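(* Let $G$ be a countable group, let $n \in \mathbb{N}$ with $n\ge 1$, and let $T_1,\dots,T_n$ be uniformly locally finite trees. Let $G$ act on the CAT(0) cube complex $X = T_1 \times \cdots \times T_n$ cubically (that is, by cube complex automorphisms). Suppose that every geodesic ray $\gamma$ in $X$ has an initial segment $p$ such that $\mathbf{Stab}_G(\gamma) = \mathbf{Stab}_G(p)$. Then the orbit equivalence relation $E_G^{\partial_{\mathfrak{R}} X}$ of the induced action of $G$ on the Roller boundary $\partial_{\mathfrak{R}} X$ of $X$ is hyperfinite.
   Context: A tree is a connected graph without cycles. A graph is uniformly locally finite if there is $M \in \mathbb{N}$ such that every vertex has valency at most $M$. The product $X=T_1\times\cdots\times T_n$ is regarded as a CAT(0) cube complex with its product cube structure; $X^{(0)}$ is its vertex set. The automorphisms in the action of $G$ may permute the factors. Paths and rays are taken in the 1-skeleton of $X$. A path $p=(p(0),\dots,p(m))$ (consecutive vertices adjacent) is geodesic if its length $m$ is minimal among all paths with the same endpoints. A ray $\gamma = (\gamma(0),\gamma(1),\dots)$ is geodesic if all its finite subpaths are geodesic. An initial segment of a geodesic ray $\gamma$ is a subpath $(\gamma(0),\dots,\gamma(m))$ for some $m\ge 0$. For an action of a group $G$ on a set and a subset $A$ of this set, $\mathbf{Stab}_G(A)=\bigcap_{a\in A}\{g\in G \mid ga=a\}$ is the pointwise stabilizer; $\mathbf{Stab}_G(\gamma)$ and $\mathbf{Stab}_G(p)$ are the pointwise stabilizers of $\gamma$ and $p$. Roller boundary: each hyperplane of $X$ determines two complementary halfspaces (subsets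 of $X^{(0)}$). An ultrafilter is a choice of exactly one halfspace for each hyperplane such that any two chosen halfspaces intersect. The set of all ultrafilters (the Roller compactification) is a closed subset of the product $\prod_{h}\{h^+,h^-\}$ over all hyperplanes $h$, where $h^{\pm}$ are the two halfspaces of $h$, hence a compact metrizable space here. Each vertex $v$ gives the ultrafilter of all halfspaces containing $v$, and $\partial_{\mathfrak{R}}X$ is the set of ultrafilters not arising from vertices, a standard Borel space with the Borel structure inherited from the compactification. Cubical automorphisms of $X$ act on $\partial_{\mathfrak{R}}X$ in the natural way. For an action of $G$ on a set $Y$, $E_G^Y$ is the orbit equivalence relation: $x\,E_G^Y\,y \iff \exists g\in G,\ gx=y$. A Borel equivalence relation $E$ on a standard Borel space is hyperfinite if there are Borel equivalence relations $E_1\subset E_2\subset\cdots$, each with all classes finite, such that $E=\bigcup_{k\in\mathbb{N}}E_k$. *)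

theory Defs
  imports "HOL-Analysis.Analysis" "HOL-Algebra.Group_Action"
begin

section \<open>Graphs and trees\<close>

text \<open>
  Simple undirected graphs are given by a vertex set and a set of two-element edges.
  Vertex paths are non-empty lists, so the length of a path \<open>p\<close> is \<open>length p - 1\<close>.
\<close>

definition simple_graph :: "'a set \<Rightarrow> 'a set set \<Rightarrow> bool" where
  "simple_graph V E \<longleftrightarrow> (\<forall>e\<in>E. e \<subseteq> V \<and> card e = 2)"

definition vertex_path :: "'a set \<Rightarrow> 'a set set \<Rightarrow> 'a list \<Rightarrow> bool" where
  "vertex_path V E p \<longleftrightarrow> p \<noteq> [] \<and> set p \<subseteq> V \<and> successively (\<lambda>x y. {x, y} \<in> E) p"

definition joined :: "'a set \<Rightarrow> 'a set set \<Rightarrow> 'a \<Rightarrow> 'a \<Rightarrow> bool" where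
  "joined V E x y \<longleftrightarrow> (\<exists>p. vertex_path V E p \<and> hd p = x \<and> last p = y)"

definition graph_components :: "'a set \<Rightarrow> 'a set set \<Rightarrow> 'a set set" where
  "graph_components V E = {{y \<in> V. joined V E x y} | x. x \<in> V}"

definition connected_graph :: "'a set \<Rightarrow> 'a set set \<Rightarrow> bool" where
  "connected_graph V E \<longleftrightarrow> V \<noteq> {} \<and> (\<forall>x\<in>V. \<forall>y\<in>V. joined V E x y)"

definition graph_cycle :: "'a set \<Rightarrow> 'a set set \<Rightarrow> 'a list \<Rightarrow> bool" where
  "graph_cycle V E c \<longleftrightarrow>
     vertex_path V E c \<and> 3 \<le> length c \<and> distinct c \<and> {last c, hd c} \<in> E"

definition tree_graph :: "'a set \<Rightarrow> 'a set set \<Rightarrow> bool" where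
  "tree_graph V E \<longleftrightarrow>
     simple_graph V E \<and> connected_graph V E \<and> \<not> (\<exists>c. graph_cycle V E c)"

definition uniformly_locally_finite :: "'a set \<Rightarrow> 'a set set \<Rightarrow> bool" where
  "uniformly_locally_finite V E \<longleftrightarrow>
     (\<exists>M. \<forall>v\<in>V. finite {e \<in> E. v \<in> e} \<and> card {e \<in> E. v \<in> e} \<le> M)"

definition geodesic_path :: "'a set \<Rightarrow> 'a set set \<Rightarrow> 'a list \<Rightarrow> bool" where
  "geodesic_path V E p \<longleftrightarrow> vertex_path V E p \<and>
     (\<forall>q. vertex_path V E q \<and> hd q = hd p \<and> last q = last p \<longrightarrow> length p \<le> length q)"

definition geodesic_ray :: "'a set \<Rightarrow> 'a set set \<Rightarrow> (nat \<Rightarrow> 'a) \<Rightarrow> bool" where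
  "geodesic_ray V E \<gamma> \<longleftrightarrow> (\<forall>i j. i \<le> j \<longrightarrow> geodesic_path V E (map \<gamma> [i..<Suc j]))"

definition initial_segment :: "'a list \<Rightarrow> (nat \<Rightarrow> 'a) \<Rightarrow> bool" where
  "initial_segment p \<gamma> \<longleftrightarrow> (\<exists>m. p = map \<gamma> [0..<Suc m])"


section \<open>Cube complexes\<close>

text \<open>
  A cube complex \<open>K\<close> is represented by the collection of the vertex sets of its cubes
  (of all dimensions, vertices being the 0-cubes). A cube of dimension \<open>d\<close> has \<open>2 ^ d\<close>
  vertices, so edges and squares are recognised by their cardinality.
\<close>

definition cc_vertices :: "'v set set \<Rightarrow> 'v set" where
  "cc_vertices K = \<Union>K"

definition cc_edges :: "'v set set \<Rightarrow> 'v set set" where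
  "cc_edges K = {e \<in> K. card e = 2}"

definition cc_squares :: "'v set set \<Rightarrow> 'v set set" where
  "cc_squares K = {s \<in> K. card s = 4}"

text \<open>The cubes of \<open>T\<^sub>1 \<times> \<dots> \<times> T\<^sub>n\<close> (factors indexed by \<open>{..<n}\<close>) are the products
  of one vertex or edge from each factor.\<close>

definition product_cubes ::
    "nat \<Rightarrow> (nat \<Rightarrow> 'a set) \<Rightarrow> (nat \<Rightarrow> 'a set set) \<Rightarrow> (nat \<Rightarrow> 'a) set set" where
  "product_cubes n V E =
     {PiE {..<n} F | F. \<forall>i<n. F i \<in> E i \<or> (\<exists>v\<in>V i. F i = {v})}"

definition cubical_automorphism :: "'v set set \<Rightarrow> ('v \<Rightarrow> 'v) \<Rightarrow> bool" where
  "cubical_automorphism K f \<longleftrightarrow> bij_betw f (cc_vertices K) (cc_vertices K) \<and>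
     (\<forall>C. C \<subseteq> cc_vertices K \<longrightarrow> (f ` C \<in> K \<longleftrightarrow> C \<in> K))"

definition cubical_action ::
    "('g, 'm) monoid_scheme \<Rightarrow> 'v set set \<Rightarrow> ('g \<Rightarrow> 'v \<Rightarrow> 'v) \<Rightarrow> bool" where
  "cubical_action G K \<phi> \<longleftrightarrow> group_action G (cc_vertices K) \<phi> \<and>
     (\<forall>g\<in>carrier G. cubical_automorphism K (\<phi> g))"

definition pointwise_stabilizer ::
    "('g, 'm) monoid_scheme \<Rightarrow> ('g \<Rightarrow> 'v \<Rightarrow> 'v) \<Rightarrow> 'v set \<Rightarrow> 'g set" where
  "pointwise_stabilizer G \<phi> A = (\<Inter>a\<in>A. stabilizer G \<phi> a)"


section \<open>Hyperplanes and halfspaces\<close>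

definition opposite_edges :: "'v set set \<Rightarrow> ('v set \<times> 'v set) set" where
  "opposite_edges K = {(e, e'). e \<in> cc_edges K \<and> e' \<in> cc_edges K \<and>
     (\<exists>s\<in>cc_squares K. e \<subseteq> s \<and> e' \<subseteq> s \<and> e \<inter> e' = {})}"

text \<open>A hyperplane is identified with the set of edges that it crosses, i.e. with a class
  of the equivalence relation generated by being opposite in a square; its halfspaces are
  the vertex sets of the components left after deleting these edges from the 1-skeleton.\<close>

definition hyperplanes :: "'v set set \<Rightarrow> 'v set set set" where
  "hyperplanes K = cc_edges K // (opposite_edges K)\<^sup>*"

definition halfspaces :: "'v set set \<Rightarrow> 'v set set \<Rightarrow> 'v set set" where
  "halfspaces K h = graph_components (cc_vertices K) (cc_edges K - h)"


section \<open>The Roller boundary\<close>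

definition ultrafilters :: "'v set set \<Rightarrow> ('v set set \<Rightarrow> 'v set) set" where
  "ultrafilters K = {\<omega> \<in> PiE (hyperplanes K) (halfspaces K).
     \<forall>h\<in>hyperplanes K. \<forall>k\<in>hyperplanes K. \<omega> h \<inter> \<omega> k \<noteq> {}}"

definition roller_topology :: "'v set set \<Rightarrow> ('v set set \<Rightarrow> 'v set) topology" where
  "roller_topology K = subtopology
     (product_topology (\<lambda>h. discrete_topology (halfspaces K h)) (hyperplanes K))
     (ultrafilters K)"

text \<open>\<open>\<omega>\<close> is the ultrafilter of \<open>v\<close> iff each halfspace chosen by \<open>\<omega>\<close> contains \<open>v\<close>.\<close>

definition roller_boundary :: "'v set set \<Rightarrow> ('v set set \<Rightarrow> 'v set) set" where
  "roller_boundary K =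
     ultrafilters K - {\<omega>. \<exists>v\<in>cc_vertices K. \<forall>h\<in>hyperplanes K. v \<in> \<omega> h}"

definition borel_of_topology :: "'x topology \<Rightarrow> 'x measure" where
  "borel_of_topology X = sigma (topspace X) {U. openin X U}"

definition roller_boundary_borel :: "'v set set \<Rightarrow> ('v set set \<Rightarrow> 'v set) measure" where
  "roller_boundary_borel K =
     restrict_space (borel_of_topology (roller_topology K)) (roller_boundary K)"

text \<open>The induced action is characterised by \<open>(g \<omega>) (g h) = g (\<omega> h)\<close>: the ultrafilter
  \<open>g \<omega>\<close> consists of the images under \<open>g\<close> of the halfspaces in \<open>\<omega>\<close>.\<close>

definition roller_action ::
    "('g, 'm) monoid_scheme \<Rightarrow> 'v set set \<Rightarrow> ('g \<Rightarrow> 'v \<Rightarrow> 'v) \<Rightarrow>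
     'g \<Rightarrow> ('v set set \<Rightarrow> 'v set) \<Rightarrow> ('v set set \<Rightarrow> 'v set)" where
  "roller_action G K \<phi> g \<omega> =
     (\<lambda>h\<in>hyperplanes K. \<phi> g ` \<omega> ((\<lambda>e. \<phi> (inv\<^bsub>G\<^esub> g) ` e) ` h))"


section \<open>Hyperfinite equivalence relations\<close>

definition orbit_equivalence ::
    "('g, 'm) monoid_scheme \<Rightarrow> 'x set \<Rightarrow> ('g \<Rightarrow> 'x \<Rightarrow> 'x) \<Rightarrow> ('x \<times> 'x) set" where
  "orbit_equivalence G Y \<alpha> = {(x, y) \<in> Y \<times> Y. \<exists>g\<in>carrier G. \<alpha> g x = y}"

text \<open>Only the \<open>\<sigma>\<close>-algebra of the measure space \<open>M\<close> is used.\<close>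

definition borel_equivalence :: "'x measure \<Rightarrow> ('x \<times> 'x) set \<Rightarrow> bool" where
  "borel_equivalence M E \<longleftrightarrow> equiv (space M) E \<and> E \<in> sets (M \<Otimes>\<^sub>M M)"

definition hyperfinite :: "'x measure \<Rightarrow> ('x \<times> 'x) set \<Rightarrow> bool" where
  "hyperfinite M E \<longleftrightarrow> borel_equivalence M E \<and>
     (\<exists>F :: nat \<Rightarrow> ('x \<times> 'x) set.
        (\<forall>k. borel_equivalence M (F k) \<and> (\<forall>x\<in>space M. finite (F k `` {x})) \<and>
             F k \<subseteq> F (Suc k)) \<and>
        E = (\<Union>k. F k))"

end

theory Submission
  imports Defs "HOL-Library.Function_Algebras"
begin

text \<open>
  An ultrafilter \<open>\<omega>\<close> on \<open>X\<close> orients every tree \<open>T\<^sub>i\<close> towards a vertex or an end. Following these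
  orientations yields commuting shifts \<open>v \<mapsto> shift e \<omega> v\<close> of the vertices, for \<open>e\<close> a vector of
  \<open>n\<close> natural numbers, and any two vertices have a common shift. A subgroup \<open>H\<close> of finite index
  in \<open>G\<close> acts by products of tree automorphisms, hence commutes with the shifts, and the orbit
  relation of \<open>H\<close> becomes an \<open>n\<close>-dimensional tail equivalence on the pairs \<open>(v, \<omega>)\<close> modulo \<open>H\<close>.
  By the hypothesis on rays, an element of \<open>H\<close> that fixes sufficiently many shifts of \<open>v\<close> fixes
  \<open>\<omega>\<close>. So a pair is determined modulo \<open>H\<close> by its finite pieces, which gives an invariant Borel
  colouring with finitely many colours at every scale \<open>t\<close>. With these colours one builds greedily
  a net that can be computed from the shifts of \<open>v\<close> alone: \<open>v\<close> moves to a shift of \<open>v\<close> in such a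
  way that all shifts of \<open>v\<close> by at most \<open>t\<close> arrive, modulo \<open>H\<close>, at a bounded number of points.
  Moving in this way along rapidly growing scales, the relations "equal modulo \<open>H\<close> after \<open>k\<close> moves"
  are finite and increasing, and their union has finitely many classes in each \<open>G\<close>-orbit. Such a
  finite extension of a hyperfinite relation is hyperfinite.
\<close>


section \<open>Finite extensions of hyperfinite relations\<close>

text \<open>Balls in the trees may grow exponentially, so a net of the whole product need not have
  boundedly many points near a vertex as the scale grows. The shifts of one vertex, however, are
  parametrised by vectors of \<open>n\<close> natural numbers, and there a box of side
  \<open>3 * t\<close> is covered by \<open>4 ^ n\<close> cells of side \<open>t\<close>, whatever
  \<open>t\<close> is. This is the origin of the constant \<open>card (vbox d 3)\<close> and the
  reason for a net that looks forward only. Each colour costs one round of the greedy construction,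
  and each round a displacement by \<open>t\<close>. The displacement has to be bounded before the
  next scale can be chosen, so at every scale the number of colours must be bounded independently of
  the boundary point. Net points of different cells need never be identified, so up to
  \<open>4 ^ n\<close> classes may remain in an \<open>H\<close>-orbit. The passage to a finite
  extension is therefore needed twice: for these classes and for the index of \<open>H\<close> in
  \<open>G\<close>.\<close>

lemma increasing_le:
  assumes "\<And>k. F k \<subseteq> F (Suc k)" "j \<le> k"
  shows "F j \<subseteq> (F k :: 'b set)"
  using lift_Suc_mono_le[of F j k] assms by auto

text \<open>Comparing the finite sets \<open>{a i x | i \<le> N x}\<close>, rather than the points themselves,
  absorbs the finite index: each of them meets all the \<open>\<Union>k. F k\<close>-classes inside its
  \<open>E\<close>-class.\<close>

lemma hyperfinite_if_finite_index:
  fixes M :: "'x measure" and a :: "nat \<Rightarrow> 'x \<Rightarrow> 'x" and F :: "nat \<Rightarrow> ('x \<times> 'x) set"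
  assumes E: "equiv (space M) E"
    and a0: "\<And>x. x \<in> space M \<Longrightarrow> a 0 x = x"
    and a_meas [measurable]: "\<And>i. a i \<in> measurable M M"
    and graph: "\<And>i. {(x, y) \<in> space M \<times> space M. a i x = y} \<in> sets (M \<Otimes>\<^sub>M M)"
    and E_a: "\<And>x. x \<in> space M \<Longrightarrow> E `` {x} = range (\<lambda>i. a i x)"
    and F_eq: "\<And>k. borel_equivalence M (F k)"
    and F_fin: "\<And>k x. x \<in> space M \<Longrightarrow> finite (F k `` {x})"
    and F_inc: "\<And>k. F k \<subseteq> F (Suc k)"
    and F_E: "\<And>k. F k \<subseteq> E"
    and index: "\<And>x. x \<in> space M \<Longrightarrow> \<exists>N. \<forall>j. \<exists>i\<le>N. \<exists>k. (a i x, a j x) \<in> F k"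
  shows "hyperfinite M E"
proof -
  have F_mono: "F j \<subseteq> F k" if "j \<le> k" for j k
    using increasing_le[of F j k] F_inc that by blast
  have F_equiv: "equiv (space M) (F k)" for k
    using F_eq by (simp add: borel_equivalence_def)
  have F_refl: "(x, x) \<in> F k" if "x \<in> space M" for x k
    using F_equiv[of k] that by (auto simp: equiv_def refl_on_def)
  have F_sym: "(y, x) \<in> F k" if "(x, y) \<in> F k" for x y k
    using F_equiv[of k] that by (auto simp: equiv_def sym_def)
  have F_trans: "(x, z) \<in> F k" if "(x, y) \<in> F k" "(y, z) \<in> F k" for x y z k
    using F_equiv[of k] that by (auto simp: equiv_def trans_def)
  have F_pred [measurable]: "Measurable.pred (M \<Otimes>\<^sub>M M) (\<lambda>p. p \<in> F k)" for k
    using F_eq[of k] unfolding borel_equivalence_def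
    by (auto intro: pred_sets2 measurable_ident)
  have a_in: "a i x \<in> space M" if "x \<in> space M" for i x
    using a_meas that by (meson measurable_space)
  have E_space: "E \<subseteq> space M \<times> space M"
    using E by (auto simp: equiv_def refl_on_def)
  have E_sym: "(y, x) \<in> E" if "(x, y) \<in> E" for x y
    using E that by (auto simp: equiv_def sym_def)
  have E_trans: "(x, z) \<in> E" if "(x, y) \<in> E" "(y, z) \<in> E" for x y z
    using E that by (auto simp: equiv_def trans_def)
  have E_ai: "(x, a i x) \<in> E" if "x \<in> space M" for i x
    using E_a[OF that] by auto
  have "E = (\<Union>i. {(x, y) \<in> space M \<times> space M. a i x = y})"
  proof (intro Set.set_eqI iffI)
    fix p assume "p \<in> E"
    then obtain x y where p: "p = (x, y)" "(x, y) \<in> E" "x \<in> space M" "y \<in> space M"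
      using E_space by (cases p) auto
    then have "y \<in> range (\<lambda>i. a i x)"
      using E_a[of x] by auto
    then show "p \<in> (\<Union>i. {(x, y) \<in> space M \<times> space M. a i x = y})"
      using p by auto
  qed (use E_ai in auto)
  then have E_borel: "borel_equivalence M E"
    using E graph by (auto simp: borel_equivalence_def intro!: sets.countable_UN)
  define Q where "Q N x \<longleftrightarrow> (\<forall>j. \<exists>i\<le>N. \<exists>k. (a i x, a j x) \<in> F k)" for N :: nat and x
  define N where "N x = (LEAST N. Q N x)" for x
  have Q_meas [measurable]: "Measurable.pred M (Q m)" for m
    unfolding Q_def by measurable
  have N_meas [measurable]: "N \<in> measurable M (count_space UNIV)"
    unfolding N_def by measurable
  have QN: "Q (N x) x" if "x \<in> space M" for x
    unfolding N_def
    by (rule LeastI_ex) (use index[OF that] in \<open>auto simp: Q_def\<close>)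
  define R where "R k = {(x, y) \<in> space M \<times> space M.
      (\<forall>i. i \<le> N x \<longrightarrow> (\<exists>j. j \<le> N y \<and> (a i x, a j y) \<in> F k)) \<and>
      (\<forall>j. j \<le> N y \<longrightarrow> (\<exists>i. i \<le> N x \<and> (a i x, a j y) \<in> F k))}" for k
  have R_sets: "R k \<in> sets (M \<Otimes>\<^sub>M M)" for k
  proof -
    have "{p \<in> space (M \<Otimes>\<^sub>M M).
      (\<forall>i. i \<le> N (fst p) \<longrightarrow> (\<exists>j. j \<le> N (snd p) \<and> (a i (fst p), a j (snd p)) \<in> F k)) \<and>
      (\<forall>j. j \<le> N (snd p) \<longrightarrow> (\<exists>i. i \<le> N (fst p) \<and> (a i (fst p), a j (snd p)) \<in> F k))}
      \<in> sets (M \<Otimes>\<^sub>M M)"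
      by measurable
    also have "?this \<longleftrightarrow> ?thesis"
      unfolding R_def by (intro arg_cong[of _ _ "\<lambda>A. A \<in> _"]) (auto simp: space_pair_measure)
    finally show ?thesis .
  qed
  have R_equiv: "equiv (space M) (R k)" for k
  proof (rule equivI)
    show "refl_on (space M) (R k)"
      unfolding refl_on_def R_def using F_refl a_in by auto
    show "sym (R k)"
      unfolding sym_def R_def by (auto; meson F_sym)
    show "trans (R k)"
      unfolding trans_def R_def by (auto; meson F_trans)
  qed (auto simp: R_def)
  have R_fin: "finite (R k `` {x})" if x: "x \<in> space M" for k x
  proof (rule finite_subset)
    \<comment> \<open>Index 0 of \<open>y\<close> is \<open>y\<close> itself, so its partner among
      the \<open>a i x\<close> confines \<open>y\<close> to finitely many finite
      \<open>F k\<close>-classes.\<close>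
    show "R k `` {x} \<subseteq> (\<Union>i\<in>{..N x}. F k `` {a i x})"
    proof
      fix y assume "y \<in> R k `` {x}"
      then obtain i where "i \<le> N x" "(a i x, a 0 y) \<in> F k" "y \<in> space M"
        unfolding R_def by auto
      then show "y \<in> (\<Union>i\<in>{..N x}. F k `` {a i x})"
        using a0 by auto
    qed
    show "finite (\<Union>i\<in>{..N x}. F k `` {a i x})"
      using F_fin a_in x by auto
  qed
  have R_E: "R k \<subseteq> E" for k
  proof
    fix p assume "p \<in> R k"
    then obtain x y j where p: "p = (x, y)" "x \<in> space M" "y \<in> space M" "(a 0 x, a j y) \<in> F k"
      unfolding R_def by auto
    then have "(x, a j y) \<in> E"
      using F_E a0 by auto
    then show "p \<in> E"
      using E_ai[OF p(3), of j] E_sym E_trans p(1) by blast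
  qed
  have R_inc: "R k \<subseteq> R (Suc k)" for k
    unfolding R_def using F_inc by blast
  have "E \<subseteq> (\<Union>k. R k)"
  proof
    fix p assume "p \<in> E"
    then obtain x y where p: "p = (x, y)" "(x, y) \<in> E" and x: "x \<in> space M" and y: "y \<in> space M"
      using E_space by (cases p) auto
    have meet: "\<exists>j\<le>N v. \<exists>k. (a i u, a j v) \<in> F k"
      if uv: "(u, v) \<in> E" "u \<in> space M" "v \<in> space M" for u v i
    proof -
      have "(v, a i u) \<in> E"
        using E_sym E_trans E_ai uv by blast
      then obtain l where "a i u = a l v"
        using E_a[OF uv(3)] by auto
      then show ?thesis
        using QN[OF uv(3)] F_sym unfolding Q_def by metis
    qed
    obtain K where K: "\<And>i. \<exists>j\<le>N y. (a i x, a j y) \<in> F (K i)"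
      using meet[OF p(2) x y] by metis
    obtain L where L: "\<And>j. \<exists>i\<le>N x. (a j y, a i x) \<in> F (L j)"
      using meet[OF E_sym[OF p(2)] y x] by metis
    \<comment> \<open>Only the indices up to \<open>N x\<close> and \<open>N y\<close> have to be
      matched, so the largest of their finitely many levels serves for all of them.\<close>
    define k where "k = Max (K ` {..N x} \<union> L ` {..N y})"
    have "K i \<le> k" if "i \<le> N x" for i
      unfolding k_def using that by (intro Max_ge) auto
    moreover have "L j \<le> k" if "j \<le> N y" for j
      unfolding k_def using that by (intro Max_ge) auto
    ultimately have "(x, y) \<in> R k"
      unfolding R_def using x y K L F_mono F_sym by (auto; meson subsetD)
    then show "p \<in> (\<Union>k. R k)"
      using p by auto
  qed
  then have "E = (\<Union>k. R k)"
    using R_E by auto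
  moreover have "borel_equivalence M (R k)" for k
    using R_equiv R_sets by (simp add: borel_equivalence_def)
  ultimately show ?thesis
    unfolding hyperfinite_def using E_borel R_fin R_inc by blast
qed

section \<open>Equivariant systems of commuting shifts\<close>

text \<open>Vectors are total functions, so that sum and order are the pointwise ones. Coordinates
  from \<open>d\<close> on are forced to be 0, which makes the box the finite order interval below
  \<open>cvec d t\<close>.\<close>

definition vbox :: "nat \<Rightarrow> nat \<Rightarrow> (nat \<Rightarrow> nat) set" where
  "vbox d t = {e. \<forall>i. e i \<le> (if i < d then t else 0)}"

definition cvec :: "nat \<Rightarrow> nat \<Rightarrow> nat \<Rightarrow> nat" where
  "cvec d t = (\<lambda>i. if i < d then t else 0)"

lemma finite_vbox: "finite (vbox d t)"
proof -
  have "vbox d t \<subseteq> {e. \<forall>i. (i \<in> {..<d} \<longrightarrow> e i \<in> {..t}) \<and> (i \<notin> {..<d} \<longrightarrow> e i = 0)}"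
    by (auto simp: vbox_def split: if_splits)
  then show ?thesis
    by (rule finite_subset) (intro finite_set_of_finite_funs; simp)
qed

lemma cvec_in_vbox: "s \<le> t \<Longrightarrow> cvec d s \<in> vbox d t"
  by (simp add: cvec_def vbox_def)

lemma cvec_add: "cvec d s + cvec d t = cvec d (s + t)"
  by (simp add: cvec_def fun_eq_iff)

lemma vbox_le: "e \<in> vbox d t \<longleftrightarrow> e \<le> cvec d t"
  by (simp add: vbox_def cvec_def le_fun_def)

lemma cvec_mono: "s \<le> t \<Longrightarrow> cvec d s \<le> cvec d t"
  by (simp add: cvec_def le_fun_def)

lemma vbox_mono: "s \<le> t \<Longrightarrow> e \<in> vbox d s \<Longrightarrow> e \<in> vbox d t"
  unfolding vbox_le using cvec_mono order_trans by blast

lemma vbox_add: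
  assumes "e \<in> vbox d s" "f \<in> vbox d t"
  shows "e + f \<in> vbox d (s + t)"
proof -
  have "e i + f i \<le> cvec d s i + cvec d t i" for i
    using assms unfolding vbox_le le_fun_def by (intro add_mono) auto
  then show ?thesis
    unfolding vbox_le by (simp add: le_fun_def flip: cvec_add)
qed

lemma vbox_diff:
  assumes "e \<in> vbox d t"
  shows "e - f \<in> vbox d t"
proof -
  have "e i - f i \<le> cvec d t i" for i
    using assms unfolding vbox_le le_fun_def by (meson diff_le_self order_trans)
  then show ?thesis
    unfolding vbox_le by (simp add: le_fun_def)
qed

lemma vec_diff_add: "e \<le> f \<Longrightarrow> f - e + e = (f :: nat \<Rightarrow> nat)"
  by (simp add: le_fun_def fun_eq_iff)

section \<open>Measurability of maps into countable spaces\<close>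

lemma measurable_count_space_binary:
  assumes f: "f \<in> measurable M (count_space A)" and g: "g \<in> measurable M (count_space B)"
    and "countable A" "countable B" and h: "\<And>a b. a \<in> A \<Longrightarrow> b \<in> B \<Longrightarrow> h a b \<in> C"
  shows "(\<lambda>x. h (f x) (g x)) \<in> measurable M (count_space C)"
proof -
  have "(\<lambda>x. h a (g x)) \<in> measurable M (count_space C)" if "a \<in> A" for a
  proof (rule measurable_compose[OF g])
    show "h a \<in> measurable (count_space B) (count_space C)"
      using h that by simp
  qed
  from measurable_compose_countable'[OF this f \<open>countable A\<close>] show ?thesis .
qed

lemma measurable_count_space_map:
  assumes "\<And>e. e \<in> set es \<Longrightarrow> f e \<in> measurable M (count_space A)" "countable A"
  shows "(\<lambda>x. map (\<lambda>e. f e x) es) \<in> measurable M (count_space (lists A))"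
  using assms(1)
proof (induction es)
  case (Cons e es)
  have "f e \<in> measurable M (count_space A)"
    and "(\<lambda>x. map (\<lambda>e. f e x) es) \<in> measurable M (count_space (lists A))"
    using Cons by simp_all
  from measurable_count_space_binary[OF this assms(2) countable_lists[OF assms(2)],
      of Cons "lists A"]
  have "(\<lambda>x. f e x # map (\<lambda>e. f e x) es) \<in> measurable M (count_space (lists A))"
    by simp
  then show ?case
    by simp
qed simp

lemma pred_eq_count_space:
  assumes "f \<in> measurable M (count_space A)" "g \<in> measurable M (count_space A)" "countable A"
  shows "Measurable.pred M (\<lambda>x. f x = g x)"
  by (rule measurable_count_space_binary[OF assms(1,2,3,3)]) simp

lemma pred_bex_countable:
  assumes "countable I" "\<And>i. i \<in> I \<Longrightarrow> Measurable.pred M (P i)"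
  shows "Measurable.pred M (\<lambda>x. \<exists>i\<in>I. P i x)"
  using assms unfolding pred_def by (intro sets.sets_Collect_countable_Ex') auto

lemma pred_ball_countable:
  assumes "countable I" "\<And>i. i \<in> I \<Longrightarrow> Measurable.pred M (P i)"
  shows "Measurable.pred M (\<lambda>x. \<forall>i\<in>I. P i x)"
  using assms unfolding pred_def by (intro sets.sets_Collect_countable_All') auto

text \<open>Isolates what the hyperfiniteness argument takes from trees: points of \<open>M\<close>
  are boundary points, elements of \<open>W\<close> are vertices, and \<open>nb t\<close> is a ball.
  That \<open>deg t\<close> is the same for all vertices will bound the number of colours. The
  hypothesis on rays enters through \<open>stabilizing\<close>, and \<open>determined\<close> lets
  countably many vertices code a point of \<open>M\<close>.\<close>

locale shift_system = group H for H :: "('g, 'm) monoid_scheme" (structure) +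
  fixes M :: "'x measure" and W :: "'w set"
    and \<alpha> :: "'g \<Rightarrow> 'x \<Rightarrow> 'x" and \<phi> :: "'g \<Rightarrow> 'w \<Rightarrow> 'w"
    and d :: nat and shift :: "(nat \<Rightarrow> nat) \<Rightarrow> 'x \<Rightarrow> 'w \<Rightarrow> 'w"
    and nb :: "nat \<Rightarrow> 'w \<Rightarrow> 'w set" and deg :: "nat \<Rightarrow> nat" and base :: 'w
  assumes countable_carrier: "countable (carrier H)"
    and countable_W: "countable W"
    and base: "base \<in> W"
    and \<alpha>_one: "x \<in> space M \<Longrightarrow> \<alpha> \<one> x = x"
    and \<alpha>_mult: "g \<in> carrier H \<Longrightarrow> h \<in> carrier H \<Longrightarrow> x \<in> space M \<Longrightarrow> \<alpha> (g \<otimes> h) x = \<alpha> g (\<alpha> h x)"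
    and \<alpha>_measurable: "g \<in> carrier H \<Longrightarrow> \<alpha> g \<in> measurable M M"
    and \<phi>_one: "w \<in> W \<Longrightarrow> \<phi> \<one> w = w"
    and \<phi>_mult: "g \<in> carrier H \<Longrightarrow> h \<in> carrier H \<Longrightarrow> w \<in> W \<Longrightarrow> \<phi> (g \<otimes> h) w = \<phi> g (\<phi> h w)"
    and \<phi>_closed: "g \<in> carrier H \<Longrightarrow> w \<in> W \<Longrightarrow> \<phi> g w \<in> W"
    and shift_closed: "x \<in> space M \<Longrightarrow> w \<in> W \<Longrightarrow> shift e x w \<in> W"
    and shift_zero: "x \<in> space M \<Longrightarrow> w \<in> W \<Longrightarrow> shift 0 x w = w"
    and shift_add: "x \<in> space M \<Longrightarrow> w \<in> W \<Longrightarrow> shift (e + f) x w = shift e x (shift f x w)"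
    and shift_equivariant: "g \<in> carrier H \<Longrightarrow> x \<in> space M \<Longrightarrow> w \<in> W \<Longrightarrow>
          shift e (\<alpha> g x) (\<phi> g w) = \<phi> g (shift e x w)"
    and shift_measurable: "w \<in> W \<Longrightarrow> (\<lambda>x. shift e x w) \<in> measurable M (count_space W)"
    and nb_W: "w \<in> W \<Longrightarrow> nb t w \<subseteq> W"
    and nb_finite: "w \<in> W \<Longrightarrow> finite (nb t w)"
    and nb_card: "w \<in> W \<Longrightarrow> card (nb t w) \<le> deg t"
    and nb_equivariant: "g \<in> carrier H \<Longrightarrow> w \<in> W \<Longrightarrow> v \<in> nb t w \<Longrightarrow> \<phi> g v \<in> nb t (\<phi> g w)"
    and nb_shift: "x \<in> space M \<Longrightarrow> w \<in> W \<Longrightarrow> e \<in> vbox d t \<Longrightarrow> f \<in> vbox d t \<Longrightarrow>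
          shift f x w \<in> nb t (shift e x w)"
    and merging: "x \<in> space M \<Longrightarrow> v \<in> W \<Longrightarrow> w \<in> W \<Longrightarrow>
          \<exists>t. \<exists>e\<in>vbox d t. \<exists>f\<in>vbox d t. shift e x v = shift f x w"
    and stabilizing: "x \<in> space M \<Longrightarrow> w \<in> W \<Longrightarrow>
          \<exists>m. \<forall>g\<in>carrier H. (\<forall>e\<in>vbox d m. \<phi> g (shift e x w) = shift e x w) \<longrightarrow> \<alpha> g x = x"
    and determined: "x \<in> space M \<Longrightarrow> y \<in> space M \<Longrightarrow> w \<in> W \<Longrightarrow>
          (\<And>t e. e \<in> vbox d t \<Longrightarrow> shift e x w = shift e y w) \<Longrightarrow> x = y"
begin

section \<open>Pairs of a point and a vertex modulo the group\<close>

definition same :: "'x \<Rightarrow> 'w \<Rightarrow> 'x \<Rightarrow> 'w \<Rightarrow> bool" where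
  "same x w y v \<longleftrightarrow> x \<in> space M \<and> w \<in> W \<and> (\<exists>g\<in>carrier H. \<alpha> g x = y \<and> \<phi> g w = v)"

lemma \<alpha>_closed: "g \<in> carrier H \<Longrightarrow> x \<in> space M \<Longrightarrow> \<alpha> g x \<in> space M"
  using \<alpha>_measurable by (meson measurable_space)

lemma \<alpha>_inv: "g \<in> carrier H \<Longrightarrow> x \<in> space M \<Longrightarrow> \<alpha> (inv g) (\<alpha> g x) = x"
  by (metis \<alpha>_mult \<alpha>_one inv_closed l_inv)

lemma \<phi>_inv: "g \<in> carrier H \<Longrightarrow> w \<in> W \<Longrightarrow> \<phi> (inv g) (\<phi> g w) = w"
  by (metis \<phi>_mult \<phi>_one inv_closed l_inv)

lemma same_carrier:
  assumes "same x w y v"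
  shows "x \<in> space M" "w \<in> W" "y \<in> space M" "v \<in> W"
  using assms \<alpha>_closed \<phi>_closed by (auto simp: same_def)

lemma same_refl: "x \<in> space M \<Longrightarrow> w \<in> W \<Longrightarrow> same x w x w"
  using \<alpha>_one \<phi>_one unfolding same_def by blast

lemma same_action: "g \<in> carrier H \<Longrightarrow> x \<in> space M \<Longrightarrow> w \<in> W \<Longrightarrow> same x w (\<alpha> g x) (\<phi> g w)"
  unfolding same_def by blast

lemma sameE:
  assumes "same x w y v"
  obtains g where "g \<in> carrier H" "x \<in> space M" "w \<in> W" "y = \<alpha> g x" "v = \<phi> g w"
  using assms unfolding same_def by blast

lemma same_sym:
  assumes "same x w y v"
  shows "same y v x w"
proof -
  obtain g where g: "g \<in> carrier H" "x \<in> space M" "w \<in> W" "y = \<alpha> g x" "v = \<phi> g w"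
    using assms by (rule sameE)
  have "same y v (\<alpha> (inv g) y) (\<phi> (inv g) v)"
    using g by (intro same_action) (auto simp: \<alpha>_closed \<phi>_closed)
  then show ?thesis
    using g by (simp add: \<alpha>_inv \<phi>_inv)
qed

lemma same_trans:
  assumes "same x w y v" "same y v z u"
  shows "same x w z u"
proof -
  obtain g where g: "g \<in> carrier H" "x \<in> space M" "w \<in> W" "y = \<alpha> g x" "v = \<phi> g w"
    using assms(1) by (rule sameE)
  obtain h where h: "h \<in> carrier H" "z = \<alpha> h y" "u = \<phi> h v"
    using assms(2) by (rule sameE)
  have "same x w (\<alpha> (h \<otimes> g) x) (\<phi> (h \<otimes> g) w)"
    using g h by (intro same_action) auto
  then show ?thesis
    using g h by (simp add: \<alpha>_mult \<phi>_mult)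
qed

lemma same_shift:
  assumes "same x w y v"
  shows "same x (shift e x w) y (shift e y v)"
proof -
  obtain g where g: "g \<in> carrier H" "x \<in> space M" "w \<in> W" "y = \<alpha> g x" "v = \<phi> g w"
    using assms by (rule sameE)
  then have "same x (shift e x w) (\<alpha> g x) (\<phi> g (shift e x w))"
    by (intro same_action shift_closed)
  then show ?thesis
    using g by (simp add: shift_equivariant)
qed

lemma shift_commute:
  assumes "x \<in> space M" "w \<in> W"
  shows "shift e x (shift f x w) = shift f x (shift e x w)"
  by (simp add: assms add.commute flip: shift_add)

lemma countable_vecs: "countable (\<Union>t. vbox d t)"
  by (simp add: countable_finite finite_vbox)

text \<open>The diagonal of \<open>M\<close> is measurable because, by \<open>determined\<close>, a
  point is coded by the countably many values \<open>shift e x base\<close>, each in the countable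
  set \<open>W\<close>.\<close>

lemma pred_eq_M:
  assumes "f \<in> measurable N M" "g \<in> measurable N M"
  shows "Measurable.pred N (\<lambda>x. f x = g x)"
proof -
  have "Measurable.pred N (\<lambda>x. \<forall>e\<in>(\<Union>t. vbox d t). shift e (f x) base = shift e (g x) base)"
  proof (intro pred_ball_countable countable_vecs)
    fix e
    have "(\<lambda>x. shift e (f x) base) \<in> measurable N (count_space W)"
      "(\<lambda>x. shift e (g x) base) \<in> measurable N (count_space W)"
      using shift_measurable[OF base] assms by (auto intro: measurable_compose)
    then show "Measurable.pred N (\<lambda>x. shift e (f x) base = shift e (g x) base)"
      using countable_W by (rule pred_eq_count_space)
  qed
  also have "?this \<longleftrightarrow> ?thesis"
  proof (rule measurable_cong)
    fix x assume "x \<in> space N"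
    then have "f x \<in> space M" "g x \<in> space M"
      using assms by (auto dest: measurable_space)
    then show "(\<forall>e\<in>(\<Union>t. vbox d t). shift e (f x) base = shift e (g x) base) \<longleftrightarrow> f x = g x"
      using determined[OF _ _ base] by auto
  qed
  finally show ?thesis .
qed

lemma graph_sets:
  assumes "f \<in> measurable M M"
  shows "{(x, y) \<in> space M \<times> space M. f x = y} \<in> sets (M \<Otimes>\<^sub>M M)"
proof -
  have "Measurable.pred (M \<Otimes>\<^sub>M M) (\<lambda>p. f (fst p) = snd p)"
    using assms by (intro pred_eq_M measurable_compose[OF measurable_fst]) auto
  then have "{p \<in> space (M \<Otimes>\<^sub>M M). f (fst p) = snd p} \<in> sets (M \<Otimes>\<^sub>M M)"
    by (simp add: pred_def)
  then show ?thesis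
    by (rule back_subst[of "\<lambda>A. A \<in> _"]) (auto simp: space_pair_measure)
qed

lemma same_pred:
  assumes "w \<in> W" "v \<in> W"
  shows "Measurable.pred M (\<lambda>x. same x w x v)"
proof -
  have "Measurable.pred M (\<lambda>x. \<exists>g\<in>carrier H. \<alpha> g x = x \<and> \<phi> g w = v)"
    by (intro pred_bex_countable countable_carrier pred_intros_logic pred_eq_M
        \<alpha>_measurable) auto
  also have "?this \<longleftrightarrow> ?thesis"
    by (intro measurable_cong) (auto simp: same_def assms)
  finally show ?thesis .
qed

subsection \<open>A finite invariant colouring\<close>

definition vecs :: "nat \<Rightarrow> (nat \<Rightarrow> nat) list" where
  "vecs m = (SOME es. set es = vbox d m)"

lemma set_vecs: "set (vecs m) = vbox d m"
  unfolding vecs_def by (rule someI_ex) (rule finite_list[OF finite_vbox])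

definition orb :: "'w list \<Rightarrow> 'w list set" where
  "orb l = (\<lambda>g. map (\<phi> g) l) ` carrier H"

text \<open>The orbit of the tuple is coded instead of the tuple, for the sake of invariance. The
  choice in \<open>vecs\<close> fixes one order in which the shifts of all pairs are listed;
  \<open>to_nat_on\<close> is injective here because \<open>lists W\<close> is countable.\<close>

definition pattern :: "nat \<Rightarrow> 'x \<Rightarrow> 'w \<Rightarrow> nat" where
  "pattern m x w = to_nat_on (orb ` lists W) (orb (map (\<lambda>e. shift e x w) (vecs m)))"

lemma orb_map:
  assumes "g \<in> carrier H" "l \<in> lists W"
  shows "orb (map (\<phi> g) l) = orb l"
proof -
  have comp: "map (\<phi> h) (map (\<phi> g) l) = map (\<phi> (h \<otimes> g)) l" if "h \<in> carrier H" for h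
    using assms that by (auto simp: \<phi>_mult in_lists_conv_set)
  show ?thesis
  proof
    show "orb (map (\<phi> g) l) \<subseteq> orb l"
      unfolding orb_def using comp assms by auto
    show "orb l \<subseteq> orb (map (\<phi> g) l)"
    proof
      fix k assume "k \<in> orb l"
      then obtain h where h: "h \<in> carrier H" "k = map (\<phi> h) l"
        unfolding orb_def by blast
      then have "k = map (\<phi> (h \<otimes> inv g)) (map (\<phi> g) l)"
        using assms comp[of "h \<otimes> inv g"] by (simp add: m_assoc l_inv)
      then show "k \<in> orb (map (\<phi> g) l)"
        unfolding orb_def using h assms by blast
    qed
  qed
qed

lemma tuple_in_lists:
  assumes "x \<in> space M" "w \<in> W"
  shows "map (\<lambda>e. shift e x w) es \<in> lists W"
  using shift_closed[OF assms] by (auto simp: in_lists_conv_set)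

lemma pattern_invariant:
  assumes "same x w y v"
  shows "pattern m x w = pattern m y v"
proof -
  obtain g where g: "g \<in> carrier H" "x \<in> space M" "w \<in> W" "y = \<alpha> g x" "v = \<phi> g w"
    using assms by (rule sameE)
  have "map (\<lambda>e. shift e y v) (vecs m) = map (\<phi> g) (map (\<lambda>e. shift e x w) (vecs m))"
    using g by (simp add: shift_equivariant)
  then show ?thesis
    using orb_map[OF g(1) tuple_in_lists[OF g(2,3)]] unfolding pattern_def by metis
qed

lemma pattern_measurable:
  assumes "w \<in> W"
  shows "(\<lambda>x. pattern m x w) \<in> measurable M (count_space UNIV)"
proof -
  have "(\<lambda>x. map (\<lambda>e. shift e x w) (vecs m)) \<in> measurable M (count_space (lists W))"
    using shift_measurable[OF assms] countable_W by (rule measurable_count_space_map)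
  then show ?thesis
    unfolding pattern_def by (rule measurable_compose) simp
qed

text \<open>This is \<open>stabilizing\<close> applied to \<open>inv h \<otimes> g\<close>.\<close>

lemma agreeing:
  assumes x: "x \<in> space M" and w: "w \<in> W"
  shows "\<exists>m. \<forall>g\<in>carrier H. \<forall>h\<in>carrier H.
    (\<forall>e\<in>vbox d m. \<phi> g (shift e x w) = \<phi> h (shift e x w)) \<longrightarrow> \<alpha> g x = \<alpha> h x"
proof -
  obtain m where m: "\<And>g. g \<in> carrier H \<Longrightarrow> (\<forall>e\<in>vbox d m. \<phi> g (shift e x w) = shift e x w) \<Longrightarrow> \<alpha> g x = x"
    using stabilizing[OF x w] by blast
  have "\<alpha> g x = \<alpha> h x"
    if g: "g \<in> carrier H" and h: "h \<in> carrier H"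
      and eq: "\<forall>e\<in>vbox d m. \<phi> g (shift e x w) = \<phi> h (shift e x w)" for g h
  proof -
    have "\<alpha> (inv h \<otimes> g) x = x"
      using g h eq shift_closed[OF x w] by (intro m) (simp_all add: \<phi>_mult \<phi>_inv)
    then have "\<alpha> (h \<otimes> (inv h \<otimes> g)) x = \<alpha> h x"
      using g h x by (simp add: \<alpha>_mult[of h])
    moreover have "h \<otimes> (inv h \<otimes> g) = g"
      using g h by (simp flip: m_assoc)
    ultimately show ?thesis
      by simp
  qed
  then show ?thesis
    by blast
qed

text \<open>For every \<open>m\<close> some \<open>h m\<close> carries the first shifts of
  \<open>w\<close> to those of \<open>v\<close>, but these elements may vary with \<open>m\<close>.
  By \<open>agreeing\<close> the points \<open>\<alpha> (h m) x\<close> are eventually constant, and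
  the constant point has the same shifts of \<open>v\<close> as \<open>x\<close>, so it is
  \<open>x\<close>. Then \<open>h k\<close> carries \<open>w\<close> to \<open>v\<close> and fixes
  \<open>x\<close>.\<close>

lemma pattern_separates:
  assumes x: "x \<in> space M" and w: "w \<in> W" and v: "v \<in> W"
    and eq: "\<And>m. pattern m x w = pattern m x v"
  shows "same x w x v"
proof -
  have "countable (orb ` lists W)"
    using countable_W by auto
  then have orb_eq: "orb (map (\<lambda>e. shift e x w) (vecs m)) = orb (map (\<lambda>e. shift e x v) (vecs m))" for m
    using eq[of m] tuple_in_lists[OF x] w v unfolding pattern_def
    by (metis imageI to_nat_on_inj)
  have "\<exists>g\<in>carrier H. \<forall>e\<in>vbox d m. \<phi> g (shift e x w) = shift e x v" for m
  proof -
    have "map (\<phi> \<one>) (map (\<lambda>e. shift e x v) (vecs m)) \<in> orb (map (\<lambda>e. shift e x v) (vecs m))"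
      unfolding orb_def by blast
    moreover have "map (\<phi> \<one>) (map (\<lambda>e. shift e x v) (vecs m)) = map (\<lambda>e. shift e x v) (vecs m)"
      using shift_closed[OF x v] by (simp add: \<phi>_one)
    ultimately have "map (\<lambda>e. shift e x v) (vecs m) \<in> orb (map (\<lambda>e. shift e x w) (vecs m))"
      unfolding orb_eq[of m] by (simp only:)
    then obtain g where g: "g \<in> carrier H"
      and "map (\<lambda>e. shift e x v) (vecs m) = map (\<phi> g) (map (\<lambda>e. shift e x w) (vecs m))"
      unfolding orb_def by blast
    then have "\<forall>e\<in>set (vecs m). \<phi> g (shift e x w) = shift e x v"
      by auto
    then show ?thesis
      using g by (auto simp: set_vecs)
  qed
  then obtain h where h: "\<And>m. h m \<in> carrier H"
    and hs: "\<And>m e. e \<in> vbox d m \<Longrightarrow> \<phi> (h m) (shift e x w) = shift e x v"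
    by metis
  obtain k where k: "\<And>g g'. g \<in> carrier H \<Longrightarrow> g' \<in> carrier H \<Longrightarrow>
      (\<forall>e\<in>vbox d k. \<phi> g (shift e x w) = \<phi> g' (shift e x w)) \<Longrightarrow> \<alpha> g x = \<alpha> g' x"
    using agreeing[OF x w] by blast
  \<comment> \<open>Both elements send the shifts of \<open>w\<close> in the box \<open>k\<close> to
    the corresponding shifts of \<open>v\<close>.\<close>
  have hx: "\<alpha> (h m) x = \<alpha> (h k) x" if "k \<le> m" for m
    by (rule k) (use h hs vbox_mono[OF that] in auto)
  have hw: "\<phi> (h m) w = v" for m
  proof -
    have "(0 :: nat \<Rightarrow> nat) \<in> vbox d m"
      by (simp add: vbox_def)
    from hs[OF this] show ?thesis
      using shift_zero[OF x] w v by simp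
  qed
  have "\<alpha> (h k) x = x"
  proof (rule determined[OF \<alpha>_closed[OF h x] x v])
    fix t e assume e: "e \<in> vbox d t"
    \<comment> \<open>Large enough for \<open>h m\<close> to act on \<open>x\<close> as
      \<open>h k\<close> does and to be known at the shift by \<open>e\<close>.\<close>
    define m where "m = max t k"
    have "e \<in> vbox d m"
      using vbox_mono[OF _ e] by (simp add: m_def)
    have "shift e (\<alpha> (h k) x) v = shift e (\<alpha> (h m) x) (\<phi> (h m) w)"
      using hx[of m] hw[of m] by (simp add: m_def)
    also have "\<dots> = \<phi> (h m) (shift e x w)"
      using h x w by (simp add: shift_equivariant)
    also have "\<dots> = shift e x v"
      using hs[OF \<open>e \<in> vbox d m\<close>] .
    finally show "shift e (\<alpha> (h k) x) v = shift e x v" .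
  qed
  then show ?thesis
    unfolding same_def using h hw x w by blast
qed

text \<open>Colour first by the orbit of an initial piece of the shifts of \<open>w\<close>, long enough to tell
  \<open>w\<close> apart from its inequivalent neighbours. This uses countably many colours; the greedy
  recolouring in the order of these colours uses at most one more than the maximal number of
  neighbours.\<close>

definition resolves :: "nat \<Rightarrow> 'x \<Rightarrow> 'w \<Rightarrow> nat \<Rightarrow> bool" where
  "resolves t x w m \<longleftrightarrow> (\<forall>v\<in>nb t w. \<not> same x w x v \<longrightarrow> (\<exists>j\<in>{..<m}. pattern j x w \<noteq> pattern j x v))"

definition resolution :: "nat \<Rightarrow> 'x \<Rightarrow> 'w \<Rightarrow> nat" where
  "resolution t x w = (LEAST m. resolves t x w m)"

definition precolour :: "nat \<Rightarrow> 'x \<Rightarrow> 'w \<Rightarrow> nat" where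
  "precolour t x w = to_nat (map (\<lambda>j. pattern j x w) [0..<resolution t x w])"

lemma resolves_resolution:
  assumes x: "x \<in> space M" and w: "w \<in> W"
  shows "resolves t x w (resolution t x w)"
  unfolding resolution_def
proof (rule LeastI_ex)
  have "\<exists>j. pattern j x w \<noteq> pattern j x v" if "v \<in> nb t w" "\<not> same x w x v" for v
    using pattern_separates[OF x w] nb_W[OF w] that by blast
  then obtain j where j: "\<And>v. v \<in> nb t w \<Longrightarrow> \<not> same x w x v \<Longrightarrow> pattern (j v) x w \<noteq> pattern (j v) x v"
    by metis
  have "j v < Suc (Max (j ` nb t w))" if "v \<in> nb t w" for v
    using that nb_finite[OF w] by (simp add: le_imp_less_Suc)
  then show "\<exists>m. resolves t x w m"
    unfolding resolves_def using j by blast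
qed

lemma resolves_invariant:
  assumes "same x w y v" "resolves t y v m"
  shows "resolves t x w m"
  unfolding resolves_def
proof (intro ballI impI)
  obtain g where g: "g \<in> carrier H" "x \<in> space M" "w \<in> W" "y = \<alpha> g x" "v = \<phi> g w"
    using assms(1) by (rule sameE)
  fix u assume u: "u \<in> nb t w" "\<not> same x w x u"
  then have "u \<in> W" "\<phi> g u \<in> nb t v"
    using g nb_W nb_equivariant by blast+
  have gu: "same x u y (\<phi> g u)"
    using g \<open>u \<in> W\<close> by (simp add: same_action)
  then have "\<not> same y v y (\<phi> g u)"
    using assms(1) u(2) same_sym same_trans by blast
  then show "\<exists>j\<in>{..<m}. pattern j x w \<noteq> pattern j x u"
    using assms(2) \<open>\<phi> g u \<in> nb t v\<close> pattern_invariant[OF gu] pattern_invariant[OF assms(1)]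
    unfolding resolves_def by auto
qed

lemma precolour_invariant:
  assumes "same x w y v"
  shows "precolour t x w = precolour t y v"
proof -
  have "resolves t x w = resolves t y v"
    using resolves_invariant assms same_sym by blast
  then show ?thesis
    using pattern_invariant[OF assms] by (simp add: precolour_def resolution_def)
qed

lemma precolour_measurable:
  assumes w: "w \<in> W"
  shows "(\<lambda>x. precolour t x w) \<in> measurable M (count_space UNIV)"
proof -
  have meas: "(\<lambda>x. pattern j x u) \<in> measurable M (count_space UNIV)"
    and meas': "Measurable.pred M (\<lambda>x. same x w x u)" if "u \<in> nb t w \<or> u = w" for u j
    using that nb_W[OF w] w by (auto intro: pattern_measurable same_pred)
  have "Measurable.pred M (\<lambda>x. resolves t x w m)" for m
    unfolding resolves_def
  proof (rule pred_ball_countable)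
    fix u assume "u \<in> nb t w"
    then have "Measurable.pred M (\<lambda>x. pattern j x w = pattern j x u)" for j
      using meas by (intro pred_eq_count_space[where A = UNIV]) auto
    then show "Measurable.pred M (\<lambda>x. \<not> same x w x u \<longrightarrow> (\<exists>j\<in>{..<m}. pattern j x w \<noteq> pattern j x u))"
      using meas'[of u] \<open>u \<in> nb t w\<close>
      by (intro pred_intros_logic pred_bex_countable) (auto simp: countable_finite)
  qed (use nb_finite[OF w] in \<open>simp add: countable_finite\<close>)
  then have [measurable]: "(\<lambda>x. resolution t x w) \<in> measurable M (count_space UNIV)"
    unfolding resolution_def by measurable
  have code: "(\<lambda>x. to_nat (map (\<lambda>j. pattern j x w) [0..<m])) \<in> measurable M (count_space UNIV)" for m
  proof -
    have "(\<lambda>x. map (\<lambda>j. pattern j x w) [0..<m]) \<in> measurable M (count_space (lists UNIV))"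
      by (rule measurable_count_space_map) (auto intro: meas)
    then show ?thesis
      by (rule measurable_compose) simp
  qed
  show ?thesis
    unfolding precolour_def
    by (rule measurable_compose_countable[where g = "\<lambda>x. resolution t x w", OF code]) measurable
qed

text \<open>The length of the coded list records the resolution. Equal codes therefore agree on a
  stretch long enough to tell \<open>w\<close> apart from every inequivalent neighbour.\<close>

lemma precolour_proper:
  assumes x: "x \<in> space M" and w: "w \<in> W" and v: "v \<in> nb t w"
    and eq: "precolour t x w = precolour t x v"
  shows "same x w x v"
proof (rule ccontr)
  assume ns: "\<not> same x w x v"
  have l: "map (\<lambda>j. pattern j x w) [0..<resolution t x w] = map (\<lambda>j. pattern j x v) [0..<resolution t x v]"
    using eq by (simp add: precolour_def)
  from arg_cong[OF l, of length] have "resolution t x w = resolution t x v"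
    by simp
  then have "pattern j x w = pattern j x v" if "j < resolution t x w" for j
    using arg_cong[OF l, of "\<lambda>l. l ! j"] that by simp
  then show False
    using resolves_resolution[OF x w, of t] v ns unfolding resolves_def by blast
qed

text \<open>The greedy recolouring as a recursion over precolours: the step from \<open>j\<close> to
  \<open>Suc j\<close> colours the points of precolour \<open>j\<close>. The value 0 of a point not
  yet coloured is a default that is never consulted, since only neighbours of precolour below
  \<open>j\<close> count. In this form measurability follows by induction on
  \<open>j\<close>.\<close>

primrec stage :: "nat \<Rightarrow> nat \<Rightarrow> 'x \<Rightarrow> 'w \<Rightarrow> nat" where
  "stage t 0 x w = 0"
| "stage t (Suc j) x w =
    (if precolour t x w = j
     then LEAST k. \<forall>v\<in>nb t w. precolour t x v < j \<and> \<not> same x w x v \<longrightarrow> stage t j x v \<noteq> k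
     else stage t j x w)"

definition colour :: "nat \<Rightarrow> 'x \<Rightarrow> 'w \<Rightarrow> nat" where
  "colour t x w = stage t (Suc (precolour t x w)) x w"

lemma stage_stable: "precolour t x w < j \<Longrightarrow> stage t j x w = colour t x w"
proof (induction j)
  case (Suc j)
  show ?case
  proof (cases "precolour t x w = j")
    case True
    then show ?thesis
      by (simp only: colour_def)
  next
    case False
    with Suc have "stage t j x w = colour t x w"
      by simp
    with False show ?thesis
      by (simp only: stage.simps if_False)
  qed
qed simp

text \<open>The recursion along the precolour, freed of the stages: once a point is coloured, later
  stages do not change it.\<close>

lemma colour_eq:
  "colour t x w = (LEAST k. \<forall>v\<in>nb t w. precolour t x v < precolour t x w \<and> \<not> same x w x v \<longrightarrow> colour t x v \<noteq> k)"
proof -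
  have "(\<forall>v\<in>nb t w. precolour t x v < precolour t x w \<and> \<not> same x w x v
        \<longrightarrow> stage t (precolour t x w) x v \<noteq> k) \<longleftrightarrow>
      (\<forall>v\<in>nb t w. precolour t x v < precolour t x w \<and> \<not> same x w x v \<longrightarrow> colour t x v \<noteq> k)" for k
    using stage_stable[of t x _ "precolour t x w"] by auto
  moreover have "colour t x w = (LEAST k. \<forall>v\<in>nb t w. precolour t x v < precolour t x w \<and> \<not> same x w x v
      \<longrightarrow> stage t (precolour t x w) x v \<noteq> k)"
    by (simp only: colour_def[of t x w] stage.simps if_True refl)
  ultimately show ?thesis
    by (simp only:)
qed

text \<open>Pigeonhole: \<open>card A\<close> values cannot exhaust the \<open>card A + 1\<close>
  numbers in \<open>{..card A}\<close>.\<close>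

lemma least_avoiding_le:
  fixes f :: "'b \<Rightarrow> nat"
  assumes "finite A"
  shows "\<exists>k\<le>card A. \<forall>v\<in>A. P v \<longrightarrow> f v \<noteq> k"
proof (rule ccontr)
  assume "\<not> ?thesis"
  then have "{..card A} \<subseteq> f ` A"
    by auto
  then have "card {..card A} \<le> card (f ` A)"
    using assms by (intro card_mono) auto
  also have "\<dots> \<le> card A"
    using assms by (rule card_image_le)
  finally show False
    by simp
qed

lemma colour_le:
  assumes "w \<in> W"
  shows "colour t x w \<le> deg t"
proof -
  obtain k where "k \<le> card (nb t w)"
    and "\<forall>v\<in>nb t w. precolour t x v < precolour t x w \<and> \<not> same x w x v \<longrightarrow> colour t x v \<noteq> k"
    using least_avoiding_le[OF nb_finite[OF assms, of t],
        of "\<lambda>v. precolour t x v < precolour t x w \<and> \<not> same x w x v" "colour t x"] by blast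
  then have "colour t x w \<le> k"
    by (subst colour_eq) (rule Least_le)
  then show ?thesis
    using \<open>k \<le> card (nb t w)\<close> nb_card[OF assms, of t] by simp
qed

lemma colour_less_neq:
  assumes w: "w \<in> W" and v: "v \<in> nb t w" "precolour t x v < precolour t x w" "\<not> same x w x v"
  shows "colour t x w \<noteq> colour t x v"
proof -
  define P where "P k \<longleftrightarrow> (\<forall>v\<in>nb t w. precolour t x v < precolour t x w \<and> \<not> same x w x v
    \<longrightarrow> colour t x v \<noteq> k)" for k
  have "\<exists>k. P k"
    unfolding P_def using least_avoiding_le[OF nb_finite[OF w, of t],
        of "\<lambda>v. precolour t x v < precolour t x w \<and> \<not> same x w x v" "colour t x"] by blast
  then have "P (LEAST k. P k)"
    by (rule LeastI_ex)
  then have "P (colour t x w)"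
    using colour_eq[of t x w] unfolding P_def by simp
  then show ?thesis
    unfolding P_def using v by auto
qed

text \<open>The point with the larger precolour avoids the colour of the other one, so it must see
  it as a neighbour; \<open>nb\<close> is not assumed to be symmetric, hence both hypotheses. For
  equal precolours \<open>precolour_proper\<close> applies.\<close>

lemma colour_proper:
  assumes x: "x \<in> space M" and w: "w \<in> W" and v: "v \<in> nb t w" "w \<in> nb t v"
    and eq: "colour t x w = colour t x v"
  shows "same x w x v"
proof (cases "precolour t x w" "precolour t x v" rule: linorder_cases)
  case less
  have "v \<in> W"
    using nb_W[OF w] v by blast
  then have "same x v x w"
    using colour_less_neq[OF _ v(2) less] eq by auto
  then show ?thesis
    by (rule same_sym)
next
  case equal
  then show ?thesis
    by (rule precolour_proper[OF x w v(1)])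
next
  case greater
  then show ?thesis
    using colour_less_neq[OF w v(1) greater] eq by auto
qed

lemma stage_measurable:
  "w \<in> W \<Longrightarrow> (\<lambda>x. stage t j x w) \<in> measurable M (count_space UNIV)"
proof (induction j arbitrary: w)
  case (Suc j)
  have [measurable]: "(\<lambda>x. precolour t x w) \<in> measurable M (count_space UNIV)"
    "(\<lambda>x. stage t j x w) \<in> measurable M (count_space UNIV)"
    using Suc precolour_measurable by auto
  have "Measurable.pred M (\<lambda>x. \<forall>v\<in>nb t w. precolour t x v < j \<and> \<not> same x w x v \<longrightarrow> stage t j x v \<noteq> k)"
    for k
  proof (rule pred_ball_countable)
    fix v assume "v \<in> nb t w"
    then have "v \<in> W"
      using nb_W[OF Suc.prems] by blast
    then have [measurable]: "(\<lambda>x. precolour t x v) \<in> measurable M (count_space UNIV)"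
      "(\<lambda>x. stage t j x v) \<in> measurable M (count_space UNIV)"
      "Measurable.pred M (\<lambda>x. same x w x v)"
      using Suc precolour_measurable same_pred by auto
    show "Measurable.pred M (\<lambda>x. precolour t x v < j \<and> \<not> same x w x v \<longrightarrow> stage t j x v \<noteq> k)"
      by measurable
  qed (use nb_finite[OF Suc.prems] in \<open>simp add: countable_finite\<close>)
  then have [measurable]: "(\<lambda>x. LEAST k. \<forall>v\<in>nb t w. precolour t x v < j \<and> \<not> same x w x v \<longrightarrow> stage t j x v \<noteq> k)
      \<in> measurable M (count_space UNIV)"
    by measurable
  show ?case
    unfolding stage.simps by measurable
qed simp

lemma colour_measurable:
  assumes "w \<in> W"
  shows "(\<lambda>x. colour t x w) \<in> measurable M (count_space UNIV)"
  unfolding colour_def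
  by (rule measurable_compose_countable[where g = "\<lambda>x. precolour t x w" and f = "\<lambda>j x. stage t (Suc j) x w"])
    (intro stage_measurable precolour_measurable assms)+

text \<open>Induction on the precolour, which is invariant. A group element relating the two pairs
  carries competing neighbours to competing neighbours in both directions, and by induction their
  colours agree, so the same colours are forbidden on both sides.\<close>

lemma colour_invariant:
  "same x w y v \<Longrightarrow> colour t x w = colour t y v"
proof (induction "precolour t x w" arbitrary: x w y v rule: less_induct)
  case less
  have transport: "\<exists>u'\<in>nb t v. precolour t y u' < precolour t y v \<and> \<not> same y v y u' \<and> same x u y u'"
    if wv: "same x w y v" and u: "u \<in> nb t w" "precolour t x u < precolour t x w" "\<not> same x w x u"
    for x w y v u
  proof -
    obtain g where g: "g \<in> carrier H" "x \<in> space M" "w \<in> W" "y = \<alpha> g x" "v = \<phi> g w"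
      using wv by (rule sameE)
    have "u \<in> W" "\<phi> g u \<in> nb t v"
      using g u nb_W nb_equivariant by blast+
    have gu: "same x u y (\<phi> g u)"
      using g \<open>u \<in> W\<close> by (simp add: same_action)
    moreover have "\<not> same y v y (\<phi> g u)"
      using wv gu u(3) same_sym same_trans by blast
    moreover have "precolour t y (\<phi> g u) < precolour t y v"
      using u(2) precolour_invariant[OF gu] precolour_invariant[OF wv] by simp
    ultimately show ?thesis
      using \<open>\<phi> g u \<in> nb t v\<close> by blast
  qed
  have pre: "precolour t x w = precolour t y v"
    using precolour_invariant[OF less.prems] .
  have "(\<forall>u\<in>nb t w. precolour t x u < precolour t x w \<and> \<not> same x w x u \<longrightarrow> colour t x u \<noteq> k) \<longleftrightarrow>
      (\<forall>u\<in>nb t v. precolour t y u < precolour t y v \<and> \<not> same y v y u \<longrightarrow> colour t y u \<noteq> k)" for k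
  proof (intro iffI ballI impI)
    fix u assume *: "\<forall>u\<in>nb t w. precolour t x u < precolour t x w \<and> \<not> same x w x u \<longrightarrow> colour t x u \<noteq> k"
      and u: "u \<in> nb t v" "precolour t y u < precolour t y v \<and> \<not> same y v y u"
    obtain u' where u': "u' \<in> nb t w" "precolour t x u' < precolour t x w" "\<not> same x w x u'"
      "same y u x u'"
      using transport[OF same_sym[OF less.prems], of u] u by blast
    then have "colour t x u' = colour t y u"
      using less.hyps[OF _ same_sym[OF u'(4)]] by simp
    then show "colour t y u \<noteq> k"
      using * u' by metis
  next
    fix u assume *: "\<forall>u\<in>nb t v. precolour t y u < precolour t y v \<and> \<not> same y v y u \<longrightarrow> colour t y u \<noteq> k"
      and u: "u \<in> nb t w" "precolour t x u < precolour t x w \<and> \<not> same x w x u"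
    obtain u' where u': "u' \<in> nb t v" "precolour t y u' < precolour t y v" "\<not> same y v y u'"
      "same x u y u'"
      using transport[OF less.prems, of u] u by blast
    then have "colour t x u = colour t y u'"
      using less.hyps u by blast
    then show "colour t x u \<noteq> k"
      using * u' by metis
  qed
  then show ?case
    unfolding colour_eq[of t x w] colour_eq[of t y v] by simp
qed

subsection \<open>Nets along the shifts\<close>

lemma measurable_at_shift:
  assumes "\<And>u. u \<in> W \<Longrightarrow> (\<lambda>x. F u x) \<in> measurable M N" "w \<in> W"
  shows "(\<lambda>x. F (shift e x w) x) \<in> measurable M N"
  by (rule measurable_compose_countable'[where g = "\<lambda>x. shift e x w" and f = F,
        OF assms(1) shift_measurable[OF assms(2)] countable_W])

text \<open>\<open>mark t j x w\<close> is the result, as seen from \<open>w\<close>, of the first \<open>j\<close> rounds of a greedy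
  construction of a \<open>t\<close>-separated net, where round \<open>j\<close> adds points of colour \<open>j\<close>. The point
  concerned is not \<open>w\<close> itself but its shift by \<open>j * t\<close>, so that the points up to distance \<open>t\<close>
  from it, in all directions, are again shifts of \<open>w\<close>.\<close>

primrec mark :: "nat \<Rightarrow> nat \<Rightarrow> 'x \<Rightarrow> 'w \<Rightarrow> bool" where
  "mark t 0 x w = False"
| "mark t (Suc j) x w =
    (mark t j x (shift (cvec d t) x w) \<or>
     (colour t x (shift (cvec d (Suc j * t)) x w) = j \<and>
      (\<forall>e\<in>vbox d (2 * t). \<not> mark t j x (shift e x w))))"

lemma mark_invariant: "same x w y v \<Longrightarrow> mark t j x w = mark t j y v"
proof (induction j arbitrary: w v)
  case (Suc j)
  have "mark t j x (shift e x w) = mark t j y (shift e y v)" for e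
    using Suc.IH same_shift[OF Suc.prems] by blast
  moreover have "colour t x (shift e x w) = colour t y (shift e y v)" for e
    using colour_invariant same_shift[OF Suc.prems] by blast
  ultimately show ?case
    by simp
qed simp

lemma mark_measurable: "w \<in> W \<Longrightarrow> Measurable.pred M (\<lambda>x. mark t j x w)"
proof (induction j arbitrary: w)
  case (Suc j)
  have mark: "Measurable.pred M (\<lambda>x. mark t j x (shift e x w))" for e
    using Suc by (rule measurable_at_shift)
  have "(\<lambda>x. colour t x (shift (cvec d (Suc j * t)) x w)) \<in> measurable M (count_space UNIV)"
    using colour_measurable Suc.prems by (rule measurable_at_shift)
  then have "Measurable.pred M (\<lambda>x. colour t x (shift (cvec d (Suc j * t)) x w) = j)"
    by (rule pred_eq_count_space) auto
  moreover have "Measurable.pred M (\<lambda>x. \<forall>e\<in>vbox d (2 * t). \<not> mark t j x (shift e x w))"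
    using mark by (intro pred_ball_countable pred_intros_logic) (auto simp: finite_vbox countable_finite)
  ultimately show ?case
    unfolding mark.simps by (intro pred_intros_logic mark)
qed simp

text \<open>The first disjunct of \<open>mark\<close> preserves old marks. The net point seen from
  \<open>w\<close> after \<open>j + i\<close> rounds is the one seen after \<open>j\<close> rounds
  from the shift of \<open>w\<close> by \<open>i * t\<close>.\<close>

lemma mark_mono:
  assumes x: "x \<in> space M"
  shows "w \<in> W \<Longrightarrow> mark t j x (shift (cvec d (i * t)) x w) \<Longrightarrow> mark t (j + i) x w"
proof (induction i arbitrary: w)
  case 0
  then show ?case
    using shift_zero[OF x] by (simp add: cvec_def zero_fun_def)
next
  case (Suc i)
  have "shift (cvec d (Suc i * t)) x w = shift (cvec d (i * t)) x (shift (cvec d t) x w)"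
    using x Suc.prems by (simp add: cvec_add add.commute flip: shift_add)
  then have "mark t (j + i) x (shift (cvec d t) x w)"
    using Suc.IH[OF shift_closed[OF x Suc.prems(1)]] Suc.prems(2) by simp
  then show ?case
    by simp
qed

text \<open>Induction over the rounds. Two old marks are covered by the induction hypothesis at the
  shift of \<open>w\<close> by \<open>t\<close>; two new ones have the same colour at neighbouring
  points, so \<open>colour_proper\<close> applies. A mixed pair cannot occur: seen from
  \<open>shift e x w\<close>, the old mark at \<open>f\<close> has displacement
  \<open>cvec d t + f - e\<close>, and the window \<open>2 * t\<close> in \<open>mark\<close>
  contains all such vectors.\<close>

lemma mark_separated:
  assumes x: "x \<in> space M"
  shows "w \<in> W \<Longrightarrow> e \<in> vbox d t \<Longrightarrow> f \<in> vbox d t \<Longrightarrow>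
    mark t j x (shift e x w) \<Longrightarrow> mark t j x (shift f x w) \<Longrightarrow>
    same x (shift (cvec d (j * t) + e) x w) x (shift (cvec d (j * t) + f) x w)"
proof (induction j arbitrary: w e f)
  case (Suc j)
  define old where "old e \<longleftrightarrow> mark t j x (shift (cvec d t) x (shift e x w))" for e
  define new where "new e \<longleftrightarrow> colour t x (shift (cvec d (Suc j * t)) x (shift e x w)) = j \<and>
      (\<forall>h\<in>vbox d (2 * t). \<not> mark t j x (shift h x (shift e x w)))" for e
  have conflict: False if "old f" "new e" "e \<in> vbox d t" "f \<in> vbox d t" for e f
  proof -
    have "e \<le> cvec d t"
      using that vbox_le by blast
    \<comment> \<open>The extra \<open>cvec d t\<close>, by which old marks are looked up, makes the
      truncated subtraction below exact.\<close>
    then have le: "e \<le> cvec d t + f"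
      by (simp add: le_fun_def trans_le_add1)
    have "mark t j x (shift (cvec d t + f - e) x (shift e x w))"
      using that(1) x Suc.prems(1) unfolding old_def by (simp add: vec_diff_add[OF le] flip: shift_add)
    moreover have "cvec d t + f - e \<in> vbox d (2 * t)"
      using vbox_diff[OF vbox_add[OF cvec_in_vbox[OF order_refl] that(4), of t]] by (simp add: mult_2)
    ultimately show False
      using that(2) unfolding new_def by blast
  qed
  consider "old e" "old f" | "new e" "new f"
    using Suc.prems conflict unfolding mark.simps old_def new_def by blast
  then show ?case
  proof cases
    case 1
    define u where "u = shift (cvec d t) x w"
    have u: "u \<in> W"
      unfolding u_def by (rule shift_closed[OF x Suc.prems(1)])
    have shift_u: "shift g x u = shift (cvec d t) x (shift g x w)" for g
      unfolding u_def by (rule shift_commute[OF x Suc.prems(1)])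
    have eq: "shift (cvec d (j * t) + g) x u = shift (cvec d (Suc j * t) + g) x w" for g
    proof -
      have "cvec d (j * t) + g + cvec d t = cvec d (Suc j * t) + g"
        by (simp add: add.commute add.left_commute flip: cvec_add)
      then show ?thesis
        unfolding u_def using x Suc.prems(1) by (simp flip: shift_add)
    qed
    have "same x (shift (cvec d (j * t) + e) x u) x (shift (cvec d (j * t) + f) x u)"
      using 1 unfolding old_def shift_u[symmetric] by (rule Suc.IH[OF u Suc.prems(2,3)])
    then show ?thesis
      by (simp only: eq)
  next
    case 2
    define u where "u = shift (cvec d (Suc j * t)) x w"
    have u: "u \<in> W"
      unfolding u_def by (rule shift_closed[OF x Suc.prems(1)])
    have shift_u: "shift (cvec d (Suc j * t)) x (shift g x w) = shift g x u" for g
      unfolding u_def by (rule shift_commute[OF x Suc.prems(1)])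
    have "same x (shift e x u) x (shift f x u)"
    proof (rule colour_proper[OF x shift_closed[OF x u]])
      show "shift f x u \<in> nb t (shift e x u)" "shift e x u \<in> nb t (shift f x u)"
        using nb_shift[OF x u] Suc.prems by blast+
      show "colour t x (shift e x u) = colour t x (shift f x u)"
        using 2 unfolding new_def shift_u by simp
    qed
    moreover have "shift (cvec d (Suc j * t) + g) x w = shift g x u" for g
      using x Suc.prems(1) by (simp only: shift_add shift_u)
    ultimately show ?thesis
      by (simp only:)
  qed
qed simp

text \<open>Colours are at most \<open>deg t\<close> and the step from \<open>j\<close> to
  \<open>Suc j\<close> treats colour \<open>j\<close>, so this number of rounds treats every
  colour.\<close>

definition rounds :: "nat \<Rightarrow> nat" where "rounds t = Suc (deg t)"

definition marked :: "nat \<Rightarrow> 'x \<Rightarrow> 'w \<Rightarrow> (nat \<Rightarrow> nat) set" where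
  "marked t x w = {e \<in> vbox d (2 * t). mark t (rounds t) x (shift e x w)}"

text \<open>The choice is made in a set of vectors and not of vertices: \<open>marked\<close> is
  invariant, so equivalent pairs get the same vector and \<open>land\<close> becomes equivariant. As
  \<open>marked\<close> has finitely many possible values, measurability survives the
  choice.\<close>

definition jump :: "nat \<Rightarrow> 'x \<Rightarrow> 'w \<Rightarrow> (nat \<Rightarrow> nat)" where
  "jump t x w = cvec d (rounds t * t) + (SOME e. e \<in> marked t x w)"

definition reach :: "nat \<Rightarrow> nat" where "reach t = rounds t * t + 2 * t"

definition land :: "nat \<Rightarrow> 'x \<Rightarrow> 'w \<Rightarrow> 'w" where
  "land t x w = shift (jump t x w) x w"

text \<open>Maximality of the net. Let \<open>j\<close> be the colour of \<open>u\<close>. In the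
  round treating \<open>j\<close>, the vertex \<open>y\<close> is either marked or kept out by an
  older mark within \<open>2 * t\<close>, and \<open>mark_mono\<close> carries the mark on to the
  last round. The vector found is \<open>cvec d t\<close> in the first case and the one of the older
  mark in the second.\<close>

lemma marked_nonempty:
  assumes x: "x \<in> space M" and w: "w \<in> W"
  shows "marked t x w \<noteq> {}"
proof -
  define u where "u = shift (cvec d (Suc (rounds t) * t)) x w"
  define j where "j = colour t x u"
  have j: "j < rounds t"
    using colour_le[of u t] shift_closed[OF x w] unfolding j_def u_def rounds_def by (simp add: le_imp_less_Suc)
  \<comment> \<open>Chosen such that \<open>u\<close> is the point whose colour the step from
    \<open>j\<close> to \<open>Suc j\<close> tests at \<open>y\<close>.\<close>
  define y where "y = shift (cvec d ((rounds t - j) * t)) x w"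
  have y: "y \<in> W"
    unfolding y_def by (rule shift_closed[OF x w])
  have "(Suc (rounds t) * t) = Suc j * t + (rounds t - j) * t"
    using j by (simp flip: add_mult_distrib)
  then have u: "u = shift (cvec d (Suc j * t)) x y"
    unfolding u_def y_def using x w by (simp only: cvec_add flip: shift_add)
  show ?thesis
  proof (cases "\<forall>e\<in>vbox d (2 * t). \<not> mark t j x (shift e x y)")
    case True
    moreover have "colour t x (shift (cvec d (Suc j * t)) x y) = j"
      unfolding u[symmetric] by (rule j_def[symmetric])
    ultimately have "mark t (Suc j) x y"
      unfolding mark.simps by blast
    moreover have "y = shift (cvec d ((rounds t - Suc j) * t)) x (shift (cvec d t) x w)"
    proof -
      have "(rounds t - j) * t = (rounds t - Suc j) * t + t"
      proof -
        have "rounds t - j = Suc (rounds t - Suc j)"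
          using j by simp
        then show ?thesis
          by (simp only: mult_Suc add.commute)
      qed
      then show ?thesis
        unfolding y_def using x w by (simp only: cvec_add flip: shift_add)
    qed
    ultimately have "mark t (Suc j) x (shift (cvec d ((rounds t - Suc j) * t)) x (shift (cvec d t) x w))"
      by (simp only:)
    from mark_mono[OF x shift_closed[OF x w] this]
    have "mark t (rounds t) x (shift (cvec d t) x w)"
      using j by (simp only: le_add_diff_inverse Suc_leI)
    moreover have "cvec d t \<in> vbox d (2 * t)"
      by (intro cvec_in_vbox) simp
    ultimately show ?thesis
      unfolding marked_def by blast
  next
    case False
    then obtain e where e: "e \<in> vbox d (2 * t)" "mark t j x (shift e x y)"
      by blast
    have "shift e x y = shift (cvec d ((rounds t - j) * t)) x (shift e x w)"
      unfolding y_def by (rule shift_commute[OF x w])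
    with e(2) have "mark t j x (shift (cvec d ((rounds t - j) * t)) x (shift e x w))"
      by (simp only:)
    from mark_mono[OF x shift_closed[OF x w] this]
    have "mark t (rounds t) x (shift e x w)"
      using j by (simp only: le_add_diff_inverse less_imp_le)
    then show ?thesis
      unfolding marked_def using e(1) by blast
  qed
qed

lemma some_marked:
  assumes "x \<in> space M" "w \<in> W"
  shows "(SOME e. e \<in> marked t x w) \<in> marked t x w"
  using marked_nonempty[OF assms] by (simp add: some_in_eq)

lemma jump_in_vbox:
  assumes "x \<in> space M" "w \<in> W"
  shows "jump t x w \<in> vbox d (reach t)"
proof -
  have "(SOME e. e \<in> marked t x w) \<in> vbox d (2 * t)"
    using some_marked[OF assms] unfolding marked_def by blast
  then show ?thesis
    unfolding jump_def reach_def by (intro vbox_add cvec_in_vbox) auto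
qed

text \<open>Every move advances every coordinate. After \<open>N\<close> moves a vertex has thus
  passed all its shifts by vectors in \<open>vbox d N\<close>, in particular its meeting points with
  other vertices there.\<close>

lemma jump_ge: "1 \<le> t \<Longrightarrow> cvec d 1 \<le> jump t x w"
  unfolding jump_def rounds_def by (simp add: le_fun_def cvec_def)

lemma marked_invariant:
  assumes "same x w y v"
  shows "marked t x w = marked t y v"
  unfolding marked_def by (simp only: mark_invariant[OF same_shift[OF assms]])

lemma land_equivariant:
  assumes "g \<in> carrier H" "x \<in> space M" "w \<in> W"
  shows "land t (\<alpha> g x) (\<phi> g w) = \<phi> g (land t x w)"
  using assms marked_invariant[OF same_action[OF assms], of t]
  by (simp add: land_def jump_def shift_equivariant)

lemma land_closed: "x \<in> space M \<Longrightarrow> w \<in> W \<Longrightarrow> land t x w \<in> W"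
  by (simp add: land_def shift_closed)

lemma land_measurable:
  assumes w: "w \<in> W"
  shows "(\<lambda>x. land t x w) \<in> measurable M (count_space W)"
proof -
  have fin: "finite (Pow (vbox d (2 * t)))"
    by (simp add: finite_vbox)
  have "(\<lambda>x. marked t x w) \<in> measurable M (count_space (Pow (vbox d (2 * t))))"
    unfolding measurable_count_space_eq_countable[OF countable_finite[OF fin]]
  proof (intro conjI ballI)
    show "(\<lambda>x. marked t x w) \<in> space M \<rightarrow> Pow (vbox d (2 * t))"
      unfolding marked_def by auto
    fix A assume A: "A \<in> Pow (vbox d (2 * t))"
    have "Measurable.pred M (\<lambda>x. mark t (rounds t) x (shift e x w) \<longleftrightarrow> e \<in> A)" for e
      using measurable_at_shift[OF mark_measurable w] by (intro pred_intros_logic) auto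
    then have "Measurable.pred M (\<lambda>x. \<forall>e\<in>vbox d (2 * t). mark t (rounds t) x (shift e x w) \<longleftrightarrow> e \<in> A)"
      by (intro pred_ball_countable) (auto simp: finite_vbox countable_finite)
    moreover have "(\<lambda>x. marked t x w) -` {A} \<inter> space M =
        {x \<in> space M. \<forall>e\<in>vbox d (2 * t). mark t (rounds t) x (shift e x w) \<longleftrightarrow> e \<in> A}"
      using A unfolding marked_def by auto
    ultimately show "(\<lambda>x. marked t x w) -` {A} \<inter> space M \<in> sets M"
      by (simp add: pred_def)
  qed
  then show ?thesis
    unfolding land_def jump_def
    by (rule measurable_compose_countable'[where
          f = "\<lambda>A x. shift (cvec d (rounds t * t) + (SOME e. e \<in> A)) x w",
          OF shift_measurable[OF w] _ countable_finite[OF fin]])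
qed

text \<open>The landing displacement from \<open>w\<close> is \<open>cvec d (rounds t * t)\<close>
  plus a marked vector \<open>e + f\<close> in \<open>vbox d (3 * t)\<close>. Division by
  \<open>t\<close> sorts these vectors into cells with quotients in \<open>vbox d 3\<close>, and
  \<open>mark_separated\<close> identifies, modulo the group, all landing points of one cell. The
  bound does not involve \<open>t\<close>.\<close>

lemma land_few:
  assumes x: "x \<in> space M" and w: "w \<in> W" and t: "1 \<le> t"
  shows "\<exists>C. finite C \<and> card C \<le> card (vbox d 3) \<and>
    (\<forall>f\<in>vbox d t. \<exists>v\<in>C. same x v x (land t x (shift f x w)))"
proof -
  define P where "P q u \<longleftrightarrow> u \<in> vbox d (3 * t) \<and> mark t (rounds t) x (shift u x w) \<and>
      (\<lambda>i. u i div t) = q" for q u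
  \<comment> \<open>One candidate for each cell \<open>q\<close>. A cell without marked vectors
    contributes an arbitrary shift, which only enlarges \<open>C\<close>.\<close>
  define C where "C = (\<lambda>q. shift (cvec d (rounds t * t) + (SOME u. P q u)) x w) ` vbox d 3"
  have "\<exists>v\<in>C. same x v x (land t x (shift f x w))" if f: "f \<in> vbox d t" for f
  proof -
    define e where "e = (SOME e. e \<in> marked t x (shift f x w))"
    have e: "e \<in> vbox d (2 * t)" "mark t (rounds t) x (shift e x (shift f x w))"
      using some_marked[OF x shift_closed[OF x w]] unfolding e_def marked_def by blast+
    define u where "u = e + f"
    define q where "q = (\<lambda>i. u i div t)"
    have u: "u \<in> vbox d (3 * t)"
      using vbox_add[OF e(1) f] by (simp add: u_def)
    have Pu: "P q u"
      unfolding P_def using u e(2) x w by (simp add: u_def q_def shift_add)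
    have q: "q \<in> vbox d 3"
      unfolding vbox_def
    proof (intro CollectI allI)
      fix i
      have "u i \<le> (if i < d then 3 * t else 0)"
        using u by (simp add: vbox_def)
      then have "u i div t \<le> (if i < d then 3 * t else 0) div t"
        by (rule div_le_mono)
      then show "q i \<le> (if i < d then 3 else 0)"
        using t by (simp add: q_def split: if_splits)
    qed
    define v where "v = (SOME u. P q u)"
    have Pv: "P q v"
      unfolding v_def by (rule someI[of "P q", OF Pu])
    \<comment> \<open>The corner of the cell. Counted from it, the marked vectors of the cell are
      remainders in \<open>vbox d t\<close>, as \<open>mark_separated\<close> wants.\<close>
    define w' where "w' = shift (\<lambda>i. t * q i) x w"
    have w': "w' \<in> W"
      unfolding w'_def by (rule shift_closed[OF x w])
    have rem: "(\<lambda>i. z i mod t) \<in> vbox d t" "z = (\<lambda>i. z i mod t) + (\<lambda>i. t * q i)" if "P q z" for z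
    proof -
      have z: "z i = 0" if "\<not> i < d" for i
        using \<open>P q z\<close> that by (auto simp: P_def vbox_def split: if_splits dest: spec[of _ i])
      show "(\<lambda>i. z i mod t) \<in> vbox d t"
        using t z by (auto simp: vbox_def less_imp_le)
      have "q i = z i div t" for i
        using that by (auto simp: P_def)
      then show "z = (\<lambda>i. z i mod t) + (\<lambda>i. t * q i)"
        by (simp add: fun_eq_iff)
    qed
    have shift_rem: "shift (g + (\<lambda>i. z i mod t)) x w' = shift (g + z) x w" if "P q z" for z g
    proof -
      have "g + z = g + ((\<lambda>i. z i mod t) + (\<lambda>i. t * q i))"
        using rem(2)[OF that] by (rule arg_cong)
      then show ?thesis
        unfolding w'_def by (simp only: shift_add[OF x w, symmetric] add.assoc)
    qed
    have shift_rem0: "shift (\<lambda>i. z i mod t) x w' = shift z x w" if "P q z" for z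
      using shift_rem[OF that, of 0] by (simp only: add_0)
    have "same x (shift (cvec d (rounds t * t) + (\<lambda>i. v i mod t)) x w')
        x (shift (cvec d (rounds t * t) + (\<lambda>i. u i mod t)) x w')"
      by (rule mark_separated[OF x w']) (use rem Pu Pv shift_rem0 in \<open>auto simp: P_def\<close>)
    then have "same x (shift (cvec d (rounds t * t) + v) x w) x (shift (cvec d (rounds t * t) + u) x w)"
      by (simp only: shift_rem[OF Pu] shift_rem[OF Pv])
    moreover have "shift (cvec d (rounds t * t) + u) x w = land t x (shift f x w)"
      unfolding land_def jump_def u_def using x w by (simp add: e_def shift_add add.assoc[symmetric] shift_closed)
    moreover have "shift (cvec d (rounds t * t) + v) x w \<in> C"
      unfolding C_def v_def using q by blast
    ultimately show ?thesis
      by auto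
  qed
  moreover have "finite C"
    unfolding C_def by (simp add: finite_vbox)
  moreover have "card C \<le> card (vbox d 3)"
    unfolding C_def by (intro card_image_le finite_vbox)
  ultimately show ?thesis
    by blast
qed

subsection \<open>The approximating relations\<close>

text \<open>The scale of the \<open>n\<close>-th step exceeds \<open>n\<close> plus the total displacement \<open>disp n\<close> of the
  previous steps. Hence points that have a common shift at distance \<open>n\<close> are so close, compared
  with this scale, that \<open>land_few\<close> applies to all of them at once.\<close>

primrec disp :: "nat \<Rightarrow> nat" where
  "disp 0 = 0"
| "disp (Suc n) = disp n + reach (Suc (n + disp n))"

primrec descend :: "nat \<Rightarrow> 'x \<Rightarrow> 'w \<Rightarrow> 'w" where
  "descend 0 x w = w"
| "descend (Suc n) x w = land (Suc (n + disp n)) x (descend n x w)"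

lemma descend_closed: "x \<in> space M \<Longrightarrow> w \<in> W \<Longrightarrow> descend n x w \<in> W"
  by (induction n) (simp_all add: land_closed)

lemma descend_equivariant:
  assumes "g \<in> carrier H" "x \<in> space M" "w \<in> W"
  shows "descend n (\<alpha> g x) (\<phi> g w) = \<phi> g (descend n x w)"
  by (induction n) (simp_all add: land_equivariant descend_closed assms)

lemma descend_measurable:
  assumes "w \<in> W"
  shows "(\<lambda>x. descend n x w) \<in> measurable M (count_space W)"
proof (induction n)
  case (Suc n)
  have "(\<lambda>x. land (Suc (n + disp n)) x (descend n x w)) \<in> measurable M (count_space W)"
    by (rule measurable_compose_countable'[where g = "\<lambda>x. descend n x w" and
          f = "\<lambda>v x. land (Suc (n + disp n)) x v", OF land_measurable Suc.IH countable_W])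
  then show ?case
    by simp
qed (simp add: assms)

lemma descend_shift:
  assumes x: "x \<in> space M" and w: "w \<in> W"
  shows "\<exists>f\<in>vbox d (disp n). cvec d n \<le> f \<and> descend n x w = shift f x w"
proof (induction n)
  case 0
  have "(0 :: nat \<Rightarrow> nat) \<in> vbox d (disp 0)" "cvec d 0 \<le> 0"
    by (simp_all add: vbox_def cvec_def le_fun_def)
  then show ?case
    using shift_zero[OF x w] by (metis descend.simps(1))
next
  case (Suc n)
  then obtain f where f: "f \<in> vbox d (disp n)" "cvec d n \<le> f" "descend n x w = shift f x w"
    by blast
  define t where "t = Suc (n + disp n)"
  define e where "e = jump t x (descend n x w)"
  have e: "e \<in> vbox d (reach t)" "cvec d 1 \<le> e"
    unfolding e_def by (rule jump_in_vbox[OF x descend_closed[OF x w]], rule jump_ge) (simp add: t_def)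
  have "f + e \<in> vbox d (disp (Suc n))"
    using vbox_add[OF f(1) e(1)] unfolding disp.simps t_def .
  then have "e + f \<in> vbox d (disp (Suc n))"
    by (simp only: add.commute)
  moreover have "cvec d (Suc n) \<le> e + f"
    unfolding le_fun_def
  proof
    fix i
    have "cvec d (Suc n) i = cvec d 1 i + cvec d n i"
      by (simp add: cvec_def)
    also have "\<dots> \<le> e i + f i"
      using e(2) f(2) by (intro add_mono) (auto simp: le_fun_def)
    finally show "cvec d (Suc n) i \<le> (e + f) i"
      by simp
  qed
  moreover have "descend (Suc n) x w = shift (e + f) x w"
    by (simp only: descend.simps land_def shift_add[OF x w] flip: t_def e_def f(3))
  ultimately show ?case
    by blast
qed

text \<open>All points start at the same vertex \<open>base\<close>, so the ends of all descents of
  \<open>n\<close> moves lie in one ball; this makes the classes finite. For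
  \<open>y = \<alpha> g x\<close>, equivariance turns the comparison into one of the starts
  \<open>base\<close> and \<open>\<phi> (inv g) base\<close> under the single point
  \<open>x\<close>.\<close>

definition rel :: "nat \<Rightarrow> ('x \<times> 'x) set" where
  "rel n = {(x, y) \<in> space M \<times> space M. same x (descend n x base) y (descend n y base)}"

lemma rel_equiv: "equiv (space M) (rel n)"
proof (rule equivI)
  show "refl_on (space M) (rel n)"
    unfolding refl_on_def rel_def using same_refl descend_closed base by auto
  show "sym (rel n)"
    unfolding sym_def rel_def using same_sym by blast
  show "trans (rel n)"
    unfolding trans_def rel_def using same_trans by blast
qed (auto simp: rel_def)

lemma same_descend_Suc:
  assumes "same x (descend n x w) y (descend n y v)"
  shows "same x (descend (Suc n) x w) y (descend (Suc n) y v)"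
proof -
  obtain g where g: "g \<in> carrier H" "x \<in> space M" "descend n x w \<in> W" "y = \<alpha> g x"
    "descend n y v = \<phi> g (descend n x w)"
    using assms by (rule sameE)
  have "descend (Suc n) y v = \<phi> g (descend (Suc n) x w)"
    unfolding descend.simps g(5) unfolding g(4) by (rule land_equivariant[OF g(1-3)])
  moreover have "descend (Suc n) x w \<in> W"
    unfolding descend.simps by (rule land_closed[OF g(2,3)])
  ultimately show ?thesis
    using g(4) same_action[OF g(1,2)] by metis
qed

lemma rel_Suc: "rel n \<subseteq> rel (Suc n)"
  unfolding rel_def using same_descend_Suc by blast

lemma rel_orbit: "(x, y) \<in> rel n \<Longrightarrow> \<exists>g\<in>carrier H. \<alpha> g x = y"
  unfolding rel_def same_def by blast

text \<open>Countably many pieces, one for each group element \<open>g\<close> and each end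
  \<open>p\<close> of the first descent: the graph of \<open>\<alpha> g\<close> cut with a
  measurable rectangle.\<close>

lemma rel_sets: "rel n \<in> sets (M \<Otimes>\<^sub>M M)"
proof -
  have "rel n = (\<Union>g\<in>carrier H. \<Union>p\<in>W. {(x, y) \<in> space M \<times> space M. \<alpha> g x = y} \<inter>
      {x \<in> space M. descend n x base = p} \<times> {y \<in> space M. descend n y base = \<phi> g p})"
    unfolding rel_def same_def using descend_closed[OF _ base] by auto
  moreover have "{x \<in> space M. descend n x base = p} \<in> sets M" if "p \<in> W" for p
  proof -
    have "Measurable.pred M (\<lambda>x. descend n x base = p)"
      using that by (intro pred_eq_count_space[OF descend_measurable[OF base] _ countable_W]) simp
    then show ?thesis
      by (simp add: pred_def)
  qed
  ultimately show ?thesis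
    using graph_sets[OF \<alpha>_measurable] countable_carrier countable_W \<phi>_closed
    by (auto intro!: sets.countable_UN')
qed

lemma finite_image_factor:
  assumes "finite (f ` S)" "\<And>a b. a \<in> S \<Longrightarrow> b \<in> S \<Longrightarrow> f a = f b \<Longrightarrow> g a = g b"
  shows "finite (g ` S)"
proof -
  have "g ` S \<subseteq> (\<lambda>r. g (SOME a. a \<in> S \<and> f a = r)) ` f ` S"
  proof
    fix y assume "y \<in> g ` S"
    then obtain a where a: "a \<in> S" "y = g a"
      by blast
    have "(SOME b. b \<in> S \<and> f b = f a) \<in> S \<and> f (SOME b. b \<in> S \<and> f b = f a) = f a"
      by (rule someI[of _ a]) (use a in simp)
    then have "y = g (SOME b. b \<in> S \<and> f b = f a)"
      using assms(2) a by metis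
    then show "y \<in> (\<lambda>r. g (SOME a. a \<in> S \<and> f a = r)) ` f ` S"
      using a by blast
  qed
  then show ?thesis
    using assms(1) by (meson finite_imageI finite_subset)
qed

text \<open>By \<open>agreeing\<close>, \<open>\<alpha> g x\<close> depends only on the images of
  finitely many shifts of \<open>w\<close>, and these images are confined to a finite ball around
  \<open>v\<close>.\<close>

lemma finite_stabilizer_orbit:
  assumes x: "x \<in> space M" and w: "w \<in> W"
  shows "finite ((\<lambda>g. \<alpha> g x) ` {g \<in> carrier H. \<phi> g w = v})"
proof -
  obtain m where m: "\<And>g h. g \<in> carrier H \<Longrightarrow> h \<in> carrier H \<Longrightarrow>
      (\<forall>e\<in>vbox d m. \<phi> g (shift e x w) = \<phi> h (shift e x w)) \<Longrightarrow> \<alpha> g x = \<alpha> h x"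
    using agreeing[OF x w] by blast
  have "finite ((\<lambda>g. \<lambda>e\<in>vbox d m. \<phi> g (shift e x w)) ` {g \<in> carrier H. \<phi> g w = v})"
  proof (cases "v \<in> W")
    case True
    have "\<phi> g (shift e x w) \<in> nb m v" if "g \<in> carrier H" "\<phi> g w = v" "e \<in> vbox d m" for g e
    proof -
      have "shift e x w \<in> nb m (shift 0 x w)"
        by (rule nb_shift[OF x w]) (use that in \<open>simp_all add: vbox_def\<close>)
      then show ?thesis
        using nb_equivariant[OF that(1) w] that(2) shift_zero[OF x w] by metis
    qed
    then have "(\<lambda>g. \<lambda>e\<in>vbox d m. \<phi> g (shift e x w)) ` {g \<in> carrier H. \<phi> g w = v}
        \<subseteq> PiE (vbox d m) (\<lambda>_. nb m v)"
      by auto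
    then show ?thesis
      by (rule finite_subset) (intro finite_PiE finite_vbox nb_finite True)
  next
    case False
    then have "{g \<in> carrier H. \<phi> g w = v} = {}"
      using \<phi>_closed w by blast
    then show ?thesis
      by (simp only: image_empty finite.emptyI)
  qed
  then show ?thesis
  proof (rule finite_image_factor)
    fix g h assume gh: "g \<in> {g \<in> carrier H. \<phi> g w = v}" "h \<in> {g \<in> carrier H. \<phi> g w = v}"
      and eq: "(\<lambda>e\<in>vbox d m. \<phi> g (shift e x w)) = (\<lambda>e\<in>vbox d m. \<phi> h (shift e x w))"
    have "\<phi> g (shift e x w) = \<phi> h (shift e x w)" if "e \<in> vbox d m" for e
      using fun_cong[OF eq, of e] that by simp
    then show "\<alpha> g x = \<alpha> h x"
      using gh m by blast
  qed
qed

text \<open>The descent of every \<open>y\<close> ends in the finite ball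
  \<open>nb (disp n) base\<close>, and only finitely many points come from group elements sending
  the end of the descent for \<open>x\<close> to a given vertex of this ball.\<close>

lemma rel_finite:
  assumes x: "x \<in> space M"
  shows "finite (rel n `` {x})"
proof (rule finite_subset)
  show "rel n `` {x} \<subseteq> (\<Union>q\<in>nb (disp n) base.
      (\<lambda>g. \<alpha> g x) ` {g \<in> carrier H. \<phi> g (descend n x base) = q})"
  proof
    fix y assume "y \<in> rel n `` {x}"
    then have y: "y \<in> space M" and s: "same x (descend n x base) y (descend n y base)"
      unfolding rel_def by auto
    obtain f where f: "f \<in> vbox d (disp n)" "descend n y base = shift f y base"
      using descend_shift[OF y base] by blast
    have "shift f y base \<in> nb (disp n) (shift 0 y base)"
      by (rule nb_shift[OF y base]) (use f in \<open>simp_all add: vbox_def\<close>)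
    then have "descend n y base \<in> nb (disp n) base"
      using f shift_zero[OF y base] by simp
    moreover obtain g where "g \<in> carrier H" "y = \<alpha> g x" "descend n y base = \<phi> g (descend n x base)"
      using s by (rule sameE)
    ultimately show "y \<in> (\<Union>q\<in>nb (disp n) base.
        (\<lambda>g. \<alpha> g x) ` {g \<in> carrier H. \<phi> g (descend n x base) = q})"
      by auto
  qed
  show "finite (\<Union>q\<in>nb (disp n) base.
      (\<lambda>g. \<alpha> g x) ` {g \<in> carrier H. \<phi> g (descend n x base) = q})"
    using nb_finite[OF base] finite_stabilizer_orbit[OF x descend_closed[OF x base]] by auto
qed

text \<open>Pulled back to \<open>x\<close>, the points of \<open>B\<close> become starts
  \<open>w y\<close>, each of which has a common shift with \<open>base\<close>. After sufficiently
  many moves all these descents are shifts of \<open>base\<close> within the next scale, so by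
  \<open>land_few\<close> the next move leaves at most \<open>card (vbox d 3)\<close> ends modulo
  the group. Two points with the same end would be related.\<close>

lemma unrelated_card_le:
  assumes x: "x \<in> space M" and B: "finite B" "B \<subseteq> (\<lambda>g. \<alpha> g x) ` carrier H"
    and unrel: "\<And>y z n. y \<in> B \<Longrightarrow> z \<in> B \<Longrightarrow> y \<noteq> z \<Longrightarrow> (y, z) \<notin> rel n"
  shows "card B \<le> card (vbox d 3)"
proof -
  have "\<forall>y\<in>B. \<exists>g. g \<in> carrier H \<and> \<alpha> g x = y"
    using B(2) by blast
  from bchoice[OF this] obtain g where g: "\<And>y. y \<in> B \<Longrightarrow> g y \<in> carrier H" "\<And>y. y \<in> B \<Longrightarrow> \<alpha> (g y) x = y"
    by blast
  define w where "w y = \<phi> (inv (g y)) base" for y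
  have w: "w y \<in> W" if "y \<in> B" for y
    unfolding w_def using g(1)[OF that] base by (simp add: \<phi>_closed)
  have gw: "\<phi> (g y) (w y) = base" if "y \<in> B" for y
    unfolding w_def using \<phi>_inv[of "inv (g y)" base] g(1)[OF that] base by simp
  have "\<forall>y\<in>B. \<exists>t e f. e \<in> vbox d t \<and> f \<in> vbox d t \<and> shift e x (w y) = shift f x base"
    using merging[OF x w base] by blast
  then obtain t e f where e: "\<And>y. y \<in> B \<Longrightarrow> e y \<in> vbox d (t y)" and f: "\<And>y. y \<in> B \<Longrightarrow> f y \<in> vbox d (t y)"
    and ef: "\<And>y. y \<in> B \<Longrightarrow> shift (e y) x (w y) = shift (f y) x base"
    by metis
  define N where "N = Max (t ` B)"
  have tN: "t y \<le> N" if "y \<in> B" for y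
    unfolding N_def using B(1) that by simp
  \<comment> \<open>The scale of the move from \<open>descend N\<close> to
    \<open>descend (Suc N)\<close>.\<close>
  define T where "T = Suc (N + disp N)"
  obtain C where C: "finite C" "card C \<le> card (vbox d 3)"
    and land_C: "\<And>h. h \<in> vbox d T \<Longrightarrow> \<exists>v\<in>C. same x v x (land T x (shift h x base))"
    using land_few[OF x base, of T] unfolding T_def by auto
  have "\<exists>v\<in>C. same x v x (descend (Suc N) x (w y))" if y: "y \<in> B" for y
  proof -
    obtain k where k: "k \<in> vbox d (disp N)" "cvec d N \<le> k" "descend N x (w y) = shift k x (w y)"
      using descend_shift[OF x w[OF y]] by blast
    \<comment> \<open>The \<open>N\<close> moves have carried \<open>w y\<close> past its meeting
      point with \<open>base\<close>, so the descent can be rewritten as a shift of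
      \<open>base\<close>, with displacement at most \<open>disp N + N\<close>.\<close>
    have "e y \<le> cvec d N"
      using vbox_mono[OF tN[OF y] e[OF y]] by (simp only: vbox_le)
    then have le: "e y \<le> k"
      using k(2) by (rule order_trans)
    have "shift k x (w y) = shift (k - e y) x (shift (e y) x (w y))"
      using vec_diff_add[OF le] by (simp only: shift_add[OF x w[OF y], symmetric])
    also have "\<dots> = shift (k - e y + f y) x base"
      by (simp only: ef[OF y] shift_add[OF x base])
    finally have "descend N x (w y) = shift (k - e y + f y) x base"
      using k(3) by simp
    moreover have "k - e y + f y \<in> vbox d T"
      using vbox_add[OF vbox_diff[OF k(1)] vbox_mono[OF tN[OF y] f[OF y]], of "e y"]
      by (rule vbox_mono[rotated]) (simp add: T_def)
    ultimately show ?thesis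
      using land_C[of "k - e y + f y"] by (simp only: descend.simps T_def)
  qed
  then have "\<forall>y\<in>B. \<exists>v. v \<in> C \<and> same x v x (descend (Suc N) x (w y))"
    by blast
  from bchoice[OF this] obtain c where c: "\<And>y. y \<in> B \<Longrightarrow> c y \<in> C"
    "\<And>y. y \<in> B \<Longrightarrow> same x (c y) x (descend (Suc N) x (w y))"
    by blast
  have "inj_on c B"
  proof (rule inj_onI)
    fix y z assume yz: "y \<in> B" "z \<in> B" "c y = c z"
    have move: "same x (descend (Suc N) x (w u)) u (descend (Suc N) u base)" if u: "u \<in> B" for u
    proof -
      have "descend (Suc N) u base = \<phi> (g u) (descend (Suc N) x (w u))"
        using descend_equivariant[OF g(1)[OF u] x w[OF u], of "Suc N"]
        by (simp only: g(2)[OF u] gw[OF u])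
      then show ?thesis
        using same_action[OF g(1)[OF u] x descend_closed[OF x w[OF u], of "Suc N"]]
        by (simp only: g(2)[OF u])
    qed
    have "same x (descend (Suc N) x (w y)) x (descend (Suc N) x (w z))"
    proof (rule same_trans[OF same_sym[OF c(2)[OF yz(1)]]])
      show "same x (c y) x (descend (Suc N) x (w z))"
        unfolding yz(3) by (rule c(2)[OF yz(2)])
    qed
    from same_trans[OF same_trans[OF same_sym[OF move[OF yz(1)]] this] move[OF yz(2)]]
    have "same y (descend (Suc N) y base) z (descend (Suc N) z base)" .
    with same_carrier(1)[OF this] same_carrier(3)[OF this] have "(y, z) \<in> rel (Suc N)"
      unfolding rel_def by (simp only: mem_Collect_eq case_prod_conv mem_Sigma_iff simp_thms)
    then show "y = z"
      using unrel yz by blast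
  qed
  then have "card B \<le> card C"
    using c(1) C(1) by (intro card_inj_on_le) auto
  then show ?thesis
    using C(2) by simp
qed

text \<open>A set of pairwise unrelated points of maximal size exists by
  \<open>unrelated_card_le\<close>, and by maximality it meets every class in the orbit.\<close>

proposition finitely_many_classes:
  assumes x: "x \<in> space M"
  shows "\<exists>A. finite A \<and> A \<subseteq> (\<lambda>g. \<alpha> g x) ` carrier H \<and> (\<forall>g\<in>carrier H. \<exists>y\<in>A. \<exists>n. (y, \<alpha> g x) \<in> rel n)"
proof -
  define P where "P B \<longleftrightarrow> finite B \<and> B \<subseteq> (\<lambda>g. \<alpha> g x) ` carrier H \<and>
      (\<forall>y\<in>B. \<forall>z\<in>B. y \<noteq> z \<longrightarrow> (\<forall>n. (y, z) \<notin> rel n))" for B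
  have "P {}"
    by (simp add: P_def)
  moreover have "\<forall>B. P B \<longrightarrow> card B < Suc (card (vbox d 3))"
  proof (intro allI impI)
    fix B assume "P B"
    then have "finite B" "B \<subseteq> (\<lambda>g. \<alpha> g x) ` carrier H"
      "\<And>y z n. y \<in> B \<Longrightarrow> z \<in> B \<Longrightarrow> y \<noteq> z \<Longrightarrow> (y, z) \<notin> rel n"
      unfolding P_def by blast+
    from unrelated_card_le[OF x this] show "card B < Suc (card (vbox d 3))"
      by (rule le_imp_less_Suc)
  qed
  ultimately have "\<exists>B. P B \<and> (\<forall>B'. P B' \<longrightarrow> card B' \<le> card B)"
    by (rule Lattices_Big.ex_has_greatest_nat)
  then obtain B where B: "P B" and max: "\<And>B'. P B' \<Longrightarrow> card B' \<le> card B"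
    by blast
  have B_fin: "finite B" and B_sub: "B \<subseteq> (\<lambda>g. \<alpha> g x) ` carrier H"
    and B_unrel: "\<And>y z n. y \<in> B \<Longrightarrow> z \<in> B \<Longrightarrow> y \<noteq> z \<Longrightarrow> (y, z) \<notin> rel n"
    using B unfolding P_def by blast+
  have "\<exists>y\<in>B. \<exists>n. (y, \<alpha> g x) \<in> rel n" if g: "g \<in> carrier H" for g
  proof (rule ccontr)
    assume none: "\<not> (\<exists>y\<in>B. \<exists>n. (y, \<alpha> g x) \<in> rel n)"
    have "\<alpha> g x \<in> space M"
      by (rule \<alpha>_closed[OF g x])
    then have "(\<alpha> g x, \<alpha> g x) \<in> rel n" for n
      using rel_equiv[of n] by (auto simp: equiv_def refl_on_def)
    then have "\<alpha> g x \<notin> B"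
      using none by blast
    have right: "(y, \<alpha> g x) \<notin> rel n" if "y \<in> B" for y n
      using none that by blast
    have left: "(\<alpha> g x, y) \<notin> rel n" if "y \<in> B" for y n
    proof
      assume "(\<alpha> g x, y) \<in> rel n"
      then have "(y, \<alpha> g x) \<in> rel n"
        using rel_equiv[of n] by (simp add: equiv_def sym_def)
      then show False
        using right that by blast
    qed
    have "P (insert (\<alpha> g x) B)"
      unfolding P_def
    proof (intro conjI ballI impI allI)
      fix y z n assume yz: "y \<in> insert (\<alpha> g x) B" "z \<in> insert (\<alpha> g x) B" "y \<noteq> z"
      show "(y, z) \<notin> rel n"
      proof (cases "y = \<alpha> g x")
        case True
        then have "z \<in> B"
          using yz by blast
        then show ?thesis
          unfolding True by (rule left)
      next
        case False
        then have y: "y \<in> B"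
          using yz by blast
        show ?thesis
        proof (cases "z = \<alpha> g x")
          case True
          then show ?thesis
            using right[OF y] by simp
        next
          case False
          then have "z \<in> B"
            using yz by blast
          then show ?thesis
            using B_unrel[OF y _ yz(3)] by blast
        qed
      qed
    next
      show "finite (insert (\<alpha> g x) B)"
        using B_fin by simp
    next
      show "insert (\<alpha> g x) B \<subseteq> (\<lambda>g. \<alpha> g x) ` carrier H"
        using B_sub g by blast
    qed
    then have "card (insert (\<alpha> g x) B) \<le> card B"
      by (rule max)
    then show False
      using \<open>\<alpha> g x \<notin> B\<close> B_fin by simp
  qed
  then show ?thesis
    using B_fin B_sub by blast
qed

end

section \<open>Trees\<close>

lemma vertex_path_snoc:
  assumes "vertex_path V E p" "{last p, z} \<in> E" "z \<in> V"
  shows "vertex_path V E (p @ [z])"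
  using assms by (auto simp: vertex_path_def successively_append_iff)

lemma vertex_path_mono: "vertex_path V E p \<Longrightarrow> E \<subseteq> E' \<Longrightarrow> vertex_path V E' p"
  unfolding vertex_path_def by (auto intro: successively_mono)

lemma joined_refl: "x \<in> V \<Longrightarrow> joined V E x x"
  unfolding joined_def by (intro exI[of _ "[x]"]) (simp add: vertex_path_def)

lemma joined_in:
  assumes "joined V E x y"
  shows "x \<in> V" "y \<in> V"
  using assms by (auto simp: joined_def vertex_path_def)

lemma joined_step:
  assumes "joined V E x y" "{y, z} \<in> E" "z \<in> V"
  shows "joined V E x z"
proof -
  obtain p where p: "vertex_path V E p" "hd p = x" "last p = y"
    using assms(1) unfolding joined_def by blast
  then have "vertex_path V E (p @ [z])"
    using vertex_path_snoc assms by metis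
  moreover have "hd (p @ [z]) = x" "last (p @ [z]) = z"
    using p by (auto simp: vertex_path_def)
  ultimately show ?thesis
    unfolding joined_def by blast
qed

lemma joined_induct [consumes 1, case_names refl step]:
  assumes "joined V E x y"
    and "P x"
    and step: "\<And>u v. u \<in> V \<Longrightarrow> v \<in> V \<Longrightarrow> {u, v} \<in> E \<Longrightarrow> P u \<Longrightarrow> P v"
  shows "P y"
proof -
  have "vertex_path V E p \<Longrightarrow> P (hd p) \<Longrightarrow> P (last p)" for p
  proof (induction p)
    case (Cons a p)
    show ?case
    proof (cases "p = []")
      case False
      then have "{a, hd p} \<in> E" "a \<in> V" "hd p \<in> V" "vertex_path V E p"
        using Cons.prems(1) by (auto simp: vertex_path_def successively_Cons)
      then have "P (hd p)"
        using step[of a "hd p"] Cons.prems(2) by simp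
      then show ?thesis
        using Cons.IH \<open>vertex_path V E p\<close> False by simp
    qed (use Cons.prems in simp)
  qed (simp add: vertex_path_def)
  then show ?thesis
    using assms(1,2) unfolding joined_def by blast
qed

lemma joined_trans:
  assumes "joined V E x y" "joined V E y z"
  shows "joined V E x z"
  using assms(2,1) by (induction rule: joined_induct) (auto intro: joined_step)

lemma joined_sym:
  assumes "joined V E x y"
  shows "joined V E y x"
proof -
  have "x \<in> V"
    using assms by (rule joined_in)
  show ?thesis
    using assms
  proof (induction rule: joined_induct)
    case refl
    show ?case
      using \<open>x \<in> V\<close> by (rule joined_refl)
  next
    case (step u v)
    have "joined V E v u"
      by (rule joined_step[OF joined_refl]) (use step in \<open>auto simp: insert_commute\<close>)
    then show ?case
      using step by (blast intro: joined_trans)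
  qed
qed

lemma joined_distinct_path:
  assumes "joined V E x y"
  shows "\<exists>p. vertex_path V E p \<and> hd p = x \<and> last p = y \<and> distinct p"
proof -
  have "x \<in> V"
    using assms by (rule joined_in)
  show ?thesis
    using assms
  proof (induction rule: joined_induct)
    case refl
    show ?case
      by (intro exI[of _ "[x]"]) (simp add: vertex_path_def \<open>x \<in> V\<close>)
  next
    case (step u v)
    then obtain p where p: "vertex_path V E p" "hd p = x" "last p = u" "distinct p"
      by blast
    show ?case
    proof (cases "v \<in> set p")
      case True
      then obtain a b where ab: "p = a @ v # b"
        by (meson split_list)
      have "vertex_path V E (a @ [v])" "hd (a @ [v]) = x" "last (a @ [v]) = v" "distinct (a @ [v])"
        using p unfolding ab vertex_path_def
        by (auto simp: successively_append_iff hd_append split: if_splits)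
      then show ?thesis
        by blast
    next
      case False
      have "vertex_path V E (p @ [v])"
        using vertex_path_snoc p step by metis
      moreover have "hd (p @ [v]) = x" "last (p @ [v]) = v" "distinct (p @ [v])"
        using p False by (auto simp: vertex_path_def)
      ultimately show ?thesis
        by blast
    qed
  qed
qed

lemma simple_graph_edge:
  assumes "simple_graph V E" "{a, b} \<in> E"
  shows "a \<in> V" "b \<in> V" "a \<noteq> b"
proof -
  have e: "{a, b} \<subseteq> V" "card {a, b} = 2"
    using assms unfolding simple_graph_def by blast+
  then show "a \<in> V" "b \<in> V"
    by blast+
  show "a \<noteq> b"
    using e(2) by auto
qed

text \<open>The half-tree beyond the edge from \<open>a\<close> to \<open>b\<close>.\<close>

definition side :: "'a set \<Rightarrow> 'a set set \<Rightarrow> 'a \<Rightarrow> 'a \<Rightarrow> 'a set" where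
  "side V E a b = {x. joined V (E - {{a, b}}) b x}"

lemma side_iff: "x \<in> side V E a b \<longleftrightarrow> joined V (E - {{a, b}}) b x"
  by (simp add: side_def)

locale tree =
  fixes V :: "'a set" and E :: "'a set set"
  assumes tree: "tree_graph V E"
begin

lemma simple: "simple_graph V E"
  using tree by (simp add: tree_graph_def)

lemmas edge_in = simple_graph_edge[OF simple]

lemma joined: "x \<in> V \<Longrightarrow> y \<in> V \<Longrightarrow> joined V E x y"
  using tree by (simp add: tree_graph_def connected_graph_def)

lemma no_cycle: "\<not> graph_cycle V E c"
  using tree by (simp add: tree_graph_def)

lemma head_in_side:
  assumes "{a, b} \<in> E"
  shows "b \<in> side V E a b"
  unfolding side_iff by (rule joined_refl) (rule edge_in(2)[OF assms])

text \<open>A path without repetitions from \<open>b\<close> to \<open>a\<close> that avoids the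
  edge closes up with it to a cycle. It has at least three vertices, since two would mean the
  removed edge.\<close>

lemma tail_notin_side:
  assumes e: "{a, b} \<in> E"
  shows "a \<notin> side V E a b"
proof
  assume "a \<in> side V E a b"
  then obtain p where p: "vertex_path V (E - {{a, b}}) p" "hd p = b" "last p = a" "distinct p"
    unfolding side_iff using joined_distinct_path by meson
  have "3 \<le> length p"
  proof (rule ccontr)
    assume "\<not> 3 \<le> length p"
    moreover have "p \<noteq> []"
      using p(1) by (simp add: vertex_path_def)
    ultimately consider z where "p = [z]" | y z where "p = [y, z]"
      by (cases p; cases "tl p"; cases "tl (tl p)") auto
    then show False
    proof cases
      case 1
      then show ?thesis
        using p edge_in[OF e] by simp
    next
      case 2
      then show ?thesis
        using p by (auto simp: vertex_path_def insert_commute)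
    qed
  qed
  moreover have "vertex_path V E p"
    using p(1) by (rule vertex_path_mono) blast
  ultimately have "graph_cycle V E p"
    unfolding graph_cycle_def using p e by simp
  then show False
    using no_cycle by blast
qed

lemma side_step:
  assumes "x \<in> side V E a b" "{x, y} \<in> E" "{x, y} \<noteq> {a, b}"
  shows "y \<in> side V E a b"
proof -
  have "{x, y} \<in> E - {{a, b}}"
    using assms by simp
  then show ?thesis
    using joined_step[OF _ _ edge_in(2)[OF assms(2)]] assms(1) unfolding side_iff by metis
qed

lemma side_disjoint:
  assumes e: "{a, b} \<in> E"
  shows "side V E a b \<inter> side V E b a = {}"
proof (rule ccontr)
  assume "side V E a b \<inter> side V E b a \<noteq> {}"
  then obtain x where "x \<in> side V E a b" "x \<in> side V E b a"
    by auto
  then have "joined V (E - {{a, b}}) b x" "joined V (E - {{a, b}}) a x"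
    by (simp_all add: side_iff insert_commute)
  from joined_trans[OF this(1) joined_sym[OF this(2)]] show False
    using tail_notin_side[OF e] by (simp add: side_iff)
qed

lemma side_cover:
  assumes e: "{a, b} \<in> E" and x: "x \<in> V"
  shows "x \<in> side V E a b \<or> x \<in> side V E b a"
proof -
  have e': "{b, a} \<in> E"
    using e by (simp add: insert_commute)
  have "joined V E b x"
    by (rule joined[OF edge_in(2)[OF e] x])
  then show ?thesis
  proof (induction rule: joined_induct)
    case refl
    show ?case
      using head_in_side[OF e] by blast
  next
    case (step u v)
    show ?case
    proof (cases "{u, v} = {a, b}")
      case True
      then show ?thesis
        using head_in_side[OF e] head_in_side[OF e'] by (auto simp: doubleton_eq_iff)
    next
      case False
      then show ?thesis
        using step(4) side_step[OF _ step(3), of a b] side_step[OF _ step(3), of b a]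
        by (auto simp: insert_commute)
    qed
  qed
qed

text \<open>A walk inside the half-tree beyond \<open>b'\<close> never returns to \<open>a\<close>,
  so it cannot use the edge \<open>{b, a}\<close> and stays in \<open>side V E b a\<close>, which is
  disjoint from \<open>side V E a b\<close>.\<close>

lemma sides_at_vertex_disjoint:
  assumes e: "{a, b} \<in> E" and e': "{a, b'} \<in> E" and ne: "b \<noteq> b'"
  shows "side V E a b \<inter> side V E a b' = {}"
proof -
  have "x \<in> side V E b a \<and> x \<in> side V E a b'" if "x \<in> side V E a b'" for x
  proof -
    have "joined V (E - {{a, b'}}) b' x"
      using that by (simp only: side_iff)
    then show ?thesis
    proof (induction rule: joined_induct)
      case refl
      have "{b, a} \<in> E" "{a, b'} \<noteq> {b, a}"
        using e ne by (auto simp: insert_commute doubleton_eq_iff)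
      then show ?case
        using head_in_side[OF e'] side_step[OF head_in_side[of b a] e'] by simp
    next
      case (step u v)
      then have uv: "{u, v} \<in> E" "{u, v} \<noteq> {a, b'}" "u \<in> side V E b a" "u \<in> side V E a b'"
        by simp_all
      have v: "v \<in> side V E a b'"
        by (rule side_step[OF uv(4,1,2)])
      then have "u \<noteq> a" "v \<noteq> a"
        using tail_notin_side[OF e'] uv(4) by auto
      then have "{u, v} \<noteq> {b, a}"
        by (auto simp: doubleton_eq_iff)
      then show ?case
        using v side_step[OF uv(3,1)] by simp
    qed
  qed
  then show ?thesis
    using side_disjoint[OF e] by (simp add: disjoint_iff) metis
qed

end

text \<open>In a tree, an end or a vertex amounts to an orientation of the edges towards it, that is, to
  the map \<open>s\<close> moving every vertex one step along its only outgoing edge, if there is one.\<close>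

locale tree_flow = tree V E for V :: "'a set" and E +
  fixes s :: "'a \<Rightarrow> 'a"
  assumes flow_in: "x \<in> V \<Longrightarrow> s x \<in> V"
    and flow_edge: "x \<in> V \<Longrightarrow> s x \<noteq> x \<Longrightarrow> {x, s x} \<in> E"
    and flow_orients: "{x, y} \<in> E \<Longrightarrow> (s x = y) \<noteq> (s y = x)"
begin

lemma funpow_flow_in: "x \<in> V \<Longrightarrow> (s ^^ k) x \<in> V"
  by (induction k) (auto simp: flow_in)

text \<open>Of two adjacent vertices one flows to the other, so passing to a neighbour changes one
  of the two exponents by one step.\<close>

lemma merge:
  assumes "x \<in> V" "y \<in> V"
  shows "\<exists>k l. (s ^^ k) x = (s ^^ l) y"
  using joined[OF assms]
proof (induction rule: joined_induct)
  case refl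
  show ?case
    by blast
next
  case (step u v)
  then obtain k l where kl: "(s ^^ k) x = (s ^^ l) u"
    by blast
  consider "s u = v" | "s v = u"
    using flow_orients step(3) by blast
  then show ?case
  proof cases
    case 1
    have "(s ^^ Suc k) x = (s ^^ l) v"
      using kl 1 by (metis funpow.simps(2) funpow_swap1 o_apply)
    then show ?thesis
      by blast
  next
    case 2
    have "(s ^^ k) x = (s ^^ Suc l) v"
      using kl 2 by (simp add: funpow_swap1)
    then show ?thesis
      by blast
  qed
qed

text \<open>A return of minimal length \<open>m\<close> runs through distinct vertices and would be
  a cycle. Length 1 is a fixed point, and length 2 would orient one edge both ways.\<close>

lemma no_return:
  assumes nofix: "\<And>y. y \<in> V \<Longrightarrow> s y \<noteq> y" and y: "y \<in> V" and k: "(s ^^ k) y = y"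
  shows "k = 0"
proof (rule ccontr)
  assume "k \<noteq> 0"
  define m where "m = (LEAST m. 0 < m \<and> (s ^^ m) y = y)"
  have m: "0 < m \<and> (s ^^ m) y = y"
    unfolding m_def by (rule LeastI[of _ k]) (use k \<open>k \<noteq> 0\<close> in simp)
  have min: "(s ^^ i) y \<noteq> y" if "0 < i" "i < m" for i
    using not_less_Least[of i "\<lambda>m. 0 < m \<and> (s ^^ m) y = y"] that unfolding m_def by blast
  define c where "c = map (\<lambda>i. (s ^^ i) y) [0..<m]"
  have neq: "(s ^^ i) y \<noteq> (s ^^ j) y" if ij: "i < j" "j < m" for i j
  proof
    assume "(s ^^ i) y = (s ^^ j) y"
    then have "(s ^^ (m - j)) ((s ^^ i) y) = (s ^^ (m - j)) ((s ^^ j) y)"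
      by simp
    then have "(s ^^ (m - j + i)) y = (s ^^ (m - j + j)) y"
      by (simp only: funpow_add o_apply)
    then have return: "(s ^^ (m - j + i)) y = y"
      using m ij by simp
    have "0 < m - j + i" "m - j + i < m"
      using ij by linarith+
    from min[OF this] return show False
      by (rule notE)
  qed
  have "m \<noteq> 1"
    using m nofix[OF y] by auto
  moreover have "m \<noteq> 2"
  proof
    assume "m = 2"
    then have "s (s y) = y"
      using m by (simp add: numeral_2_eq_2)
    then show False
      using flow_orients[OF flow_edge[OF y nofix[OF y]]] by simp
  qed
  ultimately have m3: "3 \<le> m"
    using m by simp
  have step: "{(s ^^ i) y, (s ^^ Suc i) y} \<in> E" for i
    using flow_edge[OF funpow_flow_in[OF y] nofix[OF funpow_flow_in[OF y]]] by simp
  have "graph_cycle V E c"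
    unfolding graph_cycle_def vertex_path_def
  proof (intro conjI)
    show "c \<noteq> []" "3 \<le> length c" "set c \<subseteq> V"
      using m3 funpow_flow_in[OF y] by (auto simp: c_def)
    have "inj_on (\<lambda>i. (s ^^ i) y) {0..<m}"
    proof (rule inj_onI)
      fix i j assume ij: "i \<in> {0..<m}" "j \<in> {0..<m}" "(s ^^ i) y = (s ^^ j) y"
      show "i = j"
        using neq[of i j] neq[of j i] ij by (cases i j rule: linorder_cases) simp_all
    qed
    then show "distinct c"
      by (simp add: c_def distinct_map)
    show "successively (\<lambda>x y. {x, y} \<in> E) c"
      unfolding successively_conv_nth c_def using step by auto
    have "last c = (s ^^ (m - 1)) y" "hd c = y"
      using m3 by (auto simp: c_def last_map hd_map)
    then show "{last c, hd c} \<in> E"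
      using step[of "m - 1"] m by simp
  qed
  then show False
    using no_cycle by blast
qed

lemma funpow_flow_inj:
  assumes nofix: "\<And>y. y \<in> V \<Longrightarrow> s y \<noteq> y" and y: "y \<in> V" and eq: "(s ^^ k) y = (s ^^ l) y"
  shows "k = l"
proof -
  have less: "\<not> i < j" if ij: "(s ^^ i) y = (s ^^ j) y" for i j
  proof
    assume "i < j"
    then have "(s ^^ j) y = (s ^^ (j - i)) ((s ^^ i) y)"
      by (metis funpow_add le_add_diff_inverse2 less_imp_le o_apply)
    then have "(s ^^ (j - i)) ((s ^^ i) y) = (s ^^ i) y"
      using ij by simp
    from no_return[OF nofix funpow_flow_in[OF y] this] have "j - i = 0"
      by simp
    then show False
      using \<open>i < j\<close> by simp
  qed
  show ?thesis
    using less[OF eq] less[OF eq[symmetric]] by simp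
qed

text \<open>A Busemann function of the end that \<open>s\<close> points to.\<close>

lemma ex_potential:
  assumes nofix: "\<And>y. y \<in> V \<Longrightarrow> s y \<noteq> y"
  shows "\<exists>\<beta> :: 'a \<Rightarrow> int. \<forall>y\<in>V. \<beta> (s y) = \<beta> y + 1"
proof (cases "V = {}")
  case False
  then obtain z where z: "z \<in> V"
    by blast
  define R where "R y kl \<longleftrightarrow> (s ^^ fst kl) y = (s ^^ snd kl) z" for y and kl :: "nat \<times> nat"
  define \<beta> where "\<beta> y = (let kl = (SOME kl. R y kl) in int (snd kl) - int (fst kl))" for y
  \<comment> \<open>Independence of the chosen meeting: continuing both meetings to the common
    vertex after \<open>k + k'\<close> steps of \<open>y\<close> compares them on the orbit of
    \<open>z\<close>, where exponents are determined.\<close>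
  have \<beta>: "\<beta> y = int l - int k" if y: "y \<in> V" and kl: "(s ^^ k) y = (s ^^ l) z" for y k l
  proof -
    obtain k' l' where *: "(SOME kl. R y kl) = (k', l')"
      by fastforce
    have "R y (SOME kl. R y kl)"
      by (rule someI[of "R y" "(k, l)"]) (use kl in \<open>simp add: R_def\<close>)
    then have kl': "(s ^^ k') y = (s ^^ l') z"
      unfolding * by (simp add: R_def)
    have "(s ^^ (k' + l)) z = (s ^^ k') ((s ^^ k) y)"
      by (simp add: funpow_add kl)
    also have "\<dots> = (s ^^ k) ((s ^^ k') y)"
      by (metis add.commute funpow_add o_apply)
    also have "\<dots> = (s ^^ (k + l')) z"
      by (simp add: funpow_add kl')
    finally have "(s ^^ (k' + l)) z = (s ^^ (k + l')) z" .
    from funpow_flow_inj[OF nofix z this] have "k' + l = k + l'"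
      by simp
    then show ?thesis
      unfolding \<beta>_def * by simp
  qed
  have "\<beta> (s y) = \<beta> y + 1" if y: "y \<in> V" for y
  proof -
    obtain k l where kl: "(s ^^ k) y = (s ^^ l) z"
      using merge[OF y z] by blast
    have "(s ^^ k) (s y) = s ((s ^^ k) y)"
      by (rule funpow_swap1[symmetric])
    also have "\<dots> = (s ^^ Suc l) z"
      by (simp add: kl)
    finally have "(s ^^ k) (s y) = (s ^^ Suc l) z" .
    from \<beta>[OF flow_in[OF y] this] \<beta>[OF y kl] show ?thesis
      by simp
  qed
  then show ?thesis
    by blast
qed simp

text \<open>All orbits merge, so the orbit of \<open>x\<close> would run into any fixed
  point.\<close>

lemma no_fixed_point:
  assumes x: "x \<in> V" and nofix: "\<And>k. s ((s ^^ k) x) \<noteq> (s ^^ k) x" and y: "y \<in> V"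
  shows "s y \<noteq> y"
proof
  assume fixed: "s y = y"
  have "(s ^^ l) y = y" for l
    by (induction l) (simp_all add: fixed)
  then obtain k where "(s ^^ k) x = y"
    using merge[OF x y] by metis
  then show False
    using nofix[of k] fixed by simp
qed

end

text \<open>Agreement along a whole orbit passes to neighbours. If \<open>u\<close> flows to
  \<open>v\<close>, then \<open>v\<close> lies on the orbit of \<open>u\<close>. If \<open>v\<close>
  flows to \<open>u\<close>, then \<open>u\<close> does not flow to \<open>v\<close> under either
  map, so both orient this edge towards \<open>u\<close>.\<close>

lemma tree_flow_determined:
  assumes "tree_flow V E s" "tree_flow V E s'" and x: "x \<in> V"
    and agree: "\<And>k. s ((s ^^ k) x) = s' ((s ^^ k) x)" and y: "y \<in> V"
  shows "s y = s' y"
proof -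
  interpret s: tree_flow V E s by fact
  interpret s': tree_flow V E s' by fact
  have "\<forall>k. s ((s ^^ k) y) = s' ((s ^^ k) y)"
    using s.joined[OF x y]
  proof (induction rule: joined_induct)
    case refl
    show ?case
      using agree by blast
  next
    case (step u v)
    consider "s u = v" | "s v = u" "s u \<noteq> v"
      using s.flow_orients step(3) by blast
    then show ?case
    proof cases
      case 1
      show ?thesis
      proof
        fix k
        have "(s ^^ k) v = (s ^^ Suc k) u"
          using 1 by (simp add: funpow_swap1)
        then show "s ((s ^^ k) v) = s' ((s ^^ k) v)"
          using step(4) by metis
      qed
    next
      case 2
      have "s' u = s u"
        using step(4)[rule_format, of 0] by simp
      then have "s' v = u"
        using s'.flow_orients[OF step(3)] 2(2) by auto
      show ?thesis
      proof
        fix k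
        show "s ((s ^^ k) v) = s' ((s ^^ k) v)"
        proof (cases k)
          case 0
          then show ?thesis
            using \<open>s' v = u\<close> 2(1) by simp
        next
          case (Suc j)
          have "(s ^^ k) v = (s ^^ j) u"
            using 2(1) Suc by (simp add: funpow_swap1)
          then show ?thesis
            using step(4) by metis
        qed
      qed
    qed
  qed
  from this[rule_format, of 0] show ?thesis
    by simp
qed

section \<open>Products of trees\<close>

locale tree_product =
  fixes n :: nat and V :: "nat \<Rightarrow> 'a set" and E :: "nat \<Rightarrow> 'a set set"
  assumes trees: "i < n \<Longrightarrow> tree_graph (V i) (E i)"
begin

abbreviation X :: "(nat \<Rightarrow> 'a) set set" where "X \<equiv> product_cubes n V E"

definition W :: "(nat \<Rightarrow> 'a) set" where "W = PiE {..<n} V"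

lemma tree_factor: "i < n \<Longrightarrow> tree (V i) (E i)"
  using trees by (rule tree.intro)

lemmas factor_edge_in = tree.edge_in[OF tree_factor]

lemma factor_edge:
  assumes "i < n" "e \<in> E i"
  shows "e \<subseteq> V i" "card e = 2"
  using tree.simple[OF tree_factor[OF assms(1)]] assms(2) by (simp_all add: simple_graph_def)

lemma factor_nonempty: "i < n \<Longrightarrow> V i \<noteq> {}"
  using trees by (simp add: tree_graph_def connected_graph_def)

lemma W_nonempty: "W \<noteq> {}"
  unfolding W_def using factor_nonempty by (simp add: PiE_eq_empty_iff)

lemma W_in: "v \<in> W \<Longrightarrow> i < n \<Longrightarrow> v i \<in> V i"
  unfolding W_def by auto

lemma W_upd: "v \<in> W \<Longrightarrow> i < n \<Longrightarrow> a \<in> V i \<Longrightarrow> v(i := a) \<in> W"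
  unfolding W_def by (auto simp: PiE_iff extensional_def)

lemma W_upd_edge: "v \<in> W \<Longrightarrow> i < n \<Longrightarrow> {v i, a} \<in> E i \<Longrightarrow> v(i := a) \<in> W"
  by (blast intro: W_upd factor_edge_in(2))

lemma W_eqI: "v \<in> W \<Longrightarrow> u \<in> W \<Longrightarrow> (\<And>i. i < n \<Longrightarrow> v i = u i) \<Longrightarrow> v = u"
  unfolding W_def by (rule PiE_ext) auto

lemma ex_vertex: "i < n \<Longrightarrow> a \<in> V i \<Longrightarrow> \<exists>v\<in>W. v i = a"
proof -
  assume "i < n" "a \<in> V i"
  moreover obtain v where "v \<in> W"
    using W_nonempty by blast
  ultimately have "v(i := a) \<in> W" "(v(i := a)) i = a"
    by (simp_all add: W_upd)
  then show ?thesis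
    by (rule bexI[of _ "v(i := a)", rotated])
qed

section \<open>Cubes, edges and squares of the product\<close>

definition box_of :: "(nat \<Rightarrow> 'a set) \<Rightarrow> bool" where
  "box_of F \<longleftrightarrow> (\<forall>i<n. F i \<in> E i \<or> (\<exists>v\<in>V i. F i = {v}))"

lemma X_iff: "C \<in> X \<longleftrightarrow> (\<exists>F. C = PiE {..<n} F \<and> box_of F)"
  unfolding product_cubes_def box_of_def by (rule mem_Collect_eq)

lemma box_of_factor:
  assumes "box_of F" "i < n"
  shows "F i \<subseteq> V i" "card (F i) = (if F i \<in> E i then 2 else 1)"
proof -
  consider "F i \<in> E i" | v where "v \<in> V i" "F i = {v}" "F i \<notin> E i"
    using assms unfolding box_of_def by blast
  then have "F i \<subseteq> V i \<and> card (F i) = (if F i \<in> E i then 2 else 1)"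
    by cases (use factor_edge[OF assms(2)] in auto)
  then show "F i \<subseteq> V i" "card (F i) = (if F i \<in> E i then 2 else 1)"
    by blast+
qed

lemma box_of_singleton:
  assumes "box_of F" "i < n" "F i \<notin> E i" "u \<in> PiE {..<n} F" "v \<in> PiE {..<n} F"
  shows "u i = v i"
proof -
  obtain a where "F i = {a}"
    using assms(1-3) unfolding box_of_def by blast
  moreover have "u i \<in> F i" "v i \<in> F i"
    using assms(2,4,5) by auto
  ultimately show ?thesis
    by simp
qed

lemma box_of_edge:
  assumes "box_of F" "i < n" "u \<in> PiE {..<n} F" "v \<in> PiE {..<n} F" "u i \<noteq> v i"
  shows "F i = {u i, v i}" "{u i, v i} \<in> E i"
proof -
  have e: "F i \<in> E i"
    using box_of_singleton[OF assms(1,2) _ assms(3,4)] assms(5) by blast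
  have "{u i, v i} \<subseteq> F i"
    using assms(2-4) by auto
  moreover have "card (F i) = 2" "card {u i, v i} = 2"
    using factor_edge(2)[OF assms(2) e] assms(5) by simp_all
  ultimately have "{u i, v i} = F i"
    by (intro card_subset_eq) (auto intro: card_ge_0_finite)
  then show "F i = {u i, v i}" "{u i, v i} \<in> E i"
    using e by simp_all
qed

text \<open>Recovers the dimension from the cardinality: 2 vertices mean one edge factor and 4
  vertices mean two.\<close>

lemma box_of_card:
  assumes "box_of F"
  shows "card (PiE {..<n} F) = 2 ^ card {i. i < n \<and> F i \<in> E i}"
proof -
  have "card (PiE {..<n} F) = (\<Prod>i<n. card (F i))"
    by (rule card_PiE) simp
  also have "\<dots> = (\<Prod>i<n. if F i \<in> E i then 2 else 1)"
    using box_of_factor(2)[OF assms] by (intro prod.cong) auto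
  also have "\<dots> = (\<Prod>i\<in>{i\<in>{..<n}. F i \<in> E i}. 2)"
    by (rule prod.inter_filter[symmetric]) simp
  also have "\<dots> = 2 ^ card {i\<in>{..<n}. F i \<in> E i}"
    by (rule prod_constant)
  also have "{i\<in>{..<n}. F i \<in> E i} = {i. i < n \<and> F i \<in> E i}"
    by auto
  finally show ?thesis .
qed

lemma box_of_subset_W: "box_of F \<Longrightarrow> PiE {..<n} F \<subseteq> W"
  unfolding W_def using box_of_factor(1) by (intro PiE_mono) auto

lemma X_subset_W: "C \<in> X \<Longrightarrow> C \<subseteq> W"
  unfolding X_iff using box_of_subset_W by blast

lemma singletons_in_X:
  assumes "v \<in> W"
  shows "PiE {..<n} (\<lambda>i. {v i}) = {v}" "box_of (\<lambda>i. {v i})"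
proof -
  show "PiE {..<n} (\<lambda>i. {v i}) = {v}"
    using assms unfolding W_def by (intro PiE_singleton) (simp add: PiE_iff)
  show "box_of (\<lambda>i. {v i})"
    unfolding box_of_def using W_in[OF assms] by blast
qed

lemma vertices: "cc_vertices X = W"
proof
  show "cc_vertices X \<subseteq> W"
    unfolding cc_vertices_def using X_subset_W by blast
  show "W \<subseteq> cc_vertices X"
  proof
    fix v assume v: "v \<in> W"
    have "{v} \<in> X"
      unfolding X_iff using singletons_in_X[OF v] by metis
    then show "v \<in> cc_vertices X"
      unfolding cc_vertices_def by blast
  qed
qed

text \<open>Edges and squares arise from a vertex by one and two such replacements of a singleton
  factor.\<close>

lemma PiE_upd_edge:
  assumes F: "PiE {..<n} F = A" and i: "i < n" and A: "\<And>u. u \<in> A \<Longrightarrow> u i = a" and Fi: "F i = {a}"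
  shows "PiE {..<n} (F(i := {a, b})) = A \<union> (\<lambda>u. u(i := b)) ` A"
proof (intro Set.set_eqI iffI)
  fix u assume u: "u \<in> PiE {..<n} (F(i := {a, b}))"
  then have ui: "u i = a \<or> u i = b" and off: "\<And>j. j < n \<Longrightarrow> j \<noteq> i \<Longrightarrow> u j \<in> F j"
    and ext: "\<And>j. \<not> j < n \<Longrightarrow> u j = undefined"
    using i by (auto simp: PiE_iff extensional_def Ball_def split: if_splits)
  have "u(i := a) \<in> PiE {..<n} F"
    using off ext i Fi by (auto simp: PiE_iff extensional_def)
  then have ua: "u(i := a) \<in> A"
    using F by simp
  show "u \<in> A \<union> (\<lambda>u. u(i := b)) ` A"
  proof (cases "u i = a")
    case True
    then have "u(i := a) = u"
      by (rule fun_upd_idem)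
    then show ?thesis
      using ua by simp
  next
    case False
    then have "u = (u(i := a))(i := b)"
      using ui by auto
    then show ?thesis
      using ua by blast
  qed
next
  fix u assume "u \<in> A \<union> (\<lambda>u. u(i := b)) ` A"
  then obtain w where w: "w \<in> PiE {..<n} F" "u = w \<or> u = w(i := b)"
    using F by blast
  then have "w i = a"
    using A F by blast
  then show "u \<in> PiE {..<n} (F(i := {a, b}))"
    using w i by (auto simp: PiE_iff extensional_def)
qed

lemma edge_in_X:
  assumes v: "v \<in> W" and i: "i < n" and e: "{v i, b} \<in> E i"
  shows "{v, v(i := b)} \<in> cc_edges X"
proof -
  have "PiE {..<n} ((\<lambda>j. {v j})(i := {v i, b})) = {v} \<union> (\<lambda>u. u(i := b)) ` {v}"
    by (rule PiE_upd_edge[OF singletons_in_X(1)[OF v] i]) auto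
  moreover have "box_of ((\<lambda>j. {v j})(i := {v i, b}))"
    unfolding box_of_def using W_in[OF v] e by auto
  ultimately have "{v, v(i := b)} \<in> X"
    unfolding X_iff by (intro exI conjI) auto
  moreover have "v \<noteq> v(i := b)"
    using factor_edge_in(3)[OF i e] by (metis fun_upd_same)
  ultimately show ?thesis
    unfolding cc_edges_def by simp
qed

lemma edge_cases:
  assumes "e \<in> cc_edges X"
  obtains v i b where "v \<in> W" "i < n" "{v i, b} \<in> E i" "e = {v, v(i := b)}"
proof -
  obtain F where F: "e = PiE {..<n} F" "box_of F" and c: "card e = 2"
    using assms unfolding cc_edges_def X_iff by blast
  then have "2 ^ card {i. i < n \<and> F i \<in> E i} = (2 ^ 1 :: nat)"
    using box_of_card by simp
  then have "card {i. i < n \<and> F i \<in> E i} = 1"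
    by (rule power_inject_exp[THEN iffD1, rotated]) simp
  then obtain i where i: "{i. i < n \<and> F i \<in> E i} = {i}"
    by (rule card_1_singletonE)
  obtain u v where uv: "e = {v, u}" "v \<noteq> u"
    using c by (meson card_2_iff)
  have v: "v \<in> W" "u \<in> W"
    using uv(1) F box_of_subset_W by blast+
  have same: "v j = u j" if "j < n" "j \<noteq> i" for j
    by (rule box_of_singleton[OF F(2) that(1)]) (use i that uv(1) F(1) in auto)
  then have ne: "v i \<noteq> u i"
    using W_eqI[OF v] uv(2) by metis
  have "i < n"
    using i by blast
  have "u = v(i := u i)"
  proof (rule W_eqI[OF v(2) W_upd[OF v(1) \<open>i < n\<close> W_in[OF v(2) \<open>i < n\<close>]]])
    fix j assume "j < n"
    then show "u j = (v(i := u i)) j"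
      using same by simp
  qed
  then have "e = {v, v(i := u i)}"
    using uv(1) by simp
  moreover have "{v i, u i} \<in> E i"
    by (rule box_of_edge(2)[of F i v u]) (use uv(1) F \<open>i < n\<close> ne in auto)
  ultimately show ?thesis
    using that v(1) \<open>i < n\<close> by blast
qed

lemma adjacent_cases:
  assumes "{u, w} \<in> cc_edges X"
  obtains i where "u \<in> W" "i < n" "{u i, w i} \<in> E i" "w = u(i := w i)" "w \<in> W"
proof -
  obtain v i b where v: "v \<in> W" "i < n" "{v i, b} \<in> E i" "{u, w} = {v, v(i := b)}"
    using assms by (rule edge_cases)
  have vb: "v(i := b) \<in> W"
    by (rule W_upd_edge[OF v(1-3)])
  consider "u = v" "w = v(i := b)" | "u = v(i := b)" "w = v"
    using v(4) by (auto simp: doubleton_eq_iff)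
  then show ?thesis
  proof cases
    case 1
    then show ?thesis
      using that[of i] v vb by simp
  next
    case 2
    then show ?thesis
      using that[of i] v vb by (simp add: insert_commute)
  qed
qed

lemma square_in_X:
  assumes v: "v \<in> W" and ij: "i < n" "j < n" "i \<noteq> j" and a: "{v i, a} \<in> E i" and b: "{v j, b} \<in> E j"
  shows "{v, v(i := a), v(j := b), v(i := a, j := b)} \<in> cc_squares X"
proof -
  have "PiE {..<n} ((\<lambda>j. {v j})(i := {v i, a})) = {v} \<union> (\<lambda>u. u(i := a)) ` {v}"
    by (rule PiE_upd_edge[OF singletons_in_X(1)[OF v] ij(1)]) auto
  then have F: "PiE {..<n} ((\<lambda>j. {v j})(i := {v i, a})) = {v, v(i := a)}"
    by auto
  have "PiE {..<n} ((\<lambda>j. {v j})(i := {v i, a}, j := {v j, b}))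
      = {v, v(i := a)} \<union> (\<lambda>u. u(j := b)) ` {v, v(i := a)}"
    by (rule PiE_upd_edge[OF F ij(2)]) (use ij in auto)
  then have eq: "{v, v(i := a), v(j := b), v(i := a, j := b)} =
      PiE {..<n} ((\<lambda>j. {v j})(i := {v i, a}, j := {v j, b}))"
    by auto
  have "box_of ((\<lambda>j. {v j})(i := {v i, a}, j := {v j, b}))"
    unfolding box_of_def using W_in[OF v] a b by auto
  then have "{v, v(i := a), v(j := b), v(i := a, j := b)} \<in> X"
    unfolding X_iff using eq by blast
  moreover have "v i \<noteq> a" "v j \<noteq> b"
    using factor_edge_in(3) ij a b by blast+
  then have "v \<noteq> v(i := a)" "v \<noteq> v(j := b)" "v \<noteq> v(i := a, j := b)" "v(i := a) \<noteq> v(j := b)"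
    "v(i := a) \<noteq> v(i := a, j := b)" "v(j := b) \<noteq> v(i := a, j := b)"
    using ij(3) by (auto simp: fun_eq_iff)
  then have "card {v, v(i := a), v(j := b), v(i := a, j := b)} = 4"
    by simp
  ultimately show ?thesis
    unfolding cc_squares_def by blast
qed

text \<open>A factor of a cube has at most two vertices. Hence two different neighbours of a vertex
  in the same factor never lie in a common cube with it.\<close>

lemma cube_three_values:
  assumes "C \<in> X" "u \<in> C" "v \<in> C" "w \<in> C" "i < n"
  shows "u i = v i \<or> v i = w i \<or> u i = w i"
proof (rule ccontr)
  assume "\<not> ?thesis"
  then have ne: "u i \<noteq> v i" "v i \<noteq> w i" "u i \<noteq> w i"
    by blast+
  obtain F where F: "C = PiE {..<n} F" "box_of F"
    using assms(1) unfolding X_iff by blast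
  have "F i = {u i, v i}"
    by (rule box_of_edge(1)) (use assms F ne(1) in auto)
  moreover have "w i \<in> F i"
    using assms F by auto
  ultimately show False
    using ne by auto
qed

text \<open>An induction principle: the coordinates are changed one after the other, the
  \<open>i\<close>-th along a path with edges in \<open>F i\<close>. Taking \<open>F i\<close> empty
  freezes a coordinate, taking away an edge keeps the walk off a hyperplane.\<close>

lemma walk:
  assumes v: "v \<in> W" and u: "u \<in> W" and j: "\<And>i. i < n \<Longrightarrow> joined (V i) (F i) (v i) (u i)"
    and Pv: "P v"
    and step: "\<And>w i c. w \<in> W \<Longrightarrow> i < n \<Longrightarrow> c \<in> V i \<Longrightarrow> {w i, c} \<in> F i \<Longrightarrow> P w \<Longrightarrow> P (w(i := c))"
  shows "P u"
proof -
  define mix where "mix m = (\<lambda>i. if i < m then u i else v i)" for m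
  have mix: "mix m \<in> W" for m
    using u v unfolding mix_def W_def by (auto simp: PiE_iff extensional_def)
  have "m \<le> n \<Longrightarrow> P (mix m)" for m
  proof (induction m)
    case 0
    have "mix 0 = v"
      by (simp add: mix_def)
    then show ?case
      using Pv by simp
  next
    case (Suc m)
    then have m: "m < n" "P (mix m)"
      by simp_all
    from j[OF m(1)] have "P ((mix m)(m := u m))"
    proof (induction rule: joined_induct)
      case refl
      have "(mix m)(m := v m) = mix m"
        by (auto simp: mix_def fun_eq_iff)
      then show ?case
        using m by simp
    next
      case (step a c)
      have "P ((mix m)(m := a, m := c))"
      proof (rule assms(5)[OF W_upd[OF mix m(1) step(1)] m(1) step(2)])
        show "{((mix m)(m := a)) m, c} \<in> F m"
          using step(3) by simp
      qed (rule step(4))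
      then show ?case
        by (simp only: fun_upd_upd)
    qed
    moreover have "(mix m)(m := u m) = mix (Suc m)"
      by (auto simp: mix_def fun_eq_iff)
    ultimately show ?case
      by simp
  qed
  from this[of n] have "P (mix n)"
    by simp
  moreover have "mix n = u"
    by (rule W_eqI[OF mix u]) (simp add: mix_def)
  ultimately show ?thesis
    by simp
qed

text \<open>\<open>HP i a b\<close> is the hyperplane dual to the edge \<open>{a, b}\<close> of the \<open>i\<close>-th tree, and \<open>Hs i a b\<close> is
  its halfspace on the side of \<open>b\<close>.\<close>

definition HP :: "nat \<Rightarrow> 'a \<Rightarrow> 'a \<Rightarrow> (nat \<Rightarrow> 'a) set set" where
  "HP i a b = {{v, v(i := b)} | v. v \<in> W \<and> v i = a}"

definition Hs :: "nat \<Rightarrow> 'a \<Rightarrow> 'a \<Rightarrow> (nat \<Rightarrow> 'a) set" where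
  "Hs i a b = {v \<in> W. v i \<in> side (V i) (E i) a b}"

lemma HP_iff:
  assumes i: "i < n" and e: "{a, b} \<in> E i" and w: "w \<in> W" and j: "j < n" and wc: "{w j, c} \<in> E j"
  shows "{w, w(j := c)} \<in> HP i a b \<longleftrightarrow> j = i \<and> {w j, c} = {a, b}"
proof
  assume "{w, w(j := c)} \<in> HP i a b"
  then obtain v where v: "v \<in> W" "v i = a" "{w, w(j := c)} = {v, v(i := b)}"
    unfolding HP_def by blast
  have ne: "w j \<noteq> c" "a \<noteq> b"
    using factor_edge_in(3)[OF j wc] factor_edge_in(3)[OF i e] .
  have "j = i"
  proof (rule ccontr)
    assume "j \<noteq> i"
    then have "x i = w i" if "x \<in> {w, w(j := c)}" for x
      using that by auto
    then have "v i = w i" "(v(i := b)) i = w i"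
      unfolding v(3) by blast+
    then show False
      using ne v(2) by simp
  qed
  moreover have "(\<lambda>x. x j) ` {w, w(j := c)} = (\<lambda>x. x j) ` {v, v(i := b)}"
    by (simp only: v(3))
  ultimately show "j = i \<and> {w j, c} = {a, b}"
    using v(2) by simp
next
  assume ji: "j = i \<and> {w j, c} = {a, b}"
  then consider "w i = a" "c = b" | "w i = b" "c = a"
    by (auto simp: doubleton_eq_iff)
  then show "{w, w(j := c)} \<in> HP i a b"
  proof cases
    case 1
    then show ?thesis
      unfolding HP_def using w ji by blast
  next
    case 2
    have "w(i := a) \<in> W" "(w(i := a)) i = a" "(w(i := a))(i := b) = w"
      using W_upd[OF w i factor_edge_in(1)[OF i e]] 2 by auto
    moreover have "{w, w(j := c)} = {w(i := a), (w(i := a))(i := b)}"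
      using 2 ji calculation(3) by auto
    ultimately show ?thesis
      unfolding HP_def by blast
  qed
qed

text \<open>Opposite edges of a square run in the same factor. Otherwise their two factors would be
  all edge factors of the square, and the endpoint of \<open>e'\<close> with the \<open>j\<close>-th
  coordinate of \<open>v\<close> would lie on the first edge, against disjointness.\<close>

lemma opposite_forward:
  assumes v: "v \<in> W" and i: "i < n" and e: "{v i, b} \<in> E i"
    and opp: "({v, v(i := b)}, e') \<in> opposite_edges X"
  shows "\<exists>u\<in>W. u i = v i \<and> e' = {u, u(i := b)}"
proof -
  obtain s where s: "s \<in> cc_squares X" "{v, v(i := b)} \<subseteq> s" "e' \<subseteq> s" "{v, v(i := b)} \<inter> e' = {}"
    and e': "e' \<in> cc_edges X"
    using opp unfolding opposite_edges_def by blast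
  obtain F where F: "s = PiE {..<n} F" "box_of F" and card: "card s = 4"
    using s(1) unfolding cc_squares_def X_iff by blast
  obtain u j c where u: "u \<in> W" "j < n" "{u j, c} \<in> E j" "e' = {u, u(j := c)}"
    using e' by (rule edge_cases)
  have vs: "v \<in> PiE {..<n} F" "v(i := b) \<in> PiE {..<n} F" and us: "u \<in> PiE {..<n} F" "u(j := c) \<in> PiE {..<n} F"
    using s(2,3) u(4) F(1) by auto
  have ne: "v i \<noteq> b" "u j \<noteq> c"
    using factor_edge_in(3)[OF i e] factor_edge_in(3)[OF u(2,3)] .
  have Fi: "F i = {v i, b}" "F i \<in> E i"
    using box_of_edge[OF F(2) i vs] ne by auto
  have Fj: "F j = {u j, c}" "F j \<in> E j"
    using box_of_edge[OF F(2) u(2) us] ne by auto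
  have "j = i"
  proof (rule ccontr)
    assume ji: "j \<noteq> i"
    have "2 ^ card {k. k < n \<and> F k \<in> E k} = (2 ^ 2 :: nat)"
      using box_of_card[OF F(2)] card F(1) by simp
    then have two: "card {k. k < n \<and> F k \<in> E k} = 2"
      by (rule power_inject_exp[THEN iffD1, rotated]) simp
    have "{i, j} = {k. k < n \<and> F k \<in> E k}"
      by (rule card_subset_eq) (use two ji i u(2) Fi Fj in auto)
    then have rest: "F k \<notin> E k" if "k < n" "k \<noteq> i" "k \<noteq> j" for k
      using that by blast
    have "v j \<in> {u j, c}"
      using vs(1) u(2) Fj(1) by auto
    then have "u j = v j \<or> (u(j := c)) j = v j"
      by auto
    then obtain x where x: "x \<in> e'" "x j = v j"
      using u(4) by blast
    have xs: "x \<in> PiE {..<n} F"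
      using x(1) s(3) F(1) by blast
    have off: "x k = v k" if "k < n" "k \<noteq> i" for k
    proof (cases "k = j")
      case False
      then show ?thesis
        using box_of_singleton[OF F(2) that(1) rest[OF that] xs vs(1)] by blast
    qed (use x in simp)
    have "x i \<in> {v i, b}"
      using xs i Fi(1) by auto
    moreover have "x \<in> W"
      using xs box_of_subset_W[OF F(2)] by blast
    then have "x = v(i := x i)"
      using W_eqI[OF _ W_upd[OF v i W_in[OF _ i]]] off by simp
    ultimately have "x = v \<or> x = v(i := b)"
      by auto
    then show False
      using x(1) s(4) by blast
  qed
  then have "{u i, c} = {v i, b}"
    using Fi(1) Fj(1) by simp
  then consider "u i = v i" "c = b" | "u i = b" "c = v i"
    by (auto simp: doubleton_eq_iff)
  then show ?thesis
  proof cases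
    case 1
    then show ?thesis
      using u \<open>j = i\<close> by blast
  next
    case 2
    have "u(i := v i) \<in> W"
      by (rule W_upd[OF u(1) i W_in[OF v i]])
    moreover have "(u(i := v i))(i := b) = u"
      using 2 by auto
    then have "e' = {u(i := v i), (u(i := v i))(i := b)}"
      using u(4) \<open>j = i\<close> 2 by auto
    ultimately show ?thesis
      by (metis fun_upd_same)
  qed
qed

lemma opposite_square:
  assumes v: "v \<in> W" and ij: "i < n" "j < n" "i \<noteq> j" and a: "{v i, a} \<in> E i" and b: "{v j, b} \<in> E j"
  shows "({v, v(i := a)}, {v(j := b), v(j := b, i := a)}) \<in> opposite_edges X"
proof -
  have "v(j := b) \<in> W"
    by (rule W_upd_edge[OF v ij(2) b])
  then have "{v(j := b), v(j := b, i := a)} \<in> cc_edges X"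
    by (rule edge_in_X[OF _ ij(1)]) (use ij(3) a in simp)
  moreover have "{v, v(i := a)} \<in> cc_edges X"
    by (rule edge_in_X[OF v ij(1) a])
  moreover have "v j \<noteq> b"
    by (rule factor_edge_in(3)[OF ij(2) b])
  then have "{v, v(i := a)} \<inter> {v(j := b), v(j := b, i := a)} = {}"
    using ij(3) by (auto simp: fun_eq_iff)
  moreover have "v(j := b, i := a) = v(i := a, j := b)"
    using ij(3) by (auto simp: fun_eq_iff)
  then have "{v, v(i := a)} \<subseteq> {v, v(i := a), v(j := b), v(i := a, j := b)}"
    "{v(j := b), v(j := b, i := a)} \<subseteq> {v, v(i := a), v(j := b), v(i := a, j := b)}"
    by simp_all
  ultimately show ?thesis
    unfolding opposite_edges_def using square_in_X[OF v ij a b] by blast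
qed

text \<open>One inclusion iterates \<open>opposite_forward\<close>. For the other, a walk from
  \<open>v\<close> to \<open>u\<close> with frozen coordinate \<open>i\<close> crosses one square at
  every step.\<close>

lemma opposite_class:
  assumes v: "v \<in> W" and i: "i < n" and e: "{v i, b} \<in> E i"
  shows "(opposite_edges X)\<^sup>* `` {{v, v(i := b)}} = HP i (v i) b"
proof
  show "(opposite_edges X)\<^sup>* `` {{v, v(i := b)}} \<subseteq> HP i (v i) b"
  proof
    fix f assume "f \<in> (opposite_edges X)\<^sup>* `` {{v, v(i := b)}}"
    then have "({v, v(i := b)}, f) \<in> (opposite_edges X)\<^sup>*"
      by simp
    then show "f \<in> HP i (v i) b"
    proof (induction rule: rtrancl_induct)
      case base
      show ?case
        unfolding HP_def using v by blast
    next
      case (step f f')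
      then obtain u where u: "u \<in> W" "u i = v i" "f = {u, u(i := b)}"
        unfolding HP_def by blast
      have "\<exists>w\<in>W. w i = u i \<and> f' = {w, w(i := b)}"
        by (rule opposite_forward[OF u(1) i]) (use e u step(2) in simp_all)
      then show ?case
        unfolding HP_def using u(2) by auto
    qed
  qed
  show "HP i (v i) b \<subseteq> (opposite_edges X)\<^sup>* `` {{v, v(i := b)}}"
  proof
    fix f assume "f \<in> HP i (v i) b"
    then obtain u where u: "u \<in> W" "u i = v i" "f = {u, u(i := b)}"
      unfolding HP_def by blast
    have "u i = v i \<and> ({v, v(i := b)}, {u, u(i := b)}) \<in> (opposite_edges X)\<^sup>*"
    proof (rule walk[where F = "\<lambda>j. if j = i then {} else E j", OF v u(1)])
      fix j assume j: "j < n"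
      show "joined (V j) (if j = i then {} else E j) (v j) (u j)"
      proof (cases "j = i")
        case True
        then show ?thesis
          using u(2) joined_refl[OF W_in[OF v i], of "{}"] by simp
      next
        case False
        then show ?thesis
          using tree.joined[OF tree_factor[OF j] W_in[OF v j] W_in[OF u(1) j]] by simp
      qed
    next
      fix w j c assume w: "w \<in> W" "j < n" "c \<in> V j" "{w j, c} \<in> (if j = i then {} else E j)"
        and P: "w i = v i \<and> ({v, v(i := b)}, {w, w(i := b)}) \<in> (opposite_edges X)\<^sup>*"
      have ji: "j \<noteq> i" "{w j, c} \<in> E j"
        using w(4) by (auto split: if_splits)
      have "({w, w(i := b)}, {w(j := c), w(j := c, i := b)}) \<in> opposite_edges X"
        by (rule opposite_square[OF w(1) i w(2) ji(1)[symmetric] _ ji(2)]) (use P e in simp)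
      then show "(w(j := c)) i = v i \<and> ({v, v(i := b)}, {w(j := c), w(j := c, i := b)}) \<in> (opposite_edges X)\<^sup>*"
        using P ji(1) by (auto intro: rtrancl_into_rtrancl)
    qed simp
    then show "f \<in> (opposite_edges X)\<^sup>* `` {{v, v(i := b)}}"
      using u(3) by simp
  qed
qed

lemma hyperplane_cases:
  assumes "h \<in> hyperplanes X"
  obtains i a b where "i < n" "{a, b} \<in> E i" "h = HP i a b"
proof -
  obtain e where e: "e \<in> cc_edges X" "h = (opposite_edges X)\<^sup>* `` {e}"
    using assms unfolding hyperplanes_def by (rule quotientE)
  obtain v i b where v: "v \<in> W" "i < n" "{v i, b} \<in> E i" "e = {v, v(i := b)}"
    using e(1) by (rule edge_cases)
  have "h = HP i (v i) b"
    unfolding e(2) v(4) by (rule opposite_class[OF v(1-3)])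
  then show ?thesis
    using that v by blast
qed

lemma HP_in_hyperplanes:
  assumes i: "i < n" and e: "{a, b} \<in> E i"
  shows "HP i a b \<in> hyperplanes X"
proof -
  obtain v where v: "v \<in> W" "v i = a"
    using ex_vertex[OF i factor_edge_in(1)[OF i e]] by blast
  have "(opposite_edges X)\<^sup>* `` {{v, v(i := b)}} = HP i a b"
    using opposite_class[OF v(1) i, of b] v(2) e by simp
  moreover have "{v, v(i := b)} \<in> cc_edges X"
    by (rule edge_in_X[OF v(1) i]) (use v e in simp)
  ultimately show ?thesis
    unfolding hyperplanes_def by (metis quotientI)
qed

lemma HP_sym:
  assumes i: "i < n" and e: "{a, b} \<in> E i"
  shows "HP i a b = HP i b a"
proof -
  have sub: "HP i a b \<subseteq> HP i b a" if e: "{a, b} \<in> E i" for a b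
  proof
    fix f assume "f \<in> HP i a b"
    then obtain v where v: "v \<in> W" "v i = a" "f = {v, v(i := b)}"
      unfolding HP_def by blast
    have e': "{b, a} \<in> E i"
      using e by (simp add: insert_commute)
    show "f \<in> HP i b a"
      unfolding v(3) HP_iff[OF i e' v(1) i, of b, unfolded v(2), OF e]
      by (simp add: insert_commute)
  qed
  show ?thesis
    using sub[of a b] sub[of b a] e by (simp add: insert_commute subset_antisym)
qed

text \<open>An edge off the hyperplane does not change the half-tree containing coordinate
  \<open>i\<close>. Conversely, \<open>walk\<close> moves coordinate \<open>i\<close> within its
  half-tree and the other coordinates freely.\<close>

lemma joined_off_hyperplane:
  assumes i: "i < n" and e: "{a, b} \<in> E i" and y: "y \<in> W" and z: "z \<in> W"
  shows "joined W (cc_edges X - HP i a b) y z \<longleftrightarrow>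
    (y i \<in> side (V i) (E i) a b \<longleftrightarrow> z i \<in> side (V i) (E i) a b)"
proof
  note T = tree_factor[OF i]
  have keep: "w i \<in> side (V i) (E i) a b"
    if f: "{u, w} \<in> cc_edges X - HP i a b" and u: "u i \<in> side (V i) (E i) a b" for u w
  proof -
    have "{u, w} \<in> cc_edges X"
      using f by blast
    then obtain j where j: "u \<in> W" "j < n" "{u j, w j} \<in> E j" "w = u(j := w j)" "w \<in> W"
      by (rule adjacent_cases)
    show ?thesis
    proof (cases "j = i")
      case True
      have "{u, u(j := w j)} \<notin> HP i a b"
        using f j(4) by simp
      then have "{u i, w i} \<noteq> {a, b}"
        using HP_iff[OF i e j(1-3)] True by simp
      then show ?thesis
        using tree.side_step[OF T u] j(3) True by simp
    next
      case False
      then have "w i = u i"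
        by (subst j(4)) simp
      then show ?thesis
        using u by simp
    qed
  qed
  assume "joined W (cc_edges X - HP i a b) y z"
  then show "y i \<in> side (V i) (E i) a b \<longleftrightarrow> z i \<in> side (V i) (E i) a b"
  proof (induction rule: joined_induct)
    case (step u w)
    have "{w, u} \<in> cc_edges X - HP i a b"
      using step(3) by (simp only: insert_commute)
    then show ?case
      using step(4) keep[OF step(3)] keep[of w u] by blast
  qed simp
next
  note T = tree_factor[OF i]
  assume same: "y i \<in> side (V i) (E i) a b \<longleftrightarrow> z i \<in> side (V i) (E i) a b"
  show "joined W (cc_edges X - HP i a b) y z"
  proof (rule walk[where F = "\<lambda>j. if j = i then E i - {{a, b}} else E j", OF y z])
    fix j assume j: "j < n"
    show "joined (V j) (if j = i then E i - {{a, b}} else E j) (y j) (z j)"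
    proof (cases "j = i")
      case True
      have "joined (V i) (E i - {{a, b}}) (y i) (z i)"
      proof (cases "y i \<in> side (V i) (E i) a b")
        case True
        then show ?thesis
          using same joined_trans[OF joined_sym] unfolding side_iff by metis
      next
        case False
        then have "y i \<in> side (V i) (E i) b a" "z i \<in> side (V i) (E i) b a"
          using same tree.side_cover[OF T e] W_in[OF y i] W_in[OF z i] by blast+
        then have "joined (V i) (E i - {{a, b}}) a (y i)" "joined (V i) (E i - {{a, b}}) a (z i)"
          by (simp_all add: side_iff insert_commute)
        then show ?thesis
          using joined_trans[OF joined_sym] by metis
      qed
      then show ?thesis
        using True by simp
    next
      case False
      then show ?thesis
        using tree.joined[OF tree_factor[OF j] W_in[OF y j] W_in[OF z j]] by simp
    qed
  next
    show "joined W (cc_edges X - HP i a b) y y"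
      using y by (rule joined_refl)
  next
    fix w j c assume w: "w \<in> W" "j < n" "c \<in> V j" "{w j, c} \<in> (if j = i then E i - {{a, b}} else E j)"
      and P: "joined W (cc_edges X - HP i a b) y w"
    have wc: "{w j, c} \<in> E j" "\<not> (j = i \<and> {w j, c} = {a, b})"
      using w(4) by (auto split: if_splits)
    then have "{w, w(j := c)} \<in> cc_edges X - HP i a b"
      using HP_iff[OF i e w(1,2) wc(1)] edge_in_X[OF w(1,2) wc(1)] by blast
    then show "joined W (cc_edges X - HP i a b) y (w(j := c))"
      by (rule joined_step[OF P _ W_upd[OF w(1-3)]])
  qed
qed

lemma halfspaces_HP:
  assumes i: "i < n" and e: "{a, b} \<in> E i"
  shows "halfspaces X (HP i a b) = {Hs i a b, Hs i b a}"
proof -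
  note T = tree_factor[OF i]
  have e': "{b, a} \<in> E i"
    using e by (simp add: insert_commute)
  have other: "v i \<in> side (V i) (E i) b a \<longleftrightarrow> v i \<notin> side (V i) (E i) a b" if "v \<in> W" for v
    using tree.side_cover[OF T e W_in[OF that i]] tree.side_disjoint[OF T e] by blast
  define C where "C y = {z \<in> W. joined W (cc_edges X - HP i a b) y z}" for y
  have C: "C y = (if y i \<in> side (V i) (E i) a b then Hs i a b else Hs i b a)" if "y \<in> W" for y
    unfolding C_def Hs_def using joined_off_hyperplane[OF i e that] other by auto
  have half: "halfspaces X (HP i a b) = C ` W"
    unfolding halfspaces_def graph_components_def vertices C_def by auto
  obtain v w where v: "v \<in> W" "v i = a" and w: "w \<in> W" "w i = b"
    using ex_vertex[OF i factor_edge_in(1)[OF i e]] ex_vertex[OF i factor_edge_in(2)[OF i e]] by blast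
  have "C w = Hs i a b"
    using C[OF w(1)] w(2) tree.head_in_side[OF T e] by simp
  moreover have "C v = Hs i b a"
    using C[OF v(1)] v(2) tree.tail_notin_side[OF T e] by simp
  ultimately have "{Hs i a b, Hs i b a} \<subseteq> C ` W"
    using v(1) w(1) by blast
  moreover have "C ` W \<subseteq> {Hs i a b, Hs i b a}"
    using C by auto
  ultimately show ?thesis
    unfolding half by (rule subset_antisym[rotated])
qed

lemma in_Hs:
  assumes i: "i < n" and e: "{a, b} \<in> E i" and v: "v \<in> W"
  shows "v i = b \<Longrightarrow> v \<in> Hs i a b" "v i = b \<Longrightarrow> v \<notin> Hs i b a"
  using tree.head_in_side[OF tree_factor[OF i] e] tree.tail_notin_side[OF tree_factor[OF i], of b a] e v
  by (simp_all add: Hs_def insert_commute)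

lemma Hs_disjoint_at_vertex:
  assumes i: "i < n" and e: "{a, b} \<in> E i" "{a, b'} \<in> E i" "b \<noteq> b'"
  shows "Hs i a b \<inter> Hs i a b' = {}"
  using tree.sides_at_vertex_disjoint[OF tree_factor[OF i] e] unfolding Hs_def by blast

lemma Hs_neq:
  assumes i: "i < n" and e: "{a, b} \<in> E i"
  shows "Hs i a b \<noteq> Hs i b a"
proof -
  obtain v where "v \<in> W" "v i = b"
    using ex_vertex[OF i factor_edge_in(2)[OF i e]] by blast
  then show ?thesis
    using in_Hs[OF i e] by blast
qed

section \<open>Flows and shifts given by an ultrafilter\<close>

definition points :: "((nat \<Rightarrow> 'a) set set \<Rightarrow> (nat \<Rightarrow> 'a) set) \<Rightarrow> nat \<Rightarrow> 'a \<Rightarrow> 'a \<Rightarrow> bool" where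
  "points \<omega> i a b \<longleftrightarrow> {a, b} \<in> E i \<and> \<omega> (HP i a b) = Hs i a b"

text \<open>For an ultrafilter the choice is unique by \<open>points_unique\<close>. A vertex
  without outgoing edge is a sink and gets itself as value, so the flow can be iterated without
  end.\<close>

definition flow :: "((nat \<Rightarrow> 'a) set set \<Rightarrow> (nat \<Rightarrow> 'a) set) \<Rightarrow> nat \<Rightarrow> 'a \<Rightarrow> 'a" where
  "flow \<omega> i a = (if \<exists>b. points \<omega> i a b then SOME b. points \<omega> i a b else a)"

definition shift :: "(nat \<Rightarrow> nat) \<Rightarrow> ((nat \<Rightarrow> 'a) set set \<Rightarrow> (nat \<Rightarrow> 'a) set) \<Rightarrow> (nat \<Rightarrow> 'a) \<Rightarrow> nat \<Rightarrow> 'a" where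
  "shift e \<omega> v = (\<lambda>i\<in>{..<n}. (flow \<omega> i ^^ e i) (v i))"

lemma ultrafilterD:
  assumes "\<omega> \<in> ultrafilters X"
  shows "h \<in> hyperplanes X \<Longrightarrow> \<omega> h \<in> halfspaces X h"
    "h \<in> hyperplanes X \<Longrightarrow> k \<in> hyperplanes X \<Longrightarrow> \<omega> h \<inter> \<omega> k \<noteq> {}"
  using assms unfolding ultrafilters_def by auto

text \<open>The halfspaces beyond two different edges leaving \<open>a\<close> are disjoint, so an
  ultrafilter cannot contain both.\<close>

lemma points_unique:
  assumes \<omega>: "\<omega> \<in> ultrafilters X" and i: "i < n" and p: "points \<omega> i a b" "points \<omega> i a b'"
  shows "b = b'"
proof (rule ccontr)
  assume ne: "b \<noteq> b'"
  have e: "{a, b} \<in> E i" "{a, b'} \<in> E i" and w: "\<omega> (HP i a b) = Hs i a b" "\<omega> (HP i a b') = Hs i a b'"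
    using p unfolding points_def by blast+
  have "\<omega> (HP i a b) \<inter> \<omega> (HP i a b') \<noteq> {}"
    by (rule ultrafilterD(2)[OF \<omega> HP_in_hyperplanes[OF i e(1)] HP_in_hyperplanes[OF i e(2)]])
  then show False
    unfolding w using Hs_disjoint_at_vertex[OF i e ne] by blast
qed

lemma points_xor:
  assumes \<omega>: "\<omega> \<in> ultrafilters X" and i: "i < n" and e: "{a, b} \<in> E i"
  shows "points \<omega> i a b \<noteq> points \<omega> i b a"
proof -
  have e': "{b, a} \<in> E i"
    using e by (simp add: insert_commute)
  have "\<omega> (HP i a b) \<in> {Hs i a b, Hs i b a}"
    using ultrafilterD(1)[OF \<omega> HP_in_hyperplanes[OF i e]] unfolding halfspaces_HP[OF i e] .
  then show ?thesis
    unfolding points_def HP_sym[OF i e] using e e' Hs_neq[OF i e] by auto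
qed

lemma flow_eqI:
  assumes "\<omega> \<in> ultrafilters X" "i < n" "points \<omega> i a b"
  shows "flow \<omega> i a = b"
proof -
  have "points \<omega> i a (SOME b. points \<omega> i a b)"
    by (rule someI[of "points \<omega> i a", OF assms(3)])
  from points_unique[OF assms(1,2) this assms(3)] show ?thesis
    unfolding flow_def using assms(3) by auto
qed

lemma flow_points:
  assumes "flow \<omega> i a \<noteq> a"
  shows "points \<omega> i a (flow \<omega> i a)"
proof -
  have ex: "\<exists>b. points \<omega> i a b"
    using assms unfolding flow_def by (auto split: if_splits)
  then show ?thesis
    unfolding flow_def by (simp add: someI_ex)
qed

lemma flow_iff:
  assumes "\<omega> \<in> ultrafilters X" "i < n" "a \<noteq> b"
  shows "flow \<omega> i a = b \<longleftrightarrow> points \<omega> i a b"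
  using flow_eqI[OF assms(1,2)] flow_points[of \<omega> i a] assms(3) by metis

lemma tree_flow_flow:
  assumes \<omega>: "\<omega> \<in> ultrafilters X" and i: "i < n"
  shows "tree_flow (V i) (E i) (flow \<omega> i)"
proof (intro tree_flow.intro tree_flow_axioms.intro tree_factor[OF i])
  fix x assume x: "x \<in> V i"
  have edge: "{x, flow \<omega> i x} \<in> E i" if "flow \<omega> i x \<noteq> x"
    using flow_points[OF that] unfolding points_def by blast
  then show "{x, flow \<omega> i x} \<in> E i" if "flow \<omega> i x \<noteq> x"
    using that .
  show "flow \<omega> i x \<in> V i"
  proof (cases "flow \<omega> i x = x")
    case False
    then show ?thesis
      by (rule factor_edge_in(2)[OF i edge])
  qed (use x in simp)
next
  fix x y assume e: "{x, y} \<in> E i"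
  have "x \<noteq> y"
    by (rule factor_edge_in(3)[OF i e])
  then show "(flow \<omega> i x = y) \<noteq> (flow \<omega> i y = x)"
    using flow_iff[OF \<omega> i, of x y] flow_iff[OF \<omega> i, of y x] points_xor[OF \<omega> i e] by simp
qed

lemma flow_in: "\<omega> \<in> ultrafilters X \<Longrightarrow> i < n \<Longrightarrow> a \<in> V i \<Longrightarrow> flow \<omega> i a \<in> V i"
  by (rule tree_flow.flow_in[OF tree_flow_flow])

lemma funpow_flow_in: "\<omega> \<in> ultrafilters X \<Longrightarrow> i < n \<Longrightarrow> a \<in> V i \<Longrightarrow> (flow \<omega> i ^^ k) a \<in> V i"
  by (rule tree_flow.funpow_flow_in[OF tree_flow_flow])

lemma shift_apply: "i < n \<Longrightarrow> shift e \<omega> v i = (flow \<omega> i ^^ e i) (v i)"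
  by (simp add: shift_def)

lemma shift_in_W:
  assumes "\<omega> \<in> ultrafilters X" "v \<in> W"
  shows "shift e \<omega> v \<in> W"
  unfolding shift_def W_def using funpow_flow_in[OF assms(1)] W_in[OF assms(2)] by auto

lemma shift_0: 
  assumes "\<omega> \<in> ultrafilters X" "v \<in> W"
  shows "shift 0 \<omega> v = v"
  by (rule W_eqI[OF shift_in_W[OF assms] assms(2)]) (simp add: shift_apply)

lemma shift_plus: "shift (e + f) \<omega> v = shift e \<omega> (shift f \<omega> v)"
  unfolding shift_def by (auto simp: funpow_add fun_eq_iff)

lemma shift_merge:
  assumes \<omega>: "\<omega> \<in> ultrafilters X" and v: "v \<in> W" and w: "w \<in> W"
  shows "\<exists>t. \<exists>e\<in>vbox n t. \<exists>f\<in>vbox n t. shift e \<omega> v = shift f \<omega> w"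
proof -
  have "\<forall>i. \<exists>k l. i < n \<longrightarrow> (flow \<omega> i ^^ k) (v i) = (flow \<omega> i ^^ l) (w i)"
    using tree_flow.merge[OF tree_flow_flow[OF \<omega>] W_in[OF v] W_in[OF w]] by blast
  then obtain k l where kl: "\<And>i. i < n \<Longrightarrow> (flow \<omega> i ^^ k i) (v i) = (flow \<omega> i ^^ l i) (w i)"
    by metis
  define t where "t = (\<Sum>i<n. k i + l i)"
  have kt: "k i + l i \<le> t" if "i < n" for i
    unfolding t_def using that by (intro member_le_sum) auto
  define e f where "e i = (if i < n then k i else 0)" and "f i = (if i < n then l i else 0)" for i
  have "e \<in> vbox n t" "f \<in> vbox n t"
    unfolding vbox_def e_def f_def using kt by (auto dest: add_leD1 add_leD2)
  moreover have "shift e \<omega> v = shift f \<omega> w"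
    by (rule W_eqI[OF shift_in_W[OF \<omega> v] shift_in_W[OF \<omega> w]]) (simp add: shift_apply e_def f_def kl)
  ultimately show ?thesis
    by blast
qed

definition unit :: "nat \<Rightarrow> nat \<Rightarrow> nat \<Rightarrow> nat" where
  "unit i k = (\<lambda>j. if j = i then k else 0)"

lemma unit_in_vbox: "i < n \<Longrightarrow> k \<le> t \<Longrightarrow> unit i k \<in> vbox n t"
  by (simp add: unit_def vbox_def)

lemma shift_unit:
  assumes "\<omega> \<in> ultrafilters X" "v \<in> W" "i < n"
  shows "shift (unit i k) \<omega> v = v(i := (flow \<omega> i ^^ k) (v i))"
  by (rule W_eqI[OF shift_in_W[OF assms(1,2)] W_upd[OF assms(2,3) funpow_flow_in[OF assms(1,3) W_in[OF assms(2,3)]]]])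
    (simp add: shift_apply unit_def)

lemma ultrafilter_eqI:
  assumes \<omega>: "\<omega> \<in> ultrafilters X" and \<eta>: "\<eta> \<in> ultrafilters X"
    and eq: "\<And>i a. i < n \<Longrightarrow> a \<in> V i \<Longrightarrow> flow \<omega> i a = flow \<eta> i a"
  shows "\<omega> = \<eta>"
proof (rule PiE_ext)
  show "\<omega> \<in> PiE (hyperplanes X) (halfspaces X)" "\<eta> \<in> PiE (hyperplanes X) (halfspaces X)"
    using \<omega> \<eta> unfolding ultrafilters_def by auto
  fix h assume "h \<in> hyperplanes X"
  then obtain i a b where h: "i < n" "{a, b} \<in> E i" "h = HP i a b"
    by (rule hyperplane_cases)
  have ab: "a \<in> V i" "a \<noteq> b"
    using factor_edge_in[OF h(1,2)] by blast+
  have "points \<omega> i a b \<longleftrightarrow> points \<eta> i a b"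
    using flow_iff[OF \<omega> h(1) ab(2)] flow_iff[OF \<eta> h(1) ab(2)] eq[OF h(1) ab(1)] by simp
  then have "\<omega> h = Hs i a b \<longleftrightarrow> \<eta> h = Hs i a b"
    unfolding points_def h(3) using h(2) by blast
  moreover have "\<omega> h \<in> {Hs i a b, Hs i b a}" "\<eta> h \<in> {Hs i a b, Hs i b a}"
    using ultrafilterD(1)[OF \<omega> HP_in_hyperplanes[OF h(1,2)]]
      ultrafilterD(1)[OF \<eta> HP_in_hyperplanes[OF h(1,2)]]
    unfolding halfspaces_HP[OF h(1,2)] h(3) by blast+
  ultimately show "\<omega> h = \<eta> h"
    by auto
qed

text \<open>Shifts by multiples of a unit vector trace the flow orbit of \<open>v i\<close> in each
  tree, and one orbit determines the flow by \<open>tree_flow_determined\<close>.\<close>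

lemma shift_determines:
  assumes \<omega>: "\<omega> \<in> ultrafilters X" and \<eta>: "\<eta> \<in> ultrafilters X" and v: "v \<in> W"
    and eq: "\<And>t e. e \<in> vbox n t \<Longrightarrow> shift e \<omega> v = shift e \<eta> v"
  shows "\<omega> = \<eta>"
proof (rule ultrafilter_eqI[OF \<omega> \<eta>])
  fix i a assume i: "i < n" and a: "a \<in> V i"
  have pow: "(flow \<omega> i ^^ k) (v i) = (flow \<eta> i ^^ k) (v i)" for k
    using fun_cong[OF eq[OF unit_in_vbox[OF i order_refl]], of k i] i
    by (simp add: shift_apply unit_def)
  show "flow \<omega> i a = flow \<eta> i a"
  proof (rule tree_flow_determined[OF tree_flow_flow[OF \<omega> i] tree_flow_flow[OF \<eta> i] W_in[OF v i] _ a])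
    fix k
    have "flow \<omega> i ((flow \<omega> i ^^ k) (v i)) = (flow \<eta> i ^^ Suc k) (v i)"
      using pow[of "Suc k"] by simp
    then show "flow \<omega> i ((flow \<omega> i ^^ k) (v i)) = flow \<eta> i ((flow \<omega> i ^^ k) (v i))"
      using pow[of k] by simp
  qed
qed

end

section \<open>Cubical actions on products of trees\<close>

locale product_action = tree_product n V E + group G
  for n and V :: "nat \<Rightarrow> 'a set" and E and G :: "('g, 'm) monoid_scheme" (structure) +
  fixes \<phi> :: "'g \<Rightarrow> (nat \<Rightarrow> 'a) \<Rightarrow> (nat \<Rightarrow> 'a)"
  assumes action: "cubical_action G X \<phi>"
begin

section \<open>Images of edges, hyperplanes, halfspaces and ultrafilters\<close>

lemma group_action: "group_action G W \<phi>"
  using action unfolding cubical_action_def vertices by blast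

lemma \<phi>_in: "g \<in> carrier G \<Longrightarrow> v \<in> W \<Longrightarrow> \<phi> g v \<in> W"
  by (rule group_action.element_image[OF group_action]) auto

lemma \<phi>_mult: "g \<in> carrier G \<Longrightarrow> h \<in> carrier G \<Longrightarrow> v \<in> W \<Longrightarrow> \<phi> (g \<otimes> h) v = \<phi> g (\<phi> h v)"
  using group_action.composition_rule[OF group_action] by blast

lemma \<phi>_one: "v \<in> W \<Longrightarrow> \<phi> \<one> v = v"
  using group_action.id_eq_one[OF group_action] by (metis restrict_apply')

lemma \<phi>_inv: "g \<in> carrier G \<Longrightarrow> v \<in> W \<Longrightarrow> \<phi> (inv g) (\<phi> g v) = v"
  by (simp add: \<phi>_one flip: \<phi>_mult)

lemma \<phi>_inv': "g \<in> carrier G \<Longrightarrow> v \<in> W \<Longrightarrow> \<phi> g (\<phi> (inv g) v) = v"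
  using \<phi>_inv[of "inv g" v] by simp

lemma image_inv:
  assumes "g \<in> carrier G" "C \<subseteq> W"
  shows "\<phi> (inv g) ` \<phi> g ` C = C"
proof -
  have "\<phi> (inv g) ` \<phi> g ` C = id ` C"
    unfolding image_image by (rule image_cong[OF refl]) (use \<phi>_inv assms in auto)
  then show ?thesis
    by simp
qed

lemma image_inv': "g \<in> carrier G \<Longrightarrow> C \<subseteq> W \<Longrightarrow> \<phi> g ` \<phi> (inv g) ` C = C"
  using image_inv[of "inv g" C] by simp

lemma image_card: "g \<in> carrier G \<Longrightarrow> C \<subseteq> W \<Longrightarrow> card (\<phi> g ` C) = card C"
  by (intro card_image inj_on_inverseI[of C "\<phi> (inv g)"]) (use \<phi>_inv in auto)

lemma image_X: "g \<in> carrier G \<Longrightarrow> C \<in> X \<Longrightarrow> \<phi> g ` C \<in> X"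
  using action X_subset_W unfolding cubical_action_def cubical_automorphism_def vertices by blast

lemma edge_subset: "e \<in> cc_edges X \<Longrightarrow> e \<subseteq> W"
  unfolding cc_edges_def using X_subset_W by blast

lemma image_edge: "g \<in> carrier G \<Longrightarrow> e \<in> cc_edges X \<Longrightarrow> \<phi> g ` e \<in> cc_edges X"
  using image_X image_card X_subset_W unfolding cc_edges_def by simp

lemma image_square: "g \<in> carrier G \<Longrightarrow> s \<in> cc_squares X \<Longrightarrow> \<phi> g ` s \<in> cc_squares X"
  using image_X image_card X_subset_W unfolding cc_squares_def by simp

lemma image_opposite:
  assumes g: "g \<in> carrier G" and opp: "(e, e') \<in> opposite_edges X"
  shows "(\<phi> g ` e, \<phi> g ` e') \<in> opposite_edges X"
proof -
  obtain s where e: "e \<in> cc_edges X" "e' \<in> cc_edges X" and s: "s \<in> cc_squares X" "e \<subseteq> s" "e' \<subseteq> s" "e \<inter> e' = {}"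
    using opp unfolding opposite_edges_def by blast
  have "inj_on (\<phi> g) W"
    by (rule inj_on_inverseI[of W "\<phi> (inv g)"]) (rule \<phi>_inv[OF g])
  then have "\<phi> g ` e \<inter> \<phi> g ` e' = \<phi> g ` (e \<inter> e')"
    using edge_subset[OF e(1)] edge_subset[OF e(2)] by (rule inj_on_image_Int[symmetric])
  then have "\<phi> g ` e \<inter> \<phi> g ` e' = {}"
    using s(4) by simp
  then show ?thesis
    unfolding opposite_edges_def
    by (intro CollectI case_prodI conjI bexI[of _ "\<phi> g ` s"] image_edge[OF g] image_square[OF g]
        image_mono e s)
qed

lemma opposite_star_edge:
  assumes "(e, e') \<in> (opposite_edges X)\<^sup>*" "e \<in> cc_edges X"
  shows "e' \<in> cc_edges X"
  using assms by (induction rule: rtrancl_induct) (auto simp: opposite_edges_def)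

lemma image_opposite_star:
  assumes "g \<in> carrier G" "(e, e') \<in> (opposite_edges X)\<^sup>*"
  shows "(\<phi> g ` e, \<phi> g ` e') \<in> (opposite_edges X)\<^sup>*"
  using assms(2)
proof (induction rule: rtrancl_induct)
  case (step y z)
  then show ?case
    using image_opposite[OF assms(1)] by (meson rtrancl_into_rtrancl)
qed simp

lemma image_class:
  assumes g: "g \<in> carrier G" and e: "e \<in> cc_edges X"
  shows "(`) (\<phi> g) ` ((opposite_edges X)\<^sup>* `` {e}) = (opposite_edges X)\<^sup>* `` {\<phi> g ` e}"
proof
  show "(`) (\<phi> g) ` ((opposite_edges X)\<^sup>* `` {e}) \<subseteq> (opposite_edges X)\<^sup>* `` {\<phi> g ` e}"
    using image_opposite_star[OF g] by auto
  show "(opposite_edges X)\<^sup>* `` {\<phi> g ` e} \<subseteq> (`) (\<phi> g) ` ((opposite_edges X)\<^sup>* `` {e})"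
  proof
    fix f assume "f \<in> (opposite_edges X)\<^sup>* `` {\<phi> g ` e}"
    then have f: "(\<phi> g ` e, f) \<in> (opposite_edges X)\<^sup>*"
      by simp
    have "f \<subseteq> W"
      by (rule edge_subset[OF opposite_star_edge[OF f image_edge[OF g e]]])
    then have "f = \<phi> g ` \<phi> (inv g) ` f"
      using image_inv'[OF g] by simp
    moreover have "(\<phi> (inv g) ` \<phi> g ` e, \<phi> (inv g) ` f) \<in> (opposite_edges X)\<^sup>*"
      by (rule image_opposite_star[OF inv_closed[OF g] f])
    then have "\<phi> (inv g) ` f \<in> (opposite_edges X)\<^sup>* `` {e}"
      using image_inv[OF g edge_subset[OF e]] by simp
    ultimately show "f \<in> (`) (\<phi> g) ` ((opposite_edges X)\<^sup>* `` {e})"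
      by blast
  qed
qed

lemma image_hyperplane:
  assumes g: "g \<in> carrier G" and h: "h \<in> hyperplanes X"
  shows "(`) (\<phi> g) ` h \<in> hyperplanes X"
proof -
  obtain e where e: "e \<in> cc_edges X" "h = (opposite_edges X)\<^sup>* `` {e}"
    using h unfolding hyperplanes_def by (rule quotientE)
  show ?thesis
    unfolding e(2) image_class[OF g e(1)] hyperplanes_def by (rule quotientI) (rule image_edge[OF g e(1)])
qed

lemma hyperplane_subset:
  assumes "h \<in> hyperplanes X" "e \<in> h"
  shows "e \<in> cc_edges X"
proof -
  obtain f where "f \<in> cc_edges X" "h = (opposite_edges X)\<^sup>* `` {f}"
    using assms(1) unfolding hyperplanes_def by (rule quotientE)
  then show ?thesis
    using assms(2) opposite_star_edge by blast
qed

lemma image_hyperplane_inv: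
  assumes g: "g \<in> carrier G" and h: "h \<in> hyperplanes X"
  shows "(`) (\<phi> (inv g)) ` (`) (\<phi> g) ` h = h"
proof -
  have "(`) (\<phi> (inv g)) ` (`) (\<phi> g) ` h = id ` h"
    unfolding image_image
  proof (rule image_cong[OF refl])
    fix e assume "e \<in> h"
    then have "e \<subseteq> W"
      using edge_subset hyperplane_subset[OF h] by blast
    then have "\<phi> (inv g) ` \<phi> g ` e = e"
      by (rule image_inv[OF g])
    then show "(\<lambda>x. \<phi> (inv g) (\<phi> g x)) ` e = id e"
      by (simp add: image_image)
  qed
  then show ?thesis
    by simp
qed

lemma image_joined:
  assumes g: "g \<in> carrier G" and h: "h \<in> hyperplanes X"
    and j: "joined W (cc_edges X - h) u v"
  shows "joined W (cc_edges X - (`) (\<phi> g) ` h) (\<phi> g u) (\<phi> g v)"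
  using j
proof (induction rule: joined_induct)
  case refl
  show ?case
    by (rule joined_refl[OF \<phi>_in[OF g joined_in(1)[OF j]]])
next
  case (step x y)
  have "\<phi> g ` {x, y} \<notin> (`) (\<phi> g) ` h"
  proof
    assume "\<phi> g ` {x, y} \<in> (`) (\<phi> g) ` h"
    then obtain e where e: "e \<in> h" "\<phi> g ` {x, y} = \<phi> g ` e"
      by blast
    then have "\<phi> (inv g) ` \<phi> g ` {x, y} = \<phi> (inv g) ` \<phi> g ` e"
      by simp
    then have "{x, y} = e"
      using image_inv[OF g, of "{x, y}"] image_inv[OF g edge_subset[OF hyperplane_subset[OF h e(1)]]] step(1,2)
      by simp
    then show False
      using step(3) e(1) by blast
  qed
  moreover have "\<phi> g ` {x, y} \<in> cc_edges X"
    by (rule image_edge[OF g]) (use step(3) in blast)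
  ultimately have "{\<phi> g x, \<phi> g y} \<in> cc_edges X - (`) (\<phi> g) ` h"
    by simp
  then show ?case
    by (rule joined_step[OF step(4) _ \<phi>_in[OF g step(2)]])
qed

lemma halfspace_subset: "A \<in> halfspaces X h \<Longrightarrow> A \<subseteq> W"
  unfolding halfspaces_def graph_components_def vertices by blast

lemma image_halfspace:
  assumes g: "g \<in> carrier G" and h: "h \<in> hyperplanes X" and A: "A \<in> halfspaces X h"
  shows "\<phi> g ` A \<in> halfspaces X ((`) (\<phi> g) ` h)"
proof -
  obtain u where u: "u \<in> W" "A = {v \<in> W. joined W (cc_edges X - h) u v}"
    using A unfolding halfspaces_def graph_components_def vertices by blast
  have "\<phi> g ` A = {v \<in> W. joined W (cc_edges X - (`) (\<phi> g) ` h) (\<phi> g u) v}"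
  proof (intro Set.set_eqI iffI)
    fix w assume "w \<in> \<phi> g ` A"
    then obtain v where "v \<in> W" "joined W (cc_edges X - h) u v" "w = \<phi> g v"
      using u(2) by blast
    then show "w \<in> {v \<in> W. joined W (cc_edges X - (`) (\<phi> g) ` h) (\<phi> g u) v}"
      using image_joined[OF g h] \<phi>_in[OF g] by simp
  next
    fix w assume "w \<in> {v \<in> W. joined W (cc_edges X - (`) (\<phi> g) ` h) (\<phi> g u) v}"
    then have w: "w \<in> W" "joined W (cc_edges X - (`) (\<phi> g) ` h) (\<phi> g u) w"
      by simp_all
    have "joined W (cc_edges X - h) u (\<phi> (inv g) w)"
      using image_joined[OF inv_closed[OF g] image_hyperplane[OF g h] w(2)]
        image_hyperplane_inv[OF g h] \<phi>_inv[OF g u(1)] by simp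
    then have "\<phi> (inv g) w \<in> A"
      using u(2) \<phi>_in[OF inv_closed[OF g] w(1)] by simp
    moreover have "w = \<phi> g (\<phi> (inv g) w)"
      using \<phi>_inv'[OF g w(1)] by simp
    ultimately show "w \<in> \<phi> g ` A"
      by blast
  qed
  then show ?thesis
    unfolding halfspaces_def graph_components_def vertices using \<phi>_in[OF g u(1)] by blast
qed

abbreviation \<alpha> where "\<alpha> \<equiv> roller_action G X \<phi>"

lemma \<alpha>_apply: "h \<in> hyperplanes X \<Longrightarrow> \<alpha> g \<omega> h = \<phi> g ` \<omega> ((`) (\<phi> (inv g)) ` h)"
  unfolding roller_action_def by (rule restrict_apply')

lemma \<alpha>_image:
  assumes g: "g \<in> carrier G" and h: "h \<in> hyperplanes X"
  shows "\<alpha> g \<omega> ((`) (\<phi> g) ` h) = \<phi> g ` \<omega> h"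
  unfolding \<alpha>_apply[OF image_hyperplane[OF g h]] image_hyperplane_inv[OF g h] ..

lemma \<alpha>_ultrafilter:
  assumes g: "g \<in> carrier G" and \<omega>: "\<omega> \<in> ultrafilters X"
  shows "\<alpha> g \<omega> \<in> ultrafilters X"
proof -
  have inv_h: "(`) (\<phi> (inv g)) ` h \<in> hyperplanes X" if "h \<in> hyperplanes X" for h
    by (rule image_hyperplane[OF inv_closed[OF g] that])
  have "\<alpha> g \<omega> h \<in> halfspaces X h" if h: "h \<in> hyperplanes X" for h
  proof -
    have "\<phi> g ` \<omega> ((`) (\<phi> (inv g)) ` h) \<in> halfspaces X ((`) (\<phi> g) ` (`) (\<phi> (inv g)) ` h)"
      by (rule image_halfspace[OF g inv_h[OF h] ultrafilterD(1)[OF \<omega> inv_h[OF h]]])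
    then show ?thesis
      using \<alpha>_apply[OF h] image_hyperplane_inv[OF inv_closed[OF g] h] g by simp
  qed
  then have "\<alpha> g \<omega> \<in> PiE (hyperplanes X) (halfspaces X)"
    unfolding PiE_iff roller_action_def by simp
  moreover have "\<alpha> g \<omega> h \<inter> \<alpha> g \<omega> k \<noteq> {}" if h: "h \<in> hyperplanes X" and k: "k \<in> hyperplanes X" for h k
  proof -
    obtain v where "v \<in> \<omega> ((`) (\<phi> (inv g)) ` h)" "v \<in> \<omega> ((`) (\<phi> (inv g)) ` k)"
      using ultrafilterD(2)[OF \<omega> inv_h[OF h] inv_h[OF k]] by auto
    then have "\<phi> g v \<in> \<alpha> g \<omega> h \<inter> \<alpha> g \<omega> k"
      unfolding \<alpha>_apply[OF h] \<alpha>_apply[OF k] by (intro IntI imageI)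
    then show ?thesis
      by auto
  qed
  ultimately show ?thesis
    unfolding ultrafilters_def by blast
qed

lemma ultrafilter_subset: "\<omega> \<in> ultrafilters X \<Longrightarrow> h \<in> hyperplanes X \<Longrightarrow> \<omega> h \<subseteq> W"
  by (rule halfspace_subset[OF ultrafilterD(1)])

lemma ultrafilter_ext:
  assumes "\<omega> \<in> ultrafilters X" "\<eta> \<in> ultrafilters X" "\<And>h. h \<in> hyperplanes X \<Longrightarrow> \<omega> h = \<eta> h"
  shows "\<omega> = \<eta>"
proof (rule PiE_ext)
  show "\<omega> \<in> PiE (hyperplanes X) (halfspaces X)" "\<eta> \<in> PiE (hyperplanes X) (halfspaces X)"
    using assms(1,2) unfolding ultrafilters_def by auto
qed (rule assms(3))

lemma \<alpha>_mult:
  assumes g: "g \<in> carrier G" and h: "h \<in> carrier G" and \<omega>: "\<omega> \<in> ultrafilters X"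
  shows "\<alpha> (g \<otimes> h) \<omega> = \<alpha> g (\<alpha> h \<omega>)"
proof (rule ultrafilter_ext)
  show "\<alpha> (g \<otimes> h) \<omega> \<in> ultrafilters X" "\<alpha> g (\<alpha> h \<omega>) \<in> ultrafilters X"
    using g h \<omega> by (simp_all add: \<alpha>_ultrafilter)
  fix k assume k: "k \<in> hyperplanes X"
  define l where "l = (`) (\<phi> (inv g)) ` k"
  have l: "l \<in> hyperplanes X"
    unfolding l_def by (rule image_hyperplane[OF inv_closed[OF g] k])
  define m where "m = (`) (\<phi> (inv h)) ` l"
  have m: "m \<in> hyperplanes X"
    unfolding m_def by (rule image_hyperplane[OF inv_closed[OF h] l])
  have "(`) (\<phi> (inv (g \<otimes> h))) ` k = m"
    unfolding m_def l_def image_image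
  proof (rule image_cong[OF refl])
    fix e assume "e \<in> k"
    then have e: "e \<subseteq> W"
      using edge_subset hyperplane_subset[OF k] by blast
    show "\<phi> (inv (g \<otimes> h)) ` e = (\<lambda>x. \<phi> (inv h) (\<phi> (inv g) x)) ` e"
      by (rule image_cong[OF refl]) (use e g h in \<open>auto simp: inv_mult_group \<phi>_mult\<close>)
  qed
  then have "\<alpha> (g \<otimes> h) \<omega> k = \<phi> (g \<otimes> h) ` \<omega> m"
    using \<alpha>_apply[OF k] by simp
  also have "\<dots> = \<phi> g ` \<phi> h ` \<omega> m"
    unfolding image_image
    by (rule image_cong[OF refl]) (use ultrafilter_subset[OF \<omega> m] g h in \<open>auto simp: \<phi>_mult\<close>)
  also have "\<dots> = \<alpha> g (\<alpha> h \<omega>) k"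
    unfolding \<alpha>_apply[OF k] l_def[symmetric] \<alpha>_apply[OF l] m_def ..
  finally show "\<alpha> (g \<otimes> h) \<omega> k = \<alpha> g (\<alpha> h \<omega>) k" .
qed

lemma \<alpha>_one:
  assumes \<omega>: "\<omega> \<in> ultrafilters X"
  shows "\<alpha> \<one> \<omega> = \<omega>"
proof (rule ultrafilter_ext[OF \<alpha>_ultrafilter[OF one_closed \<omega>] \<omega>])
  fix h assume h: "h \<in> hyperplanes X"
  have one: "\<phi> \<one> ` C = C" if "C \<subseteq> W" for C
  proof -
    have "\<phi> \<one> ` C = id ` C"
      by (rule image_cong[OF refl]) (use \<phi>_one that in auto)
    then show ?thesis
      by simp
  qed
  have "(`) (\<phi> \<one>) ` h = id ` h"
    by (rule image_cong[OF refl]) (use one edge_subset hyperplane_subset[OF h] in simp)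
  then show "\<alpha> \<one> \<omega> h = \<omega> h"
    unfolding \<alpha>_apply[OF h] using one[OF ultrafilter_subset[OF \<omega> h]] by simp
qed

lemma boundary_ultrafilter: "\<omega> \<in> roller_boundary X \<Longrightarrow> \<omega> \<in> ultrafilters X"
  unfolding roller_boundary_def by blast

lemma \<alpha>_boundary:
  assumes g: "g \<in> carrier G" and \<omega>: "\<omega> \<in> roller_boundary X"
  shows "\<alpha> g \<omega> \<in> roller_boundary X"
proof -
  have "\<not> (\<exists>v\<in>W. \<forall>h\<in>hyperplanes X. v \<in> \<alpha> g \<omega> h)"
  proof
    assume "\<exists>v\<in>W. \<forall>h\<in>hyperplanes X. v \<in> \<alpha> g \<omega> h"
    then obtain v where v: "v \<in> W" "\<And>h. h \<in> hyperplanes X \<Longrightarrow> v \<in> \<alpha> g \<omega> h"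
      by blast
    have "\<phi> (inv g) v \<in> \<omega> h" if h: "h \<in> hyperplanes X" for h
    proof -
      have "v \<in> \<phi> g ` \<omega> h"
        using v(2)[OF image_hyperplane[OF g h]] \<alpha>_image[OF g h] by simp
      then have "\<phi> (inv g) v \<in> \<phi> (inv g) ` \<phi> g ` \<omega> h"
        by (rule imageI)
      then show ?thesis
        using image_inv[OF g ultrafilter_subset[OF boundary_ultrafilter[OF \<omega>] h]] by simp
    qed
    then show False
      using \<omega> \<phi>_in[OF inv_closed[OF g] v(1)] unfolding roller_boundary_def vertices by blast
  qed
  then show ?thesis
    using \<alpha>_ultrafilter[OF g boundary_ultrafilter[OF \<omega>]] unfolding roller_boundary_def vertices by blast
qed

section \<open>The subgroup preserving the factors\<close>

definition splits :: "'g \<Rightarrow> bool" where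
  "splits g \<longleftrightarrow> (\<exists>F. \<forall>v\<in>W. \<forall>i<n. \<phi> g v i = F i (v i))"

definition H :: "'g set" where "H = {g \<in> carrier G. splits g}"

lemma splitsI:
  assumes "\<And>v w i. v \<in> W \<Longrightarrow> w \<in> W \<Longrightarrow> i < n \<Longrightarrow> v i = w i \<Longrightarrow> \<phi> g v i = \<phi> g w i"
  shows "splits g"
  unfolding splits_def
proof (intro exI ballI allI impI)
  fix v i assume v: "v \<in> W" and i: "i < n"
  have "(SOME w. w \<in> W \<and> w i = v i) \<in> W \<and> (SOME w. w \<in> W \<and> w i = v i) i = v i"
    by (rule someI[of _ v]) (use v in simp)
  then show "\<phi> g v i = (\<lambda>i a. \<phi> g (SOME w. w \<in> W \<and> w i = a) i) i (v i)"
    using assms[OF v _ i] by simp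
qed

lemma splits_agree:
  assumes "splits g" "v \<in> W" "w \<in> W" "i < n" "v i = w i"
  shows "\<phi> g v i = \<phi> g w i"
proof -
  obtain F where "\<And>v i. v \<in> W \<Longrightarrow> i < n \<Longrightarrow> \<phi> g v i = F i (v i)"
    using assms(1) unfolding splits_def by blast
  then show ?thesis
    using assms(2-5) by simp
qed

lemma H_carrier: "g \<in> H \<Longrightarrow> g \<in> carrier G"
  by (simp add: H_def)

lemma H_splits: "g \<in> H \<Longrightarrow> splits g"
  by (simp add: H_def)

text \<open>Replacing coordinate \<open>i\<close> of \<open>v'\<close> by that of \<open>w'\<close>
  does not change the image under \<open>g\<close>, because the images already agree there. By
  injectivity the two coordinates were equal.\<close>

lemma H_inv:
  assumes "g \<in> H"
  shows "inv g \<in> H"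
proof -
  have g: "g \<in> carrier G" and s: "splits g"
    using assms by (simp_all add: H_def)
  have "splits (inv g)"
  proof (rule splitsI)
    fix v w i assume v: "v \<in> W" and w: "w \<in> W" and i: "i < n" and eq: "v i = w i"
    define v' w' where "v' = \<phi> (inv g) v" and "w' = \<phi> (inv g) w"
    have v': "v' \<in> W" "\<phi> g v' = v" and w': "w' \<in> W" "\<phi> g w' = w"
      unfolding v'_def w'_def using g v w by (simp_all add: \<phi>_in \<phi>_inv')
    define u where "u = v'(i := w' i)"
    have u: "u \<in> W"
      unfolding u_def by (rule W_upd[OF v'(1) i W_in[OF w'(1) i]])
    have "\<phi> g u = \<phi> g v'"
    proof (rule W_eqI[OF \<phi>_in[OF g u] \<phi>_in[OF g v'(1)]])
      fix j assume j: "j < n"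
      show "\<phi> g u j = \<phi> g v' j"
      proof (cases "j = i")
        case True
        have "\<phi> g u i = \<phi> g w' i"
          by (rule splits_agree[OF s u w'(1) i]) (simp add: u_def)
        then show ?thesis
          using True v'(2) w'(2) eq by simp
      next
        case False
        then show ?thesis
          by (intro splits_agree[OF s u v'(1) j]) (simp add: u_def)
      qed
    qed
    then have "\<phi> (inv g) (\<phi> g u) = \<phi> (inv g) (\<phi> g v')"
      by simp
    then have "u = v'"
      using \<phi>_inv[OF g u] \<phi>_inv[OF g v'(1)] by simp
    then have "u i = v' i"
      by simp
    then show "\<phi> (inv g) v i = \<phi> (inv g) w i"
      unfolding u_def v'_def w'_def by simp
  qed
  then show ?thesis
    using g by (simp add: H_def)
qed

lemma H_mult:
  assumes g: "g \<in> H" and h: "h \<in> H"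
  shows "g \<otimes> h \<in> H"
proof -
  note c = H_carrier[OF g] H_carrier[OF h]
  have "splits (g \<otimes> h)"
  proof (rule splitsI)
    fix v w i assume v: "v \<in> W" and w: "w \<in> W" and i: "i < n" and eq: "v i = w i"
    have "\<phi> h v i = \<phi> h w i"
      by (rule splits_agree[OF H_splits[OF h] v w i eq])
    then have "\<phi> g (\<phi> h v) i = \<phi> g (\<phi> h w) i"
      by (rule splits_agree[OF H_splits[OF g] \<phi>_in[OF c(2) v] \<phi>_in[OF c(2) w] i])
    then show "\<phi> (g \<otimes> h) v i = \<phi> (g \<otimes> h) w i"
      using c v w by (simp add: \<phi>_mult)
  qed
  then show ?thesis
    using c by (simp add: H_def)
qed

lemma H_one: "\<one> \<in> H"
proof -
  have "splits \<one>"
    by (rule splitsI) (simp add: \<phi>_one)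
  then show ?thesis
    by (simp add: H_def)
qed

lemma H_subgroup: "subgroup H G"
  by (rule subgroupI) (use H_carrier H_inv H_mult H_one in auto)

subsection \<open>Directions of edges\<close>

definition direction :: "'g \<Rightarrow> (nat \<Rightarrow> 'a) \<Rightarrow> nat \<Rightarrow> 'a \<Rightarrow> nat \<Rightarrow> bool" where
  "direction g v i b k \<longleftrightarrow> k < n \<and> {\<phi> g v k, \<phi> g (v(i := b)) k} \<in> E k \<and>
    \<phi> g (v(i := b)) = (\<phi> g v)(k := \<phi> g (v(i := b)) k)"

lemma ex_direction:
  assumes g: "g \<in> carrier G" and v: "v \<in> W" "i < n" "{v i, b} \<in> E i"
  shows "\<exists>k. direction g v i b k"
proof -
  have "\<phi> g ` {v, v(i := b)} \<in> cc_edges X"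
    by (rule image_edge[OF g edge_in_X[OF v]])
  then have "{\<phi> g v, \<phi> g (v(i := b))} \<in> cc_edges X"
    by simp
  then show ?thesis
    by (rule adjacent_cases) (auto simp: direction_def)
qed

lemma direction_unique:
  assumes "direction g v i b k" "direction g v i b l"
  shows "k = l"
proof (rule ccontr)
  assume "k \<noteq> l"
  have "k < n" "{\<phi> g v k, \<phi> g (v(i := b)) k} \<in> E k"
    using assms(1) unfolding direction_def by blast+
  then have "\<phi> g v k \<noteq> \<phi> g (v(i := b)) k"
    by (rule factor_edge_in(3))
  moreover have "\<phi> g (v(i := b)) k = ((\<phi> g v)(l := \<phi> g (v(i := b)) l)) k"
    using assms(2) unfolding direction_def by (metis (no_types))
  ultimately show False
    using \<open>k \<noteq> l\<close> by simp
qed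

lemma \<phi>_inject: "g \<in> carrier G \<Longrightarrow> v \<in> W \<Longrightarrow> w \<in> W \<Longrightarrow> \<phi> g v = \<phi> g w \<longleftrightarrow> v = w"
  by (metis \<phi>_inv)

text \<open>Two edges at a vertex span a square iff they have different directions, and automorphisms
  preserve squares.\<close>

lemma direction_at_vertex:
  assumes g: "g \<in> carrier G" and v: "v \<in> W" "i < n" and b: "{v i, b} \<in> E i" and c: "{v i, c} \<in> E i"
    and k: "direction g v i b k" and l: "direction g v i c l"
  shows "k = l"
proof (rule ccontr)
  assume kl: "k \<noteq> l"
  define f where "f = \<phi> g v"
  define \<beta> \<gamma> where "\<beta> = \<phi> g (v(i := b)) k" and "\<gamma> = \<phi> g (v(i := c)) l"
  have f: "f \<in> W"
    unfolding f_def by (rule \<phi>_in[OF g v(1)])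
  have k': "k < n" "{f k, \<beta>} \<in> E k" "\<phi> g (v(i := b)) = f(k := \<beta>)"
    using k unfolding direction_def f_def \<beta>_def by blast+
  have l': "l < n" "{f l, \<gamma>} \<in> E l" "\<phi> g (v(i := c)) = f(l := \<gamma>)"
    using l unfolding direction_def f_def \<gamma>_def by blast+
  define C where "C = {f, f(k := \<beta>), f(l := \<gamma>), f(k := \<beta>, l := \<gamma>)}"
  have "C \<in> X"
    using square_in_X[OF f k'(1) l'(1) kl k'(2) l'(2)] unfolding C_def cc_squares_def by blast
  then have CX: "\<phi> (inv g) ` C \<in> X"
    by (rule image_X[OF inv_closed[OF g]])
  have vb: "v(i := b) \<in> W" and vc: "v(i := c) \<in> W"
    by (rule W_upd_edge[OF v b], rule W_upd_edge[OF v c])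
  have "v \<in> \<phi> (inv g) ` C" "v(i := b) \<in> \<phi> (inv g) ` C" "v(i := c) \<in> \<phi> (inv g) ` C"
    using \<phi>_inv[OF g v(1)] \<phi>_inv[OF g vb] \<phi>_inv[OF g vc] k'(3) l'(3)
    unfolding C_def f_def by (metis imageI insertI1 insertI2)+
  from cube_three_values[OF CX this v(2)] have "v i = b \<or> b = c \<or> v i = c"
    by simp
  then have "b = c"
    using factor_edge_in(3)[OF v(2) b] factor_edge_in(3)[OF v(2) c] by simp
  then show False
    using direction_unique k l kl by blast
qed

text \<open>The square spanned by the two edges has its fourth vertex \<open>z\<close>. Its image
  cannot have \<open>p = k\<close>, for a cube has at most two values in coordinate
  \<open>k\<close>. If \<open>q\<close> were not \<open>k\<close>, the step in direction
  \<open>r\<close> would have to undo the step in direction \<open>k\<close>, and \<open>z\<close>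
  would have the same image as \<open>v\<close>.\<close>

lemma direction_parallel:
  assumes g: "g \<in> carrier G" and v: "v \<in> W" and ij: "i < n" "j < n" "i \<noteq> j"
    and b: "{v i, b} \<in> E i" and c: "{v j, c} \<in> E j" and k: "direction g v i b k"
  shows "direction g (v(j := c)) i b k"
proof -
  define f where "f = \<phi> g v"
  have vb: "v(i := b) \<in> W" and vc: "v(j := c) \<in> W"
    by (rule W_upd_edge[OF v ij(1) b], rule W_upd_edge[OF v ij(2) c])
  have b': "{(v(j := c)) i, b} \<in> E i" and c': "{(v(i := b)) j, c} \<in> E j"
    using b c ij(3) by simp_all
  define z where "z = v(j := c, i := b)"
  have z: "z \<in> W"
    unfolding z_def by (rule W_upd_edge[OF vc ij(1) b'])
  have z': "z = v(i := b, j := c)"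
    unfolding z_def using ij(3) by (rule fun_upd_twist[OF not_sym])
  have ne: "v i \<noteq> b" "v j \<noteq> c"
    using factor_edge_in(3) ij b c by blast+
  have distinct: "v \<noteq> v(i := b)" "v \<noteq> v(j := c)" "v(i := b) \<noteq> v(j := c)" "z \<noteq> v"
    using ne ij(3) unfolding z_def by (auto simp: fun_eq_iff)
  obtain p where p: "direction g v j c p"
    using ex_direction[OF g v ij(2) c] by blast
  obtain q where q: "direction g (v(j := c)) i b q"
    using ex_direction[OF g vc ij(1) b'] by blast
  obtain r where r: "direction g (v(i := b)) j c r"
    using ex_direction[OF g vb ij(2) c'] by blast
  define \<beta> \<gamma> \<delta> \<epsilon> where "\<beta> = \<phi> g (v(i := b)) k" and "\<gamma> = \<phi> g (v(j := c)) p"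
    and "\<delta> = \<phi> g z q" and "\<epsilon> = \<phi> g z r"
  have k': "k < n" "\<phi> g (v(i := b)) = f(k := \<beta>)"
    using k unfolding direction_def f_def \<beta>_def by blast+
  have p': "p < n" "\<phi> g (v(j := c)) = f(p := \<gamma>)"
    using p unfolding direction_def f_def \<gamma>_def by blast+
  have q': "\<phi> g z = f(p := \<gamma>, q := \<delta>)"
    using q unfolding direction_def z_def[symmetric] \<delta>_def p'(2) by blast
  have r': "\<phi> g z = f(k := \<beta>, r := \<epsilon>)"
    using r unfolding direction_def z'[symmetric] \<epsilon>_def k'(2) by blast
  have \<beta>: "f k \<noteq> \<beta>" and \<gamma>: "f p \<noteq> \<gamma>"
    using k'(2) p'(2) distinct(1,2) \<phi>_inject[OF g v vb] \<phi>_inject[OF g v vc] unfolding f_def by auto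
  have "p \<noteq> k"
  proof
    assume pk: "p = k"
    define C where "C = \<phi> g ` {v, v(i := b), v(j := c), v(i := b, j := c)}"
    have C: "C \<in> X"
      unfolding C_def by (rule image_X[OF g]) (use square_in_X[OF v ij b c] in \<open>simp add: cc_squares_def\<close>)
    have "f \<in> C" "f(k := \<beta>) \<in> C" "f(k := \<gamma>) \<in> C"
      unfolding C_def f_def[symmetric] k'(2)[symmetric] p'(2)[symmetric, unfolded pk]
      by (simp_all add: f_def)
    from cube_three_values[OF C this k'(1)] have "\<beta> = \<gamma>"
      using \<beta> \<gamma> pk by simp
    then have "v(i := b) = v(j := c)"
      using k'(2) p'(2) pk \<phi>_inject[OF g vb vc] by simp
    then show False
      using distinct(3) by blast
  qed
  have "q = k"
  proof (rule ccontr)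
    assume "q \<noteq> k"
    then have zk: "\<phi> g z k = f k"
      using \<open>p \<noteq> k\<close> unfolding q' by simp
    have "r = k"
    proof (rule ccontr)
      assume "r \<noteq> k"
      then have "\<phi> g z k = \<beta>"
        unfolding r' by simp
      then show False
        using zk \<beta> by simp
    qed
    then have "\<phi> g z = f(k := f k)"
      using r' zk by simp
    then have "\<phi> g z = \<phi> g v"
      unfolding f_def by simp
    then show False
      using distinct(4) \<phi>_inject[OF g z v] by blast
  qed
  then show ?thesis
    using q by blast
qed

lemma direction_reverse:
  assumes "direction g v i b k"
  shows "direction g (v(i := b)) i (v i) k"
proof -
  have restore: "(v(i := b))(i := v i) = v"
    by auto
  define f f' where "f = \<phi> g v" and "f' = \<phi> g (v(i := b))"
  have k: "k < n" "{f k, f' k} \<in> E k" "f' = f(k := f' k)"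
    using assms unfolding direction_def f_def f'_def by blast+
  have "f = f'(k := f k)"
    by (subst k(3)) simp
  then show ?thesis
    unfolding direction_def restore f_def[symmetric] f'_def[symmetric] using k(1,2) by (simp add: insert_commute)
qed

text \<open>A walk through all vertices keeps the direction: a step in another factor by
  \<open>direction_parallel\<close>, a step in factor \<open>i\<close> by reversing the edge just
  crossed. The edges at one vertex agree by \<open>direction_at_vertex\<close>.\<close>

lemma directions_constant:
  assumes g: "g \<in> carrier G" and i: "i < n"
  shows "\<exists>k<n. \<forall>v\<in>W. \<forall>b. {v i, b} \<in> E i \<longrightarrow> direction g v i b k"
proof (cases "\<exists>v\<in>W. \<exists>b. {v i, b} \<in> E i")
  case False
  \<comment> \<open>Here the \<open>i\<close>-th tree is a single vertex, the condition is vacuous,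
    and \<open>i\<close> serves as the value.\<close>
  then show ?thesis
    using i by blast
next
  case True
  then obtain v b where v: "v \<in> W" and b: "{v i, b} \<in> E i"
    by blast
  obtain k where k: "direction g v i b k"
    using ex_direction[OF g v i b] by blast
  have at: "\<forall>c. {w i, c} \<in> E i \<longrightarrow> direction g w i c k"
    if w: "w \<in> W" and b: "{w i, b} \<in> E i" and k: "direction g w i b k" for w b
  proof (intro allI impI)
    fix c assume c: "{w i, c} \<in> E i"
    obtain l where l: "direction g w i c l"
      using ex_direction[OF g w i c] by blast
    have "k = l"
      by (rule direction_at_vertex[OF g w i b c k l])
    then show "direction g w i c k"
      using l by simp
  qed
  have "\<forall>b. {w i, b} \<in> E i \<longrightarrow> direction g w i b k" if w: "w \<in> W" for w
  proof (rule walk[where F = E, OF v w])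
    fix j assume "j < n"
    then show "joined (V j) (E j) (v j) (w j)"
      using tree.joined[OF tree_factor W_in[OF v] W_in[OF w]] by blast
  next
    show "\<forall>b. {v i, b} \<in> E i \<longrightarrow> direction g v i b k"
      by (rule at[OF v b k])
  next
    fix u j c assume u: "u \<in> W" and j: "j < n" "{u j, c} \<in> E j"
      and IH: "\<forall>b. {u i, b} \<in> E i \<longrightarrow> direction g u i b k"
    have uc: "u(j := c) \<in> W"
      by (rule W_upd_edge[OF u j])
    show "\<forall>b. {(u(j := c)) i, b} \<in> E i \<longrightarrow> direction g (u(j := c)) i b k"
    proof (cases "j = i")
      case True
      have "direction g u i c k"
        using IH j(2) True by blast
      then have "direction g (u(j := c)) i (u i) k"
        unfolding True by (rule direction_reverse)
      moreover have "{(u(j := c)) i, u i} \<in> E i"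
        using j(2) True by (simp add: insert_commute)
      ultimately show ?thesis
        using at[OF uc] by blast
    next
      case False
      then have ij: "i \<noteq> j"
        by simp
      show ?thesis
      proof (intro allI impI)
        fix b assume "{(u(j := c)) i, b} \<in> E i"
        then have b: "{u i, b} \<in> E i"
          using ij by simp
        then have "direction g u i b k"
          using IH by blast
        then show "direction g (u(j := c)) i b k"
          by (rule direction_parallel[OF g u i j(1) ij b j(2)])
      qed
    qed
  qed
  moreover have "k < n"
    using k unfolding direction_def by blast
  ultimately show ?thesis
    by blast
qed

text \<open>The map \<open>\<sigma> g\<close>, sending a factor to the direction of its edges, takes
  finitely many values. If \<open>\<sigma> g = \<sigma> r\<close>, then
  \<open>g \<otimes> inv r\<close> preserves the direction of every edge and therefore lies in
  \<open>H\<close>.\<close>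

lemma H_finite_index:
  "\<exists>R. finite R \<and> R \<subseteq> carrier G \<and> (\<forall>g\<in>carrier G. \<exists>h\<in>H. \<exists>r\<in>R. g = h \<otimes> r)"
proof -
  have "\<forall>g\<in>carrier G. \<exists>\<sigma>. \<sigma> \<in> PiE {..<n} (\<lambda>_. {..<n}) \<and>
      (\<forall>i<n. \<forall>v\<in>W. \<forall>b. {v i, b} \<in> E i \<longrightarrow> direction g v i b (\<sigma> i))"
  proof
    fix g assume g: "g \<in> carrier G"
    have "\<forall>i. \<exists>k. i < n \<longrightarrow> k < n \<and> (\<forall>v\<in>W. \<forall>b. {v i, b} \<in> E i \<longrightarrow> direction g v i b k)"
      using directions_constant[OF g] by blast
    from choice[OF this] obtain \<sigma> where \<sigma>: "\<And>i. i < n \<Longrightarrow> \<sigma> i < n"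
      "\<And>i v b. i < n \<Longrightarrow> v \<in> W \<Longrightarrow> {v i, b} \<in> E i \<Longrightarrow> direction g v i b (\<sigma> i)"
      by blast
    show "\<exists>\<sigma>. \<sigma> \<in> PiE {..<n} (\<lambda>_. {..<n}) \<and>
        (\<forall>i<n. \<forall>v\<in>W. \<forall>b. {v i, b} \<in> E i \<longrightarrow> direction g v i b (\<sigma> i))"
    proof (intro exI[of _ "restrict \<sigma> {..<n}"] conjI)
      show "restrict \<sigma> {..<n} \<in> PiE {..<n} (\<lambda>_. {..<n})"
        using \<sigma>(1) by simp
      show "\<forall>i<n. \<forall>v\<in>W. \<forall>b. {v i, b} \<in> E i \<longrightarrow> direction g v i b (restrict \<sigma> {..<n} i)"
        using \<sigma>(2) by simp
    qed
  qed
  from bchoice[OF this] obtain \<sigma> where \<sigma>_dir: "\<forall>g\<in>carrier G. \<sigma> g \<in> PiE {..<n} (\<lambda>_. {..<n}) \<and>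
      (\<forall>i<n. \<forall>v\<in>W. \<forall>b. {v i, b} \<in> E i \<longrightarrow> direction g v i b (\<sigma> g i))" ..
  have \<sigma>: "\<sigma> g \<in> PiE {..<n} (\<lambda>_. {..<n})" if "g \<in> carrier G" for g
    by (rule conjunct1[OF bspec[OF \<sigma>_dir that]])
  have dir: "direction g v i b (\<sigma> g i)"
    if "g \<in> carrier G" "i < n" "v \<in> W" "{v i, b} \<in> E i" for g i v b
    using conjunct2[OF bspec[OF \<sigma>_dir that(1)]] that(2-4) by simp
  define rep where "rep s = (SOME g. g \<in> carrier G \<and> \<sigma> g = s)" for s
  have rep: "rep (\<sigma> g) \<in> carrier G" "\<sigma> (rep (\<sigma> g)) = \<sigma> g" if "g \<in> carrier G" for g
    using someI[of "\<lambda>h. h \<in> carrier G \<and> \<sigma> h = \<sigma> g" g] that unfolding rep_def by blast+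
  have "g \<otimes> inv r \<in> H" if g: "g \<in> carrier G" and r: "r \<in> carrier G" and eq: "\<sigma> g = \<sigma> r" for g r
  proof -
    define k where "k = g \<otimes> inv r"
    have k: "k \<in> carrier G"
      using g r by (simp add: k_def)
    have "splits k"
    proof (rule splitsI)
      fix v w i assume v: "v \<in> W" and w: "w \<in> W" and i: "i < n" and vw: "v i = w i"
      have "\<phi> k w i = \<phi> k v i"
      proof (rule walk[where F = "\<lambda>j. if j = i then {} else E j", OF v w])
        fix j assume j: "j < n"
        show "joined (V j) (if j = i then {} else E j) (v j) (w j)"
          using tree.joined[OF tree_factor[OF j] W_in[OF v j] W_in[OF w j]] joined_refl[OF W_in[OF v i]] vw
          by simp
      next
        fix u j c assume u: "u \<in> W" and j: "j < n" "{u j, c} \<in> (if j = i then {} else E j)"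
          and IH: "\<phi> k u i = \<phi> k v i"
        have ji: "j \<noteq> i" and e: "{u j, c} \<in> E j"
          using j(2) by (auto split: if_splits)
        have uc: "u(j := c) \<in> W"
          by (rule W_upd_edge[OF u j(1) e])
        define x y where "x = \<phi> (inv r) u" and "y = \<phi> (inv r) (u(j := c))"
        have x: "x \<in> W" "\<phi> r x = u" and y: "y \<in> W" "\<phi> r y = u(j := c)"
          unfolding x_def y_def using r u uc by (simp_all add: \<phi>_in \<phi>_inv')
        have "\<phi> (inv r) ` {u, u(j := c)} \<in> cc_edges X"
          by (rule image_edge[OF inv_closed[OF r] edge_in_X[OF u j(1) e]])
        then have "{x, y} \<in> cc_edges X"
          unfolding x_def y_def by simp
        then obtain m where m: "m < n" "{x m, y m} \<in> E m" "y = x(m := y m)"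
          by (rule adjacent_cases)
        \<comment> \<open>Pulled back by \<open>r\<close>, the edge in factor \<open>j\<close> runs
          in a factor \<open>m\<close> with \<open>\<sigma> r m = j\<close>. As
          \<open>\<sigma> g = \<sigma> r\<close>, \<open>g\<close> sends it to factor
          \<open>j\<close> again and leaves coordinate \<open>i\<close> alone.\<close>
        have "direction r x m (y m) (\<sigma> r m)"
          by (rule dir[OF r m(1) x(1) m(2)])
        then have "\<phi> r y = (\<phi> r x)(\<sigma> r m := \<phi> r y (\<sigma> r m))"
          unfolding direction_def m(3)[symmetric] by blast
        then have "(u(j := c)) j = (u(\<sigma> r m := (u(j := c)) (\<sigma> r m))) j"
          unfolding x(2) y(2) by (rule fun_cong)
        then have \<sigma>j: "\<sigma> r m = j"
          using factor_edge_in(3)[OF j(1) e] by (cases "\<sigma> r m = j") auto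
        have "direction g x m (y m) (\<sigma> g m)"
          by (rule dir[OF g m(1) x(1) m(2)])
        then have "\<phi> g y = (\<phi> g x)(j := \<phi> g y j)"
          unfolding direction_def m(3)[symmetric] eq \<sigma>j by blast
        then have "\<phi> g y i = ((\<phi> g x)(j := \<phi> g y j)) i"
          by (rule fun_cong)
        then have "\<phi> g y i = \<phi> g x i"
          using ji by simp
        moreover have "\<phi> k u = \<phi> g x" "\<phi> k (u(j := c)) = \<phi> g y"
          unfolding k_def x_def y_def using g r u uc by (simp_all add: \<phi>_mult)
        ultimately show "\<phi> k (u(j := c)) i = \<phi> k v i"
          using IH by simp
      qed simp
      then show "\<phi> k v i = \<phi> k w i"
        by simp
    qed
    then show ?thesis
      using k unfolding k_def H_def by blast
  qed
  then have main: "\<exists>h\<in>H. \<exists>r\<in>rep ` \<sigma> ` carrier G. g = h \<otimes> r" if g: "g \<in> carrier G" for g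
  proof -
    have "g \<otimes> inv (rep (\<sigma> g)) \<in> H"
      using \<open>\<And>g r. g \<in> carrier G \<Longrightarrow> r \<in> carrier G \<Longrightarrow> \<sigma> g = \<sigma> r \<Longrightarrow> g \<otimes> inv r \<in> H\<close> g rep[OF g] by simp
    moreover have "g = g \<otimes> inv (rep (\<sigma> g)) \<otimes> rep (\<sigma> g)"
      using g rep(1)[OF g] by (simp add: m_assoc)
    ultimately show ?thesis
      using g by blast
  qed
  have "\<sigma> ` carrier G \<subseteq> PiE {..<n} (\<lambda>_. {..<n})"
    using \<sigma> by blast
  then have "finite (\<sigma> ` carrier G)"
    by (rule finite_subset) (intro finite_PiE; simp)
  then have "finite (rep ` \<sigma> ` carrier G)"
    by (rule finite_imageI)
  moreover have "rep ` \<sigma> ` carrier G \<subseteq> carrier G"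
    using rep(1) by blast
  ultimately show ?thesis
    by (intro exI[of _ "rep ` \<sigma> ` carrier G"] conjI ballI main)
qed

subsection \<open>Equivariance of the flow\<close>

lemma edge_upd_iff:
  assumes "{w, w(i := c)} \<in> cc_edges X"
  shows "{w i, c} \<in> E i"
proof -
  obtain j where j: "w \<in> W" "j < n" "{w j, (w(i := c)) j} \<in> E j"
    using assms by (rule adjacent_cases)
  have "w j \<noteq> (w(i := c)) j"
    by (rule factor_edge_in(3)[OF j(2,3)])
  then have "j = i"
    by (cases "j = i") auto
  then show ?thesis
    using j(3) by simp
qed

text \<open>The element \<open>g\<close> carries hyperplane and chosen halfspace to a hyperplane of
  the same factor and one of its two halfspaces. This image contains
  \<open>\<phi> g (v(i := b))\<close>, so it is the one beyond the image edge.\<close>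

lemma points_equivariant:
  assumes g: "g \<in> H" and \<omega>: "\<omega> \<in> ultrafilters X" and v: "v \<in> W" and i: "i < n"
    and p: "points \<omega> i (v i) b"
  shows "points (\<alpha> g \<omega>) i (\<phi> g v i) (\<phi> g (v(i := b)) i)"
proof -
  note gc = H_carrier[OF g]
  have e: "{v i, b} \<in> E i" and \<omega>h: "\<omega> (HP i (v i) b) = Hs i (v i) b"
    using p unfolding points_def by blast+
  have vb: "v(i := b) \<in> W"
    by (rule W_upd_edge[OF v i e])
  define f c where "f = \<phi> g v" and "c = \<phi> g (v(i := b)) i"
  have f: "f \<in> W" and fb: "\<phi> g (v(i := b)) \<in> W"
    unfolding f_def by (rule \<phi>_in[OF gc v], rule \<phi>_in[OF gc vb])
  have upd: "\<phi> g (v(i := b)) = f(i := c)"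
  proof (rule W_eqI[OF fb W_upd[OF f i W_in[OF fb i, folded c_def]]])
    fix j assume j: "j < n"
    show "\<phi> g (v(i := b)) j = (f(i := c)) j"
    proof (cases "j = i")
      case False
      then have "\<phi> g (v(i := b)) j = \<phi> g v j"
        by (intro splits_agree[OF H_splits[OF g] vb v j]) simp
      then show ?thesis
        using False by (simp add: f_def)
    qed (simp add: c_def)
  qed
  have "\<phi> g ` {v, v(i := b)} \<in> cc_edges X"
    by (rule image_edge[OF gc edge_in_X[OF v i e]])
  then have edge: "{f, f(i := c)} \<in> cc_edges X"
    using upd by (simp add: f_def)
  have e': "{f i, c} \<in> E i"
    by (rule edge_upd_iff[OF edge])
  have "(`) (\<phi> g) ` HP i (v i) b = (opposite_edges X)\<^sup>* `` {\<phi> g ` {v, v(i := b)}}"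
    unfolding opposite_class[OF v i e, symmetric] by (rule image_class[OF gc edge_in_X[OF v i e]])
  also have "\<phi> g ` {v, v(i := b)} = {f, f(i := c)}"
    using upd by (simp add: f_def)
  also have "(opposite_edges X)\<^sup>* `` {{f, f(i := c)}} = HP i (f i) c"
    by (rule opposite_class[OF f i e'])
  finally have HP: "(`) (\<phi> g) ` HP i (v i) b = HP i (f i) c" .
  have \<alpha>h: "\<alpha> g \<omega> (HP i (f i) c) = \<phi> g ` Hs i (v i) b"
    using \<alpha>_image[OF gc HP_in_hyperplanes[OF i e], of \<omega>] unfolding HP \<omega>h .
  have "\<alpha> g \<omega> (HP i (f i) c) \<in> {Hs i (f i) c, Hs i c (f i)}"
    using ultrafilterD(1)[OF \<alpha>_ultrafilter[OF gc \<omega>] HP_in_hyperplanes[OF i e']]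
    unfolding halfspaces_HP[OF i e'] .
  moreover have "f(i := c) \<in> \<alpha> g \<omega> (HP i (f i) c)"
  proof -
    have "v(i := b) \<in> Hs i (v i) b"
      by (rule in_Hs(1)[OF i e vb]) simp
    then show ?thesis
      unfolding \<alpha>h upd[symmetric] by (rule imageI)
  qed
  moreover have "f(i := c) \<notin> Hs i c (f i)"
    by (rule in_Hs(2)[OF i e' fb[unfolded upd]]) simp
  ultimately have "\<alpha> g \<omega> (HP i (f i) c) = Hs i (f i) c"
    by auto
  then show ?thesis
    unfolding points_def f_def[symmetric] c_def[symmetric] using e' by blast
qed

lemma flow_equivariant:
  assumes g: "g \<in> H" and \<omega>: "\<omega> \<in> ultrafilters X" and v: "v \<in> W" and i: "i < n"
  shows "flow (\<alpha> g \<omega>) i (\<phi> g v i) = \<phi> g (v(i := flow \<omega> i (v i))) i"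
proof (cases "flow \<omega> i (v i) = v i")
  case False
  show ?thesis
    by (rule flow_eqI[OF \<alpha>_ultrafilter[OF H_carrier[OF g] \<omega>] i
          points_equivariant[OF g \<omega> v i flow_points[OF False]]])
next
  case True
  \<comment> \<open>At a sink, an edge leaving the image vertex would be carried back by
    \<open>inv g\<close> to an edge leaving \<open>v i\<close>.\<close>
  note gc = H_carrier[OF g]
  have "flow (\<alpha> g \<omega>) i (\<phi> g v i) = \<phi> g v i"
  proof (rule ccontr)
    assume ne: "flow (\<alpha> g \<omega>) i (\<phi> g v i) \<noteq> \<phi> g v i"
    have "points (\<alpha> (inv g) (\<alpha> g \<omega>)) i (\<phi> (inv g) (\<phi> g v) i)
        (\<phi> (inv g) ((\<phi> g v)(i := flow (\<alpha> g \<omega>) i (\<phi> g v i))) i)"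
      by (rule points_equivariant[OF H_inv[OF g] \<alpha>_ultrafilter[OF gc \<omega>] \<phi>_in[OF gc v] i flow_points[OF ne]])
    moreover have "\<alpha> (inv g) (\<alpha> g \<omega>) = \<omega>"
      using gc \<omega> by (simp add: \<alpha>_one flip: \<alpha>_mult)
    ultimately have p: "points \<omega> i (v i) (\<phi> (inv g) ((\<phi> g v)(i := flow (\<alpha> g \<omega>) i (\<phi> g v i))) i)"
      using \<phi>_inv[OF gc v] by simp
    then have "{v i, \<phi> (inv g) ((\<phi> g v)(i := flow (\<alpha> g \<omega>) i (\<phi> g v i))) i} \<in> E i"
      unfolding points_def by blast
    then show False
      using flow_eqI[OF \<omega> i p] True factor_edge_in(3)[OF i] by metis
  qed
  moreover have "v(i := flow \<omega> i (v i)) = v"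
    unfolding True by (rule fun_upd_triv)
  ultimately show ?thesis
    by simp
qed

text \<open>As \<open>g\<close> splits, coordinate \<open>i\<close> of the image can be computed at
  the vertex that differs from \<open>v\<close> in coordinate \<open>i\<close> only, where
  \<open>flow_equivariant\<close> can be iterated.\<close>

lemma shift_equivariant:
  assumes g: "g \<in> H" and \<omega>: "\<omega> \<in> ultrafilters X" and v: "v \<in> W"
  shows "shift e (\<alpha> g \<omega>) (\<phi> g v) = \<phi> g (shift e \<omega> v)"
proof (rule W_eqI)
  note gc = H_carrier[OF g]
  show "shift e (\<alpha> g \<omega>) (\<phi> g v) \<in> W" "\<phi> g (shift e \<omega> v) \<in> W"
    using shift_in_W[OF \<alpha>_ultrafilter[OF gc \<omega>] \<phi>_in[OF gc v]] \<phi>_in[OF gc shift_in_W[OF \<omega> v]] .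
  fix i assume i: "i < n"
  have pow_in: "v(i := (flow \<omega> i ^^ k) (v i)) \<in> W" for k
    by (rule W_upd[OF v i funpow_flow_in[OF \<omega> i W_in[OF v i]]])
  have "(flow (\<alpha> g \<omega>) i ^^ k) (\<phi> g v i) = \<phi> g (v(i := (flow \<omega> i ^^ k) (v i))) i" for k
  proof (induction k)
    case 0
    show ?case
      by (simp only: funpow_0 fun_upd_triv)
  next
    case (Suc k)
    define u where "u = v(i := (flow \<omega> i ^^ k) (v i))"
    have "(flow (\<alpha> g \<omega>) i ^^ Suc k) (\<phi> g v i) = flow (\<alpha> g \<omega>) i (\<phi> g u i)"
      unfolding u_def by (simp only: funpow.simps o_apply Suc.IH)
    also have "\<dots> = \<phi> g (u(i := flow \<omega> i (u i))) i"
      by (rule flow_equivariant[OF g \<omega> pow_in[of k, folded u_def] i])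
    also have "u(i := flow \<omega> i (u i)) = v(i := (flow \<omega> i ^^ Suc k) (v i))"
      unfolding u_def by simp
    finally show ?case .
  qed
  then have "shift e (\<alpha> g \<omega>) (\<phi> g v) i = \<phi> g (v(i := (flow \<omega> i ^^ e i) (v i))) i"
    using shift_apply[OF i] by metis
  also have "\<dots> = \<phi> g (shift e \<omega> v) i"
    by (rule splits_agree[OF H_splits[OF g] pow_in shift_in_W[OF \<omega> v] i]) (simp add: shift_apply[OF i])
  finally show "shift e (\<alpha> g \<omega>) (\<phi> g v) i = \<phi> g (shift e \<omega> v) i" .
qed

end

section \<open>Bounded neighbourhoods\<close>

lemma relpow_image_bound:
  assumes "\<And>x. x \<in> A \<Longrightarrow> R `` {x} \<subseteq> A \<and> finite (R `` {x}) \<and> card (R `` {x}) \<le> D" and x: "x \<in> A"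
  shows "(R ^^ k) `` {x} \<subseteq> A \<and> finite ((R ^^ k) `` {x}) \<and> card ((R ^^ k) `` {x}) \<le> D ^ k"
proof (induction k)
  case 0
  show ?case
    using x by simp
next
  case (Suc k)
  have eq: "(R ^^ Suc k) `` {x} = (\<Union>y\<in>(R ^^ k) `` {x}. R `` {y})"
    by auto
  have "card (\<Union>y\<in>(R ^^ k) `` {x}. R `` {y}) \<le> (\<Sum>y\<in>(R ^^ k) `` {x}. card (R `` {y}))"
    using Suc by (intro card_UN_le) blast
  also have "\<dots> \<le> (\<Sum>y\<in>(R ^^ k) `` {x}. D)"
    using assms(1) Suc by (intro sum_mono) blast
  also have "\<dots> = card ((R ^^ k) `` {x}) * D"
    by simp
  also have "\<dots> \<le> D ^ k * D"
    using Suc by (intro mult_right_mono) auto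
  finally have "card (\<Union>y\<in>(R ^^ k) `` {x}. R `` {y}) \<le> D ^ Suc k"
    by (simp add: mult.commute)
  moreover have "(\<Union>y\<in>(R ^^ k) `` {x}. R `` {y}) \<subseteq> A" "finite (\<Union>y\<in>(R ^^ k) `` {x}. R `` {y})"
    using assms(1) Suc by blast+
  ultimately show ?case
    unfolding eq by blast
qed

lemma relpow_reflexive_mono:
  assumes "\<And>y. y \<in> Range R \<Longrightarrow> (y, y) \<in> R" "(x, x) \<in> R" "(x, y) \<in> R ^^ k" "k \<le> l"
  shows "(x, y) \<in> R ^^ l"
  using assms(4)
proof (induction l rule: dec_induct)
  case (step l)
  have "(y, y) \<in> R"
  proof (cases l)
    case 0
    then show ?thesis
      using step assms(2) by simp
  next
    case (Suc j)
    then show ?thesis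
      using step(3) assms(1) by auto
  qed
  then show ?case
    using step(3) by auto
qed (rule assms(3))

lemma relpow_sym:
  assumes "sym R"
  shows "(x, y) \<in> R ^^ k \<Longrightarrow> (y, x) \<in> R ^^ k"
proof (induction k arbitrary: y)
  case (Suc k)
  then obtain z where z: "(x, z) \<in> R ^^ k" "(z, y) \<in> R"
    by auto
  have "(y, z) \<in> R"
    by (rule symD[OF assms z(2)])
  then show ?case
    by (rule relpow_Suc_I2) (rule Suc.IH[OF z(1)])
qed simp

lemma neighbours_bound:
  assumes "simple_graph V E" "uniformly_locally_finite V E"
  shows "\<exists>D. \<forall>a\<in>V. finite {b. {a, b} \<in> E} \<and> card {b. {a, b} \<in> E} \<le> D"
proof -
  obtain D where D: "\<And>v. v \<in> V \<Longrightarrow> finite {e \<in> E. v \<in> e} \<and> card {e \<in> E. v \<in> e} \<le> D"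
    using assms(2) unfolding uniformly_locally_finite_def by blast
  have "finite {b. {a, b} \<in> E} \<and> card {b. {a, b} \<in> E} \<le> D" if a: "a \<in> V" for a
  proof -
    have inj: "inj_on (\<lambda>b. {a, b}) {b. {a, b} \<in> E}"
      by (rule inj_onI) (auto simp: doubleton_eq_iff)
    have sub: "(\<lambda>b. {a, b}) ` {b. {a, b} \<in> E} \<subseteq> {e \<in> E. a \<in> e}"
      by auto
    have "finite {b. {a, b} \<in> E}"
      by (rule inj_on_finite[OF inj sub conjunct1[OF D[OF a]]])
    moreover have "card {b. {a, b} \<in> E} \<le> card {e \<in> E. a \<in> e}"
      by (rule card_inj_on_le[OF inj sub conjunct1[OF D[OF a]]])
    ultimately show ?thesis
      using D[OF a] by simp
  qed
  then show ?thesis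
    by blast
qed

lemma (in tree) countable_vertices:
  assumes "uniformly_locally_finite V E"
  shows "countable V"
proof (cases "V = {}")
  case False
  then obtain z where z: "z \<in> V"
    by blast
  obtain D where D: "\<And>a. a \<in> V \<Longrightarrow> finite {b. {a, b} \<in> E} \<and> card {b. {a, b} \<in> E} \<le> D"
    using neighbours_bound[OF simple assms] by blast
  define R where "R = {(a, b). {a, b} \<in> E}"
  have "R `` {a} \<subseteq> V \<and> finite (R `` {a}) \<and> card (R `` {a}) \<le> D" if "a \<in> V" for a
    using D[OF that] edge_in(2) unfolding R_def by auto
  then have "finite ((R ^^ k) `` {z})" for k
    using relpow_image_bound[of V R D z k] z by blast
  then have "countable (\<Union>k. (R ^^ k) `` {z})"
    by (intro countable_UN[OF countableI_type] countable_finite)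
  moreover have "V \<subseteq> (\<Union>k. (R ^^ k) `` {z})"
  proof
    fix x assume "x \<in> V"
    with z have "joined V E z x"
      by (rule joined)
    then show "x \<in> (\<Union>k. (R ^^ k) `` {z})"
    proof (induction rule: joined_induct)
      case refl
      have "(z, z) \<in> R ^^ 0"
        by simp
      then show ?case
        by blast
    next
      case (step u v)
      then obtain k where "(z, u) \<in> R ^^ k"
        by blast
      moreover have "(u, v) \<in> R"
        using step(3) by (simp add: R_def)
      ultimately have "(z, v) \<in> R ^^ Suc k"
        by auto
      then show ?case
        by blast
    qed
  qed
  ultimately show ?thesis
    by (rule countable_subset[rotated])
qed simp

context tree_product begin

definition adj :: "((nat \<Rightarrow> 'a) \<times> (nat \<Rightarrow> 'a)) set" where
  "adj = {(u, w). u \<in> W \<and> w \<in> W \<and> (u = w \<or> {u, w} \<in> cc_edges X)}"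

text \<open>Since \<open>adj\<close> is reflexive, its powers are balls. Two shifts of a vertex by
  vectors in \<open>vbox n t\<close> are each within \<open>n * t\<close> of it, which explains the
  radius.\<close>

definition nb :: "nat \<Rightarrow> (nat \<Rightarrow> 'a) \<Rightarrow> (nat \<Rightarrow> 'a) set" where
  "nb t w = (adj ^^ (n * t + n * t)) `` {w}"

lemma adj_refl: "w \<in> W \<Longrightarrow> (w, w) \<in> adj"
  by (simp add: adj_def)

lemma adj_sym: "sym adj"
  unfolding adj_def sym_def by (auto simp: insert_commute)

lemma adj_mono:
  assumes "(u, w) \<in> adj ^^ k" "k \<le> l" "u \<in> W"
  shows "(u, w) \<in> adj ^^ l"
  by (rule relpow_reflexive_mono[OF _ adj_refl[OF assms(3)] assms(1,2)]) (auto simp: adj_def)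

lemma adj_shift_coordinate:
  assumes \<omega>: "\<omega> \<in> ultrafilters X" and v: "v \<in> W" and i: "i < n"
  shows "(v, v(i := (flow \<omega> i ^^ k) (v i))) \<in> adj ^^ k"
proof (induction k)
  case 0
  show ?case
    by simp
next
  case (Suc k)
  define u where "u = v(i := (flow \<omega> i ^^ k) (v i))"
  have u: "u \<in> W"
    unfolding u_def by (rule W_upd[OF v i funpow_flow_in[OF \<omega> i W_in[OF v i]]])
  have "(u, u(i := flow \<omega> i (u i))) \<in> adj"
  proof (cases "flow \<omega> i (u i) = u i")
    case True
    then have "u(i := flow \<omega> i (u i)) = u"
      by (simp only: fun_upd_triv)
    then show ?thesis
      using adj_refl[OF u] by (simp only:)
  next
    case False
    have e: "{u i, flow \<omega> i (u i)} \<in> E i"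
      by (rule tree_flow.flow_edge[OF tree_flow_flow[OF \<omega> i] W_in[OF u i] False])
    show ?thesis
      unfolding adj_def using u W_upd_edge[OF u i e] edge_in_X[OF u i e] by blast
  qed
  moreover have "u(i := flow \<omega> i (u i)) = v(i := (flow \<omega> i ^^ Suc k) (v i))"
    unfolding u_def by simp
  ultimately have "(u, v(i := (flow \<omega> i ^^ Suc k) (v i))) \<in> adj"
    by (simp only:)
  with Suc.IH[folded u_def] show ?case
    unfolding relpow.simps(2) by (rule relcompI)
qed

lemma adj_shift:
  assumes \<omega>: "\<omega> \<in> ultrafilters X" and v: "v \<in> W" and e: "e \<in> vbox n t"
  shows "(v, shift e \<omega> v) \<in> adj ^^ (n * t)"
proof -
  define mix where "mix m = (\<lambda>i. if i < m then shift e \<omega> v i else v i)" for m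
  have mix: "mix m \<in> W" for m
    using shift_in_W[OF \<omega> v, of e] v unfolding mix_def W_def by (auto simp: PiE_iff extensional_def)
  have "m \<le> n \<Longrightarrow> (v, mix m) \<in> adj ^^ (m * t)" for m
  proof (induction m)
    case 0
    have "mix 0 = v"
      by (simp add: mix_def)
    then show ?case
      by simp
  next
    case (Suc m)
    then have m: "m < n" "(v, mix m) \<in> adj ^^ (m * t)"
      by simp_all
    have "e m \<le> t"
      using e m(1) unfolding vbox_def by (auto dest: spec[of _ m])
    then have "(mix m, (mix m)(m := (flow \<omega> m ^^ e m) (mix m m))) \<in> adj ^^ t"
      by (rule adj_mono[OF adj_shift_coordinate[OF \<omega> mix m(1)] _ mix])
    moreover have "(mix m)(m := (flow \<omega> m ^^ e m) (mix m m)) = mix (Suc m)"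
      using m(1) by (auto simp: mix_def fun_eq_iff shift_apply less_Suc_eq)
    ultimately have "(v, mix (Suc m)) \<in> adj ^^ (m * t + t)"
      using m(2) by (auto simp: relpow_add)
    then show ?case
      by (simp add: add.commute)
  qed
  from this[of n] have "(v, mix n) \<in> adj ^^ (n * t)"
    by simp
  moreover have "mix n = shift e \<omega> v"
    by (rule W_eqI[OF mix shift_in_W[OF \<omega> v]]) (simp add: mix_def)
  ultimately show ?thesis
    by simp
qed

lemma shift_in_nb:
  assumes \<omega>: "\<omega> \<in> ultrafilters X" and v: "v \<in> W" and e: "e \<in> vbox n t" and f: "f \<in> vbox n t"
  shows "shift f \<omega> v \<in> nb t (shift e \<omega> v)"
proof -
  have "(shift e \<omega> v, v) \<in> adj ^^ (n * t)"
    by (rule relpow_sym[OF adj_sym adj_shift[OF \<omega> v e]])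
  then have "(shift e \<omega> v, shift f \<omega> v) \<in> adj ^^ (n * t + n * t)"
    unfolding relpow_add using adj_shift[OF \<omega> v f] by (rule relcompI)
  then show ?thesis
    unfolding nb_def by simp
qed

lemma nb_bound:
  assumes ulf: "\<And>i. i < n \<Longrightarrow> uniformly_locally_finite (V i) (E i)"
  shows "\<exists>deg. \<forall>t. \<forall>w\<in>W. nb t w \<subseteq> W \<and> finite (nb t w) \<and> card (nb t w) \<le> deg t"
proof -
  have "\<forall>i. \<exists>D. i < n \<longrightarrow> (\<forall>a\<in>V i. finite {b. {a, b} \<in> E i} \<and> card {b. {a, b} \<in> E i} \<le> D)"
    using neighbours_bound[OF tree.simple[OF tree_factor] ulf] by blast
  from choice[OF this] obtain D where D: "\<And>i a. i < n \<Longrightarrow> a \<in> V i \<Longrightarrow> finite {b. {a, b} \<in> E i}"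
    "\<And>i a. i < n \<Longrightarrow> a \<in> V i \<Longrightarrow> card {b. {a, b} \<in> E i} \<le> D i"
    by blast
  define B where "B = Suc (\<Sum>i<n. D i)"
  have "adj `` {w} \<subseteq> W \<and> finite (adj `` {w}) \<and> card (adj `` {w}) \<le> B" if w: "w \<in> W" for w
  proof -
    define N where "N = (\<Union>i<n. (\<lambda>b. w(i := b)) ` {b. {w i, b} \<in> E i})"
    have "adj `` {w} \<subseteq> insert w N"
    proof
      fix u assume "u \<in> adj `` {w}"
      then consider "u = w" | "{w, u} \<in> cc_edges X"
        unfolding adj_def by blast
      then show "u \<in> insert w N"
      proof cases
        case 2
        then obtain i where i: "i < n" "{w i, u i} \<in> E i" "u = w(i := u i)"
          by (rule adjacent_cases)
        have "w(i := u i) \<in> N"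
          unfolding N_def using i(1,2) by blast
        then show ?thesis
          using i(3) by simp
      qed simp
    qed
    moreover have fin: "finite (insert w N)"
      unfolding N_def using D(1)[OF _ W_in[OF w]] by blast
    moreover have "card (insert w N) \<le> B"
    proof -
      have "card N \<le> (\<Sum>i<n. card ((\<lambda>b. w(i := b)) ` {b. {w i, b} \<in> E i}))"
        unfolding N_def by (rule card_UN_le) simp
      also have "\<dots> \<le> (\<Sum>i<n. D i)"
      proof (rule sum_mono)
        fix i assume "i \<in> {..<n}"
        then have i: "i < n"
          by simp
        show "card ((\<lambda>b. w(i := b)) ` {b. {w i, b} \<in> E i}) \<le> D i"
          using card_image_le[OF D(1)[OF i W_in[OF w i]], of "\<lambda>b. w(i := b)"] D(2)[OF i W_in[OF w i]]
          by (rule order_trans)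
      qed
      finally show ?thesis
        using card_insert_le_m1[of "B" N w] unfolding B_def by simp
    qed
    ultimately have "finite (adj `` {w})" "card (adj `` {w}) \<le> B"
      using finite_subset card_mono order_trans by metis+
    moreover have "adj `` {w} \<subseteq> W"
      unfolding adj_def by blast
    ultimately show ?thesis
      by blast
  qed
  then have "nb t w \<subseteq> W \<and> finite (nb t w) \<and> card (nb t w) \<le> B ^ (n * t + n * t)" if "w \<in> W" for t w
    unfolding nb_def using that by (rule relpow_image_bound)
  then show ?thesis
    by (intro exI[of _ "\<lambda>t. B ^ (n * t + n * t)"]) blast
qed

lemma countable_W:
  assumes "\<And>i. i < n \<Longrightarrow> uniformly_locally_finite (V i) (E i)"
  shows "countable W"
  unfolding W_def
proof (rule countable_PiE)
  fix i assume "i \<in> {..<n}"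
  then have i: "i < n"
    by simp
  show "countable (V i)"
    by (rule tree.countable_vertices[OF tree_factor[OF i] assms[OF i]])
qed simp

subsection \<open>Geodesic rays\<close>

text \<open>A potential of the flow in one factor is 1-Lipschitz on the 1-skeleton of the product, and it
  grows with slope 1 along the orbit of the flow.\<close>

lemma coordinate_ray_geodesic:
  assumes \<omega>: "\<omega> \<in> ultrafilters X" and v: "v \<in> W" and i: "i < n"
    and nofix: "\<And>k. flow \<omega> i ((flow \<omega> i ^^ k) (v i)) \<noteq> (flow \<omega> i ^^ k) (v i)"
  shows "geodesic_ray W (cc_edges X) (\<lambda>k. v(i := (flow \<omega> i ^^ k) (v i)))"
proof -
  interpret tree_flow "V i" "E i" "flow \<omega> i"
    by (rule tree_flow_flow[OF \<omega> i])
  define \<gamma> where "\<gamma> k = v(i := (flow \<omega> i ^^ k) (v i))" for k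
  have \<gamma>: "\<gamma> k \<in> W" for k
    unfolding \<gamma>_def by (rule W_upd[OF v i tree_flow.funpow_flow_in[OF tree_flow_axioms W_in[OF v i]]])
  have free: "flow \<omega> i y \<noteq> y" if "y \<in> V i" for y
    by (rule no_fixed_point[OF W_in[OF v i] nofix that])
  from ex_potential[OF free] obtain \<beta> :: "'a \<Rightarrow> int" where \<beta>: "\<And>y. y \<in> V i \<Longrightarrow> \<beta> (flow \<omega> i y) = \<beta> y + 1"
    by blast
  have \<gamma>i: "\<gamma> (Suc k) i = flow \<omega> i (\<gamma> k i)" for k
    by (simp add: \<gamma>_def)
  have \<beta>\<gamma>: "\<beta> (\<gamma> k i) = \<beta> (v i) + int k" for k
  proof (induction k)
    case 0
    show ?case
      by (simp add: \<gamma>_def)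
  next
    case (Suc k)
    then show ?case
      using \<beta>[OF W_in[OF \<gamma> i]] \<gamma>i by simp
  qed
  have edge: "{\<gamma> k, \<gamma> (Suc k)} \<in> cc_edges X" for k
  proof -
    have "\<gamma> (Suc k) = (\<gamma> k)(i := flow \<omega> i (\<gamma> k i))"
      unfolding \<gamma>_def by simp
    then show ?thesis
      using edge_in_X[OF \<gamma> i flow_edge[OF W_in[OF \<gamma> i] free[OF W_in[OF \<gamma> i]]]] by simp
  qed
  have lip: "\<beta> (w i) \<le> \<beta> (u i) + 1" if uw: "{u, w} \<in> cc_edges X" for u w
  proof -
    obtain j where j: "u \<in> W" "j < n" "{u j, w j} \<in> E j" "w = u(j := w j)" "w \<in> W"
      using uw by (rule adjacent_cases)
    show ?thesis
    proof (cases "j = i")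
      case True
      then have "flow \<omega> i (u i) = w i \<or> flow \<omega> i (w i) = u i"
        using flow_orients j(3) by blast
      then show ?thesis
        using \<beta>[OF W_in[OF j(1) i]] \<beta>[OF W_in[OF j(5) i]] by auto
    next
      case False
      then have "w i = u i"
        by (subst j(4)) simp
      then show ?thesis
        by simp
    qed
  qed
  \<comment> \<open>\<open>length q\<close> counts vertices, hence the \<open>- 1\<close>.\<close>
  have path: "vertex_path W (cc_edges X) q \<Longrightarrow> \<beta> (last q i) \<le> \<beta> (hd q i) + int (length q) - 1" for q
  proof (induction q)
    case (Cons u q)
    show ?case
    proof (cases "q = []")
      case False
      then have "{u, hd q} \<in> cc_edges X" "vertex_path W (cc_edges X) q"
        using Cons.prems by (auto simp: vertex_path_def successively_Cons)
      then show ?thesis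
        using Cons.IH lip[of u "hd q"] False by simp
    qed simp
  qed (simp add: vertex_path_def)
  have "geodesic_path W (cc_edges X) (map \<gamma> [k..<Suc l])" if kl: "k \<le> l" for k l
    unfolding geodesic_path_def
  proof (intro conjI allI impI)
    have "{map \<gamma> [k..<Suc l] ! j, map \<gamma> [k..<Suc l] ! Suc j} \<in> cc_edges X"
      if "Suc j < length (map \<gamma> [k..<Suc l])" for j
      using that edge[of "k + j"] by (simp add: nth_upt del: upt_Suc)
    then have "successively (\<lambda>x y. {x, y} \<in> cc_edges X) (map \<gamma> [k..<Suc l])"
      unfolding successively_conv_nth by blast
    moreover have "set (map \<gamma> [k..<Suc l]) \<subseteq> W" "map \<gamma> [k..<Suc l] \<noteq> []"
      using \<gamma> kl by auto
    ultimately show "vertex_path W (cc_edges X) (map \<gamma> [k..<Suc l])"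
      unfolding vertex_path_def by blast
    have ends: "hd (map \<gamma> [k..<Suc l]) = \<gamma> k" "last (map \<gamma> [k..<Suc l]) = \<gamma> l"
      using kl by (simp_all add: hd_map last_map del: upt_Suc)
    fix q assume q: "vertex_path W (cc_edges X) q \<and> hd q = hd (map \<gamma> [k..<Suc l]) \<and>
      last q = last (map \<gamma> [k..<Suc l])"
    then have "\<beta> (\<gamma> l i) \<le> \<beta> (\<gamma> k i) + int (length q) - 1"
      using path[of q] unfolding ends by simp
    then have "Suc l - k \<le> length q"
      unfolding \<beta>\<gamma> by linarith
    then show "length (map \<gamma> [k..<Suc l]) \<le> length q"
      by (simp only: length_map length_upt)
  qed
  then show ?thesis
    unfolding geodesic_ray_def \<gamma>_def by blast
qed

end

context product_action begin

lemma nb_equivariant: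
  assumes g: "g \<in> carrier G" and v: "v \<in> nb t w"
  shows "\<phi> g v \<in> nb t (\<phi> g w)"
proof -
  have step: "(\<phi> g u, \<phi> g w) \<in> adj" if uw: "(u, w) \<in> adj" for u w
  proof (cases "u = w")
    case True
    then show ?thesis
      using uw \<phi>_in[OF g] unfolding adj_def by simp
  next
    case False
    then have e: "{u, w} \<in> cc_edges X" "u \<in> W" "w \<in> W"
      using uw unfolding adj_def by blast+
    then show ?thesis
      using image_edge[OF g e(1)] \<phi>_in[OF g] unfolding adj_def by simp
  qed
  have "(w, u) \<in> adj ^^ k \<Longrightarrow> (\<phi> g w, \<phi> g u) \<in> adj ^^ k" for k u
  proof (induction k arbitrary: u)
    case (Suc k)
    then obtain z where "(w, z) \<in> adj ^^ k" "(z, u) \<in> adj"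
      by auto
    then show ?case
      using Suc.IH step by auto
  qed simp
  then show ?thesis
    using v unfolding nb_def by simp
qed

text \<open>The hypothesis is applied to the \<open>n\<close> rays from \<open>v\<close> along the
  flow of one factor each. An element of \<open>H\<close> that fixes all these rays fixes every
  shift of \<open>v\<close>, coordinate by coordinate, and hence \<open>\<omega>\<close> by
  \<open>shift_determines\<close>.\<close>

lemma stabilizing:
  assumes rays: "\<And>\<gamma>. geodesic_ray W (cc_edges X) \<gamma> \<Longrightarrow>
      \<exists>p. initial_segment p \<gamma> \<and> pointwise_stabilizer G \<phi> (range \<gamma>) = pointwise_stabilizer G \<phi> (set p)"
    and \<omega>: "\<omega> \<in> ultrafilters X" and v: "v \<in> W"
  shows "\<exists>m. \<forall>g\<in>H. (\<forall>e\<in>vbox n m. \<phi> g (shift e \<omega> v) = shift e \<omega> v) \<longrightarrow> \<alpha> g \<omega> = \<omega>"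
proof -
  define ray where "ray i k = v(i := (flow \<omega> i ^^ k) (v i))" for i k
  have ray: "ray i k \<in> W" if "i < n" for i k
    unfolding ray_def by (rule W_upd[OF v that funpow_flow_in[OF \<omega> that W_in[OF v that]]])
  have "\<exists>m. \<forall>g\<in>carrier G. (\<forall>k\<le>m. \<phi> g (ray i k) = ray i k) \<longrightarrow> (\<forall>k. \<phi> g (ray i k) = ray i k)"
    if i: "i < n" for i
  proof (cases "\<exists>k. flow \<omega> i ((flow \<omega> i ^^ k) (v i)) = (flow \<omega> i ^^ k) (v i)")
    \<comment> \<open>The flow reaches a sink after \<open>m\<close> steps. The orbit is then no
      geodesic ray, but it is constant from \<open>m\<close> on.\<close>
    case True
    then obtain m where m: "flow \<omega> i ((flow \<omega> i ^^ m) (v i)) = (flow \<omega> i ^^ m) (v i)"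
      by blast
    have "(flow \<omega> i ^^ (j + m)) (v i) = (flow \<omega> i ^^ m) (v i)" for j
      by (induction j) (simp_all add: m)
    then have "ray i k = ray i m" if "m \<le> k" for k
      unfolding ray_def using that by (metis le_add_diff_inverse2)
    then have "\<phi> g (ray i k) = ray i k" if "\<forall>k\<le>m. \<phi> g (ray i k) = ray i k" for g k
      using that by (metis linear order_refl)
    then show ?thesis
      by blast
  next
    case False
    then have "geodesic_ray W (cc_edges X) (ray i)"
      unfolding ray_def by (intro coordinate_ray_geodesic[OF \<omega> v i]) blast
    then obtain p where p: "initial_segment p (ray i)"
      and stab: "pointwise_stabilizer G \<phi> (range (ray i)) = pointwise_stabilizer G \<phi> (set p)"
      using rays by blast
    obtain m where m: "p = map (ray i) [0..<Suc m]"
      using p unfolding initial_segment_def by blast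
    have "\<phi> g (ray i k) = ray i k" if g: "g \<in> carrier G" and fixed: "\<forall>k\<le>m. \<phi> g (ray i k) = ray i k" for g k
    proof -
      have "g \<in> pointwise_stabilizer G \<phi> (set p)"
        unfolding pointwise_stabilizer_def stabilizer_def m using g fixed by auto
      then have "g \<in> pointwise_stabilizer G \<phi> (range (ray i))"
        unfolding stab .
      then show ?thesis
        unfolding pointwise_stabilizer_def stabilizer_def by blast
    qed
    then show ?thesis
      by blast
  qed
  then have "\<forall>i. \<exists>m. i < n \<longrightarrow> (\<forall>g\<in>carrier G. (\<forall>k\<le>m. \<phi> g (ray i k) = ray i k) \<longrightarrow> (\<forall>k. \<phi> g (ray i k) = ray i k))"
    by blast
  from choice[OF this] obtain m where m: "\<And>i g k. i < n \<Longrightarrow> g \<in> carrier G \<Longrightarrow>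
      (\<forall>k\<le>m i. \<phi> g (ray i k) = ray i k) \<Longrightarrow> \<phi> g (ray i k) = ray i k"
    by blast
  define M where "M = (\<Sum>i<n. m i)"
  have mM: "m i \<le> M" if "i < n" for i
    unfolding M_def using that by (intro member_le_sum) auto
  have "\<alpha> g \<omega> = \<omega>" if g: "g \<in> H" and fixed: "\<forall>e\<in>vbox n M. \<phi> g (shift e \<omega> v) = shift e \<omega> v" for g
  proof -
    note gc = H_carrier[OF g]
    have fix_ray: "\<phi> g (ray i k) = ray i k" if i: "i < n" for i k
    proof (rule m[OF i gc], intro allI impI)
      fix k assume "k \<le> m i"
      then have "unit i k \<in> vbox n M"
        using unit_in_vbox[OF i] mM[OF i] order_trans by blast
      then show "\<phi> g (ray i k) = ray i k"
        using fixed shift_unit[OF \<omega> v i, of k] unfolding ray_def by metis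
    qed
    have fix_shift: "\<phi> g (shift e \<omega> v) = shift e \<omega> v" for e
    proof (rule W_eqI[OF \<phi>_in[OF gc shift_in_W[OF \<omega> v]] shift_in_W[OF \<omega> v]])
      fix i assume i: "i < n"
      have "\<phi> g (shift e \<omega> v) i = \<phi> g (ray i (e i)) i"
        by (rule splits_agree[OF H_splits[OF g] shift_in_W[OF \<omega> v] ray[OF i] i])
          (simp add: ray_def shift_apply[OF i])
      also have "\<dots> = shift e \<omega> v i"
        unfolding fix_ray[OF i] by (simp add: ray_def shift_apply[OF i])
      finally show "\<phi> g (shift e \<omega> v) i = shift e \<omega> v i" .
    qed
    \<comment> \<open>With \<open>v\<close> itself fixed, equivariance computes the shifts of
      \<open>v\<close> under \<open>\<alpha> g \<omega>\<close>.\<close>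
    have "\<phi> g v = v"
      using fix_shift[of 0] unfolding shift_0[OF \<omega> v] .
    then have "shift e (\<alpha> g \<omega>) v = shift e \<omega> v" for e
      using shift_equivariant[OF g \<omega> v, of e] fix_shift[of e] by simp
    then show ?thesis
      by (rule shift_determines[OF \<alpha>_ultrafilter[OF gc \<omega>] \<omega> v])
  qed
  then show ?thesis
    by blast
qed

end

section \<open>Measurability\<close>

lemma space_borel_of_topology: "space (borel_of_topology T) = topspace T"
  unfolding borel_of_topology_def by (rule space_measure_of) (use openin_subset in blast)

lemma openin_borel_of_topology: "openin T U \<Longrightarrow> U \<in> sets (borel_of_topology T)"
  unfolding borel_of_topology_def using openin_subset by (intro in_measure_of) auto

lemma measurable_borel_of_topology:
  assumes "continuous_map S T f"
  shows "f \<in> measurable (borel_of_topology S) (borel_of_topology T)"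
  unfolding borel_of_topology_def[of T]
proof (rule measurable_measure_of)
  show "{U. openin T U} \<subseteq> Pow (topspace T)"
    using openin_subset by blast
  show "f \<in> space (borel_of_topology S) \<rightarrow> topspace T"
    using assms by (simp add: space_borel_of_topology continuous_map_def)
  fix U assume "U \<in> {U. openin T U}"
  then have "openin S {x \<in> topspace S. f x \<in> U}"
    using openin_continuous_map_preimage[OF assms] by blast
  moreover have "f -` U \<inter> space (borel_of_topology S) = {x \<in> topspace S. f x \<in> U}"
    unfolding space_borel_of_topology by blast
  ultimately show "f -` U \<inter> space (borel_of_topology S) \<in> sets (borel_of_topology S)"
    using openin_borel_of_topology by simp
qed

lemma measurable_to_count_space:
  assumes "continuous_map S (discrete_topology A) f" "countable A"
  shows "f \<in> measurable (borel_of_topology S) (count_space A)"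
  unfolding measurable_count_space_eq_countable[OF assms(2)]
proof (intro conjI ballI)
  show "f \<in> space (borel_of_topology S) \<rightarrow> A"
    using assms(1) by (simp add: space_borel_of_topology continuous_map_def)
  fix a assume "a \<in> A"
  then have "openin S {x \<in> topspace S. f x \<in> {a}}"
    by (intro openin_continuous_map_preimage[OF assms(1)]) simp
  moreover have "f -` {a} \<inter> space (borel_of_topology S) = {x \<in> topspace S. f x \<in> {a}}"
    unfolding space_borel_of_topology by blast
  ultimately show "f -` {a} \<inter> space (borel_of_topology S) \<in> sets (borel_of_topology S)"
    using openin_borel_of_topology by simp
qed

context tree_product begin

lemma topspace_roller: "topspace (roller_topology X) = ultrafilters X"
  unfolding roller_topology_def ultrafilters_def by auto

lemma space_boundary: "space (roller_boundary_borel X) = roller_boundary X"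
  unfolding roller_boundary_borel_def space_restrict_space space_borel_of_topology topspace_roller
  by (auto simp: roller_boundary_def)

lemma continuous_coordinate:
  "h \<in> hyperplanes X \<Longrightarrow> continuous_map (roller_topology X) (discrete_topology (halfspaces X h)) (\<lambda>\<omega>. \<omega> h)"
  unfolding roller_topology_def
  by (intro continuous_map_from_subtopology continuous_map_product_projection)

lemma countable_halfspaces:
  assumes "h \<in> hyperplanes X"
  shows "countable (halfspaces X h)"
proof -
  obtain i a b where "i < n" "{a, b} \<in> E i" "h = HP i a b"
    using assms by (rule hyperplane_cases)
  then show ?thesis
    by (simp add: halfspaces_HP)
qed

lemma coordinate_measurable:
  assumes "h \<in> hyperplanes X"
  shows "(\<lambda>\<omega>. \<omega> h) \<in> measurable (roller_boundary_borel X) (count_space (halfspaces X h))"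
  unfolding roller_boundary_borel_def
  by (intro measurable_restrict_space1 measurable_to_count_space continuous_coordinate
      countable_halfspaces assms)

lemma space_ultrafilter: "\<omega> \<in> space (roller_boundary_borel X) \<Longrightarrow> \<omega> \<in> ultrafilters X"
  unfolding space_boundary roller_boundary_def by blast

lemma points_pred:
  assumes i: "i < n"
  shows "{\<omega> \<in> space (roller_boundary_borel X). points \<omega> i a b} \<in> sets (roller_boundary_borel X)"
proof (cases "{a, b} \<in> E i")
  case True
  have h: "HP i a b \<in> hyperplanes X"
    by (rule HP_in_hyperplanes[OF i True])
  have "(\<lambda>\<omega>. \<omega> (HP i a b)) -` {Hs i a b} \<inter> space (roller_boundary_borel X) \<in> sets (roller_boundary_borel X)"
    by (rule measurable_sets[OF coordinate_measurable[OF h]]) (simp add: halfspaces_HP[OF i True])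
  moreover have "{\<omega> \<in> space (roller_boundary_borel X). points \<omega> i a b} =
      (\<lambda>\<omega>. \<omega> (HP i a b)) -` {Hs i a b} \<inter> space (roller_boundary_borel X)"
    unfolding points_def using True by blast
  ultimately show ?thesis
    by simp
qed (simp add: points_def)

text \<open>A value other than \<open>a\<close> is a condition on a single coordinate of
  \<open>\<omega>\<close>. The value \<open>a\<close> is the complement of countably many such
  conditions.\<close>

lemma flow_measurable:
  assumes i: "i < n" and V: "countable (V i)" and a: "a \<in> V i"
  shows "(\<lambda>\<omega>. flow \<omega> i a) \<in> measurable (roller_boundary_borel X) (count_space (V i))"
  unfolding measurable_count_space_eq_countable[OF V]
proof (intro conjI ballI)
  let ?M = "roller_boundary_borel X"
  show "(\<lambda>\<omega>. flow \<omega> i a) \<in> space ?M \<rightarrow> V i"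
    using flow_in[OF space_ultrafilter i a] by blast
  fix b assume b: "b \<in> V i"
  have other: "(\<lambda>\<omega>. flow \<omega> i a) -` {c} \<inter> space ?M \<in> sets ?M" if "c \<noteq> a" for c
  proof -
    have "(\<lambda>\<omega>. flow \<omega> i a) -` {c} \<inter> space ?M = {\<omega> \<in> space ?M. points \<omega> i a c}"
      using flow_iff[OF space_ultrafilter i not_sym[OF that]] by auto
    then show ?thesis
      using points_pred[OF i] by simp
  qed
  show "(\<lambda>\<omega>. flow \<omega> i a) -` {b} \<inter> space ?M \<in> sets ?M"
  proof (cases "b = a")
    case True
    have "(\<lambda>\<omega>. flow \<omega> i a) -` {b} \<inter> space ?M =
        space ?M - (\<Union>c\<in>V i - {a}. (\<lambda>\<omega>. flow \<omega> i a) -` {c} \<inter> space ?M)"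
      using flow_in[OF space_ultrafilter i a] True by blast
    moreover have "(\<Union>c\<in>V i - {a}. (\<lambda>\<omega>. flow \<omega> i a) -` {c} \<inter> space ?M) \<in> sets ?M"
      using V other by (intro sets.countable_UN') auto
    ultimately show ?thesis
      by (simp add: sets.compl_sets)
  qed (rule other)
qed

lemma shift_measurable:
  assumes V: "\<And>i. i < n \<Longrightarrow> countable (V i)" and v: "v \<in> W"
  shows "(\<lambda>\<omega>. shift e \<omega> v) \<in> measurable (roller_boundary_borel X) (count_space W)"
proof -
  let ?M = "roller_boundary_borel X"
  have pow: "(\<lambda>\<omega>. (flow \<omega> i ^^ k) a) \<in> measurable ?M (count_space (V i))"
    if i: "i < n" and a: "a \<in> V i" for i k a
  proof (induction k)
    case 0
    show ?case
      using a by simp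
  next
    case (Suc k)
    have "(\<lambda>\<omega>. flow \<omega> i ((flow \<omega> i ^^ k) a)) \<in> measurable ?M (count_space (V i))"
      by (rule measurable_compose_countable'[where g = "\<lambda>\<omega>. (flow \<omega> i ^^ k) a" and f = "\<lambda>b \<omega>. flow \<omega> i b",
            OF flow_measurable[OF i V[OF i]] Suc.IH V[OF i]])
    then show ?case
      by simp
  qed
  have W: "countable W"
    unfolding W_def using V by (intro countable_PiE) auto
  show ?thesis
    unfolding measurable_count_space_eq_countable[OF W]
  proof (intro conjI ballI)
    show "(\<lambda>\<omega>. shift e \<omega> v) \<in> space ?M \<rightarrow> W"
      using shift_in_W[OF space_ultrafilter v] by blast
    fix u assume u: "u \<in> W"
    have "Measurable.pred ?M (\<lambda>\<omega>. \<forall>i\<in>{..<n}. (flow \<omega> i ^^ e i) (v i) = u i)"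
    proof (rule pred_ball_countable)
      fix i assume "i \<in> {..<n}"
      then have i: "i < n"
        by simp
      show "Measurable.pred ?M (\<lambda>\<omega>. (flow \<omega> i ^^ e i) (v i) = u i)"
        by (rule pred_eq_count_space[OF pow[OF i W_in[OF v i]] _ V[OF i]]) (use W_in[OF u i] in simp)
    qed simp
    then have "{\<omega> \<in> space ?M. \<forall>i\<in>{..<n}. (flow \<omega> i ^^ e i) (v i) = u i} \<in> sets ?M"
      by (simp add: pred_def)
    moreover have "(\<lambda>\<omega>. shift e \<omega> v) -` {u} \<inter> space ?M =
        {\<omega> \<in> space ?M. \<forall>i\<in>{..<n}. (flow \<omega> i ^^ e i) (v i) = u i}"
    proof (intro Set.set_eqI iffI)
      fix \<omega> assume "\<omega> \<in> (\<lambda>\<omega>. shift e \<omega> v) -` {u} \<inter> space ?M"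
      then show "\<omega> \<in> {\<omega> \<in> space ?M. \<forall>i\<in>{..<n}. (flow \<omega> i ^^ e i) (v i) = u i}"
        by (auto simp: shift_apply)
    next
      fix \<omega> assume \<omega>: "\<omega> \<in> {\<omega> \<in> space ?M. \<forall>i\<in>{..<n}. (flow \<omega> i ^^ e i) (v i) = u i}"
      have "shift e \<omega> v = u"
        by (rule W_eqI[OF shift_in_W[OF space_ultrafilter v] u]) (use \<omega> in \<open>auto simp: shift_apply\<close>)
      then show "\<omega> \<in> (\<lambda>\<omega>. shift e \<omega> v) -` {u} \<inter> space ?M"
        using \<omega> by simp
    qed
    ultimately show "(\<lambda>\<omega>. shift e \<omega> v) -` {u} \<inter> space ?M \<in> sets ?M"
      by simp
  qed
qed

end

context product_action begin

text \<open>The action is continuous: coordinate \<open>h\<close> of the image depends only on the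
  coordinate of the hyperplane that \<open>g\<close> carries to \<open>h\<close>.\<close>

lemma \<alpha>_measurable:
  assumes g: "g \<in> carrier G"
  shows "\<alpha> g \<in> measurable (roller_boundary_borel X) (roller_boundary_borel X)"
proof -
  let ?T = "roller_topology X"
  have "continuous_map ?T (product_topology (\<lambda>h. discrete_topology (halfspaces X h)) (hyperplanes X)) (\<alpha> g)"
    unfolding continuous_map_componentwise
  proof (intro conjI ballI)
    show "\<alpha> g ` topspace ?T \<subseteq> extensional (hyperplanes X)"
      unfolding roller_action_def by auto
    fix h assume h: "h \<in> hyperplanes X"
    define k where "k = (`) (\<phi> (inv g)) ` h"
    have k: "k \<in> hyperplanes X"
      unfolding k_def by (rule image_hyperplane[OF inv_closed[OF g] h])
    have "(`) (\<phi> g) ` k = h"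
      unfolding k_def using image_hyperplane_inv[OF inv_closed[OF g] h] g by simp
    then have "continuous_map (discrete_topology (halfspaces X k)) (discrete_topology (halfspaces X h)) ((`) (\<phi> g))"
      using image_halfspace[OF g k] by auto
    from continuous_map_compose[OF continuous_coordinate[OF k] this]
    have "continuous_map ?T (discrete_topology (halfspaces X h)) (\<lambda>\<omega>. \<phi> g ` \<omega> k)"
      by (simp only: o_def)
    moreover have "\<alpha> g \<omega> h = \<phi> g ` \<omega> k" for \<omega>
      unfolding k_def by (rule \<alpha>_apply[OF h])
    ultimately show "continuous_map ?T (discrete_topology (halfspaces X h)) (\<lambda>\<omega>. \<alpha> g \<omega> h)"
      by (simp only:)
  qed
  then have "continuous_map ?T ?T (\<alpha> g)"
    using \<alpha>_ultrafilter[OF g] unfolding topspace_roller[symmetric]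
    by (subst (2) roller_topology_def) (simp add: continuous_map_in_subtopology topspace_roller)
  then show ?thesis
    unfolding roller_boundary_borel_def
    by (intro measurable_restrict_space3 measurable_borel_of_topology) (use \<alpha>_boundary[OF g] in auto)
qed

text \<open>The shift system is set up over \<open>H\<close>, whose elements commute with the
  shifts. Finite index and finitely many classes in each \<open>H\<close>-orbit combine to the
  hypothesis of \<open>hyperfinite_if_finite_index\<close>.\<close>

theorem hyperfinite_boundary_action:
  assumes countable: "countable (carrier G)"
    and ulf: "\<And>i. i < n \<Longrightarrow> uniformly_locally_finite (V i) (E i)"
    and rays: "\<And>\<gamma>. geodesic_ray W (cc_edges X) \<gamma> \<Longrightarrow>
      \<exists>p. initial_segment p \<gamma> \<and> pointwise_stabilizer G \<phi> (range \<gamma>) = pointwise_stabilizer G \<phi> (set p)"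
  shows "hyperfinite (roller_boundary_borel X) (orbit_equivalence G (roller_boundary X) \<alpha>)"
proof -
  let ?M = "roller_boundary_borel X"
  let ?H = "G\<lparr>carrier := H\<rparr>"
  have V: "countable (V i)" if "i < n" for i
    by (rule tree.countable_vertices[OF tree_factor[OF that] ulf[OF that]])
  obtain deg where deg: "\<And>t w. w \<in> W \<Longrightarrow> nb t w \<subseteq> W \<and> finite (nb t w) \<and> card (nb t w) \<le> deg t"
    using nb_bound[OF ulf] by blast
  obtain base where base: "base \<in> W"
    using W_nonempty by blast
  interpret S: shift_system ?H ?M W \<alpha> \<phi> n shift nb deg base
  proof (intro shift_system.intro shift_system_axioms.intro)
    show "Group.group ?H"
      by (rule subgroup.subgroup_is_group[OF H_subgroup is_group])
    show "countable (carrier ?H)"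
      using countable H_carrier by (auto intro: countable_subset)
    show "countable W"
      by (rule countable_W[OF ulf])
    show "base \<in> W"
      by (rule base)
  next
    fix x assume "x \<in> space ?M"
    then have x: "x \<in> ultrafilters X"
      by (rule space_ultrafilter)
    show "\<alpha> \<one>\<^bsub>?H\<^esub> x = x"
      using \<alpha>_one[OF x] by simp
    fix g assume "g \<in> carrier ?H"
    then have g: "g \<in> H" "g \<in> carrier G"
      using H_carrier by simp_all
    show "\<alpha> (g \<otimes>\<^bsub>?H\<^esub> h) x = \<alpha> g (\<alpha> h x)" if "h \<in> carrier ?H" for h
      using \<alpha>_mult[OF g(2) _ x] H_carrier that by simp
    show "shift e (\<alpha> g x) (\<phi> g w) = \<phi> g (shift e x w)" if "w \<in> W" for e w
      by (rule shift_equivariant[OF g(1) x that])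
  next
    fix x w assume "x \<in> space ?M"
    then have x: "x \<in> ultrafilters X"
      by (rule space_ultrafilter)
    assume w: "w \<in> W"
    show "shift e x w \<in> W" for e
      by (rule shift_in_W[OF x w])
    show "shift 0 x w = w"
      by (rule shift_0[OF x w])
    show "shift (e + f) x w = shift e x (shift f x w)" for e f
      by (rule shift_plus)
    show "shift f x w \<in> nb t (shift e x w)" if "e \<in> vbox n t" "f \<in> vbox n t" for e f t
      by (rule shift_in_nb[OF x w that])
    show "\<exists>t. \<exists>e\<in>vbox n t. \<exists>f\<in>vbox n t. shift e x w = shift f x v" if "v \<in> W" for v
      by (rule shift_merge[OF x w that])
    show "\<exists>m. \<forall>g\<in>carrier ?H. (\<forall>e\<in>vbox n m. \<phi> g (shift e x w) = shift e x w) \<longrightarrow> \<alpha> g x = x"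
      using stabilizing[OF rays x w] by simp
    show "x = y" if "y \<in> space ?M" "\<And>t e. e \<in> vbox n t \<Longrightarrow> shift e x w = shift e y w" for y
      by (rule shift_determines[OF x space_ultrafilter[OF that(1)] w that(2)])
  next
    fix g assume "g \<in> carrier ?H"
    then have g: "g \<in> carrier G"
      using H_carrier by simp
    show "\<alpha> g \<in> measurable ?M ?M"
      by (rule \<alpha>_measurable[OF g])
    show "\<phi> g w \<in> W" if "w \<in> W" for w
      by (rule \<phi>_in[OF g that])
    show "\<phi> (g \<otimes>\<^bsub>?H\<^esub> h) w = \<phi> g (\<phi> h w)" if "h \<in> carrier ?H" "w \<in> W" for h w
      using \<phi>_mult[OF g _ that(2)] H_carrier that(1) by simp
    show "\<phi> g v \<in> nb t (\<phi> g w)" if "v \<in> nb t w" for v t w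
      by (rule nb_equivariant[OF g that])
  next
    fix w assume w: "w \<in> W"
    show "\<phi> \<one>\<^bsub>?H\<^esub> w = w"
      using \<phi>_one[OF w] by simp
    show "(\<lambda>x. shift e x w) \<in> measurable ?M (count_space W)" for e
      by (rule shift_measurable[OF V w])
    show "nb t w \<subseteq> W" "finite (nb t w)" "card (nb t w) \<le> deg t" for t
      using deg[OF w] by blast+
  qed
  \<comment> \<open>Index 0 is reserved for the identity; the enumeration of \<open>G\<close> starts
    at index 1.\<close>
  define a where "a i = \<alpha> (case i of 0 \<Rightarrow> \<one> | Suc j \<Rightarrow> from_nat_into (carrier G) j)" for i :: nat
  have a_carrier: "(case i of 0 \<Rightarrow> \<one> | Suc j \<Rightarrow> from_nat_into (carrier G) j) \<in> carrier G" for i :: nat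
    by (cases i) (auto intro: from_nat_into)
  have a_range: "range (\<lambda>i. a i x) = (\<lambda>g. \<alpha> g x) ` carrier G" for x
  proof
    show "range (\<lambda>i. a i x) \<subseteq> (\<lambda>g. \<alpha> g x) ` carrier G"
      unfolding a_def using a_carrier by blast
    show "(\<lambda>g. \<alpha> g x) ` carrier G \<subseteq> range (\<lambda>i. a i x)"
    proof
      fix y assume "y \<in> (\<lambda>g. \<alpha> g x) ` carrier G"
      then obtain g where g: "g \<in> carrier G" "y = \<alpha> g x"
        by blast
      obtain j where "from_nat_into (carrier G) j = g"
        using from_nat_into_surj[OF countable g(1)] by blast
      then have "y = a (Suc j) x"
        using g(2) by (simp add: a_def)
      then show "y \<in> range (\<lambda>i. a i x)"
        by blast
    qed
  qed
  let ?E = "orbit_equivalence G (roller_boundary X) \<alpha>"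
  have E_iff: "(x, y) \<in> ?E \<longleftrightarrow> x \<in> roller_boundary X \<and> (\<exists>g\<in>carrier G. \<alpha> g x = y)" for x y
    unfolding orbit_equivalence_def using \<alpha>_boundary by auto
  show ?thesis
  proof (rule hyperfinite_if_finite_index[where a = a and F = S.rel])
    show "equiv (space ?M) ?E"
      unfolding space_boundary
    proof (rule equivI)
      show "?E \<subseteq> roller_boundary X \<times> roller_boundary X"
        unfolding orbit_equivalence_def by blast
      show "refl_on (roller_boundary X) ?E"
        unfolding refl_on_def E_iff using \<alpha>_one[OF boundary_ultrafilter] one_closed by blast
      show "sym ?E"
      proof (rule symI)
        fix x y assume "(x, y) \<in> ?E"
        then obtain g where g: "x \<in> roller_boundary X" "g \<in> carrier G" "y = \<alpha> g x"
          unfolding E_iff by blast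
        have x: "x \<in> ultrafilters X"
          by (rule boundary_ultrafilter[OF g(1)])
        have "\<alpha> (inv g) y = x"
          using g(2,3) \<alpha>_mult[OF inv_closed[OF g(2)] g(2) x] \<alpha>_one[OF x] by simp
        then show "(y, x) \<in> ?E"
          unfolding E_iff g(3) using \<alpha>_boundary[OF g(2,1)] inv_closed[OF g(2)]
          by (intro conjI bexI[of _ "inv g"])
      qed
      show "trans ?E"
      proof (rule transI)
        fix x y z assume "(x, y) \<in> ?E" "(y, z) \<in> ?E"
        then obtain g h where g: "x \<in> roller_boundary X" "g \<in> carrier G" "y = \<alpha> g x"
          and h: "h \<in> carrier G" "z = \<alpha> h y"
          unfolding E_iff by blast
        have "\<alpha> (h \<otimes> g) x = z"
          using \<alpha>_mult[OF h(1) g(2) boundary_ultrafilter[OF g(1)]] g(3) h(2) by simp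
        then show "(x, z) \<in> ?E"
          unfolding E_iff using g(1) m_closed[OF h(1) g(2)] by blast
      qed
    qed
    show "a 0 x = x" if "x \<in> space ?M" for x
      unfolding a_def using \<alpha>_one[OF space_ultrafilter[OF that]] by simp
    show a_meas: "a i \<in> measurable ?M ?M" for i
      unfolding a_def by (rule \<alpha>_measurable[OF a_carrier])
    show "{(x, y) \<in> space ?M \<times> space ?M. a i x = y} \<in> sets (?M \<Otimes>\<^sub>M ?M)" for i
      by (rule S.graph_sets[OF a_meas])
    show "?E `` {x} = range (\<lambda>i. a i x)" if "x \<in> space ?M" for x
      unfolding a_range using that E_iff[of x] unfolding space_boundary by auto
    show "borel_equivalence ?M (S.rel k)" for k
      unfolding borel_equivalence_def by (rule conjI[OF S.rel_equiv S.rel_sets])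
    show "finite (S.rel k `` {x})" if "x \<in> space ?M" for k x
      by (rule S.rel_finite[OF that])
    show "S.rel k \<subseteq> S.rel (Suc k)" for k
      by (rule S.rel_Suc)
    show "S.rel k \<subseteq> ?E" for k
    proof (rule subrelI)
      fix x y assume xy: "(x, y) \<in> S.rel k"
      obtain g where "g \<in> H" "\<alpha> g x = y"
        using S.rel_orbit[OF xy] by auto
      moreover have "x \<in> roller_boundary X"
        using xy unfolding S.rel_def space_boundary by blast
      ultimately show "(x, y) \<in> ?E"
        unfolding E_iff using H_carrier by blast
    qed
    fix x assume x: "x \<in> space ?M"
    \<comment> \<open>The \<open>G\<close>-orbit of \<open>x\<close> is the union of the
      \<open>H\<close>-orbits of \<open>\<alpha> r x\<close> with \<open>r\<close> in
      \<open>R\<close>. Representatives of the finitely many classes in each of them form the finite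
      set \<open>B\<close> below.\<close>
    obtain R where R: "finite R" "R \<subseteq> carrier G" "\<And>g. g \<in> carrier G \<Longrightarrow> \<exists>h\<in>H. \<exists>r\<in>R. g = h \<otimes> r"
      using H_finite_index by blast
    have \<alpha>_space: "\<alpha> r x \<in> space ?M" if "r \<in> carrier G" for r
      using \<alpha>_boundary[OF that] x unfolding space_boundary by blast
    have "\<forall>r\<in>R. \<exists>A. finite A \<and> A \<subseteq> (\<lambda>g. \<alpha> g (\<alpha> r x)) ` H \<and>
        (\<forall>g\<in>H. \<exists>y\<in>A. \<exists>k. (y, \<alpha> g (\<alpha> r x)) \<in> S.rel k)"
    proof
      fix r assume "r \<in> R"
      then have "\<alpha> r x \<in> space ?M"
        using \<alpha>_space R(2) by blast
      from S.finitely_many_classes[OF this]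
      show "\<exists>A. finite A \<and> A \<subseteq> (\<lambda>g. \<alpha> g (\<alpha> r x)) ` H \<and>
          (\<forall>g\<in>H. \<exists>y\<in>A. \<exists>k. (y, \<alpha> g (\<alpha> r x)) \<in> S.rel k)"
        by simp
    qed
    from bchoice[OF this] obtain A where A: "\<forall>r\<in>R. finite (A r) \<and> A r \<subseteq> (\<lambda>g. \<alpha> g (\<alpha> r x)) ` H \<and>
        (\<forall>g\<in>H. \<exists>y\<in>A r. \<exists>k. (y, \<alpha> g (\<alpha> r x)) \<in> S.rel k)" ..
    define B where "B = (\<Union>r\<in>R. A r)"
    have "finite B"
      unfolding B_def using R(1) A by blast
    have x': "x \<in> ultrafilters X"
      by (rule space_ultrafilter[OF x])
    have prod: "\<alpha> h (\<alpha> r x) = \<alpha> (h \<otimes> r) x" if "h \<in> H" "r \<in> R" for h r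
    proof -
      have "h \<in> carrier G" "r \<in> carrier G"
        using that H_carrier R(2) by blast+
      then show ?thesis
        using \<alpha>_mult[OF _ _ x'] by simp
    qed
    have "\<exists>i. y = a i x" if y: "y \<in> B" for y
    proof -
      obtain r where r: "r \<in> R" "y \<in> A r"
        using y unfolding B_def by (rule UN_E)
      then obtain h where h: "h \<in> H" "y = \<alpha> h (\<alpha> r x)"
        using A by blast
      then have "y = \<alpha> (h \<otimes> r) x"
        using prod[OF h(1) r(1)] by simp
      moreover have "h \<otimes> r \<in> carrier G"
        using H_carrier[OF h(1)] R(2) r(1) by blast
      ultimately have "y \<in> (\<lambda>g. \<alpha> g x) ` carrier G"
        by blast
      then show ?thesis
        unfolding a_range[symmetric] by blast
    qed
    then have "\<forall>y\<in>B. \<exists>i. y = a i x"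
      by blast
    from bchoice[OF this] obtain ix where ix: "\<forall>y\<in>B. y = a (ix y) x" ..
    show "\<exists>N. \<forall>j. \<exists>i\<le>N. \<exists>k. (a i x, a j x) \<in> S.rel k"
    proof (rule exI[of _ "Max (ix ` B)"], rule allI)
      fix j
      have "a j x \<in> (\<lambda>g. \<alpha> g x) ` carrier G"
        unfolding a_range[symmetric] by blast
      then obtain g where g: "g \<in> carrier G" "a j x = \<alpha> g x"
        by blast
      obtain h r where hr: "h \<in> H" "r \<in> R" "g = h \<otimes> r"
        using R(3)[OF g(1)] by blast
      have "a j x = \<alpha> h (\<alpha> r x)"
        unfolding prod[OF hr(1,2)] using g(2) hr(3) by simp
      moreover obtain y k where y: "y \<in> A r" "(y, \<alpha> h (\<alpha> r x)) \<in> S.rel k"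
        using A hr(1,2) by blast
      moreover have "y \<in> B"
        unfolding B_def using hr(2) y(1) by blast
      moreover have "y = a (ix y) x"
        using ix \<open>y \<in> B\<close> by (rule bspec)
      ultimately have "(a (ix y) x, a j x) \<in> S.rel k"
        by simp
      moreover have "ix y \<le> Max (ix ` B)"
        using \<open>finite B\<close> \<open>y \<in> B\<close> by simp
      ultimately show "\<exists>i\<le>Max (ix ` B). \<exists>k. (a i x, a j x) \<in> S.rel k"
        by blast
    qed
  qed
qed

end

theorem theorem1p1:
  fixes G :: "('g, 'm) monoid_scheme"
    and n :: nat
    and V :: "nat \<Rightarrow> 'a set"
    and E :: "nat \<Rightarrow> 'a set set"
    and \<phi> :: "'g \<Rightarrow> (nat \<Rightarrow> 'a) \<Rightarrow> (nat \<Rightarrow> 'a)"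
  defines "X \<equiv> product_cubes n V E"
  assumes "group G" and "countable (carrier G)"
    and "n \<ge> 1"
    and "\<And>i. i < n \<Longrightarrow> tree_graph (V i) (E i)"
    and "\<And>i. i < n \<Longrightarrow> uniformly_locally_finite (V i) (E i)"
    and "cubical_action G X \<phi>"
    and "\<And>\<gamma>. geodesic_ray (cc_vertices X) (cc_edges X) \<gamma> \<Longrightarrow>
           \<exists>p. initial_segment p \<gamma> \<and>
             pointwise_stabilizer G \<phi> (range \<gamma>) = pointwise_stabilizer G \<phi> (set p)"
  shows "hyperfinite (roller_boundary_borel X)
           (orbit_equivalence G (roller_boundary X) (roller_action G X \<phi>))"
proof -
  interpret group G
    by fact
  interpret product_action n V E G \<phi>
    by unfold_locales (use assms(5,7) in \<open>simp_all add: X_def\<close>)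
  show ?thesis
    unfolding X_def
    by (rule hyperfinite_boundary_action) (use assms(3,6,8) in \<open>simp_all add: X_def vertices\<close>)
qed

end
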